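(* Let $n\ge 3$ and let $e_1,\dots,e_n$ be positive integers with $E=e_1e_2\cdots e_n\ge 2$. For every prime $p\ge 3E-2$, the group $G_{\mathbf F_p,n;e_1,\dots,e_n}$ has a quotient isomorphic to the alternating group $\mathrm{Alt}(d)$ for infinitely many integers $d$.
   Context: For a prime $p$, let $R_n=\mathbf F_p[x_1,\dots,x_n]$. For distinct $i,j$, integer $e\ge0$ and $r\in\mathbf F_p$, let $\alpha_{i;j}^{(e)}(r)\in\mathrm{Aut}(R_n)$ be the automorphism with $x_i\mapsto x_i+rx_j^e$ and $x_\ell\mapsto x_\ell$ for $\ell\neq i$. $G_{\mathbf F_p,n;e_1,\dots,e_n}$ is the subgroup of $\mathrm{Aut}(R_n)$ generated by $\alpha_{i;i+1}^{(e_i)}(1)$, $i=1,\dots,n$, indices modulo $n$ (equivalently by all $\alpha_{i;i+1}^{(e_i)}(r)$, $r\in\mathbf F_p$). *)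

theory Defs
  imports "HOL-Library.Poly_Mapping" "HOL-Algebra.Algebra"
begin

text \<open>Multivariate polynomials over a commutative ring 'a in variables x_k (k :: nat),
  represented as finitely supported maps from monomials (exponent vectors) to coefficients.\<close>
type_synonym 'a mpoly = "(nat \<Rightarrow>\<^sub>0 nat) \<Rightarrow>\<^sub>0 'a"

definition mp_const :: "'a::comm_semiring_1 \<Rightarrow> 'a mpoly" where
  "mp_const c = Poly_Mapping.single 0 c"

definition mp_var :: "nat \<Rightarrow> 'a::comm_semiring_1 mpoly" where
  "mp_var i = Poly_Mapping.single (Poly_Mapping.single i 1) 1"

definition mp_subst :: "(nat \<Rightarrow> 'a::comm_semiring_1 mpoly) \<Rightarrow> 'a mpoly \<Rightarrow> 'a mpoly" where
  "mp_subst \<sigma> P = (\<Sum>m\<in>Poly_Mapping.keys P. mp_const (Poly_Mapping.lookup P m) * (\<Prod>k\<in>Poly_Mapping.keys m. \<sigma> k ^ Poly_Mapping.lookup m k))"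

text \<open>R_n = polynomials in x_0, ..., x_(n-1) (0-based indexing of x_1..x_n).\<close>
definition poly_ring :: "nat \<Rightarrow> 'a::comm_semiring_1 mpoly set" where
  "poly_ring n = {P. \<forall>m\<in>Poly_Mapping.keys P. Poly_Mapping.keys m \<subseteq> {..<n}}"

definition elem_aut :: "nat \<Rightarrow> nat \<Rightarrow> nat \<Rightarrow> nat \<Rightarrow> 'a::comm_semiring_1 \<Rightarrow> 'a mpoly \<Rightarrow> 'a mpoly" where
  "elem_aut n i j e r = restrict
     (mp_subst (\<lambda>k. if k = i then mp_var i + mp_const r * mp_var j ^ e else mp_var k))
     (poly_ring n)"

definition G_group :: "nat \<Rightarrow> (nat \<Rightarrow> nat) \<Rightarrow> ('a::comm_semiring_1 mpoly \<Rightarrow> 'a mpoly) monoid" where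
  "G_group n e = (BijGroup (poly_ring n))
     \<lparr>carrier := generate (BijGroup (poly_ring n))
                   {elem_aut n i (Suc i mod n) (e i) 1 | i. i < n}\<rparr>"

end

theory Submission
  imports Defs "HOL-Algebra.Algebraic_Closure_Type"
begin

text \<open>
  Let \<open>K\<close> be the field with \<open>p ^ m\<close> elements, \<open>m\<close> a large prime, and \<open>F\<close> its prime field. The group acts on
  \<open>K\<^sup>n\<close> by substitution and commutes with the finite group \<open>\<Gamma>\<close> generated by Frobenius and the maps
  \<open>x\<^sub>i \<mapsto> l ^ w i * x\<^sub>i\<close> with \<open>l ^ (E - 1) = 1\<close>, where \<open>w i = e i * e (i+1) * ... * e (n-1)\<close>. As \<open>m\<close> is prime
  and \<open>m \<ge> E\<close>, \<open>\<Gamma>\<close> acts freely on \<open>K - F\<close> in every coordinate. The group induces exactly the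
  alternating group on the \<open>\<Gamma>\<close>-orbits of \<open>K\<^sup>n - F\<^sup>n\<close>, and there are at least \<open>m\<close> of them.

  Commutators produce shears \<open>x\<^sub>i \<mapsto> x\<^sub>i + x\<^sub>j ^ a\<close> for \<open>a = arc i j + (E - 1) * t\<close> with arbitrary \<open>t\<close>; extracting a
  single term of a binomial expansion only needs \<open>E < p\<close>. Interpolation then gives shears by an
  equivariant function of \<open>x\<^sub>j\<close> supported on one \<open>\<Gamma>\<close>-orbit, and further commutators give shears by
  functions of all other coordinates supported on only two orbits. Two such shears in different directions
  whose supports share a single orbit have a 3-cycle as commutator. Every shear by \<open>f\<close> is the square of
  the shear by \<open>f / 2\<close>, so all induced permutations are even.
\<close>

section \<open>3-cycles\<close>

text \<open>A group element commutes with \<Gamma>, so moving one point moves its whole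
  \<Gamma>-orbit in the same way; 3-cycles can only be expected on orbits. Freeness outside
  \<open>F\<close> is what allows a value prescribed at one point to be extended equivariantly along
  the orbit. The obstacle is localisation: a commutator of shears in directions i and j is a shear
  in direction i by a difference \<open>f(x + shift) - f(x)\<close>, whose sum over all values of
  coordinate j is zero. A single commutator therefore cannot isolate one orbit, and pairs of
  opposite bumps take the place of single ones. The assumption n \<ge> 3 supplies a third
  coordinate, used both for the detour that raises exponents and for keeping apart the second bumps
  of the two shears. The degree d is not computed: d \<ge> m is enough, because m can be taken
  beyond any bound.\<close>

definition cyc3 :: "'x \<Rightarrow> 'x \<Rightarrow> 'x \<Rightarrow> 'x \<Rightarrow> 'x" where
  "cyc3 a b c = transpose a b \<circ> transpose b c"

lemma cyc3_apply:
  assumes "distinct [a, b, c]"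
  shows "cyc3 a b c x = (if x = a then b else if x = b then c else if x = c then a else x)"
  using assms by (auto simp: cyc3_def transpose_def)

lemma cyc3_rotate: "distinct [a, b, c] \<Longrightarrow> cyc3 b c a = cyc3 a b c"
  by (rule ext) (auto simp: cyc3_apply)

lemma inv_cyc3: "distinct [a, b, c] \<Longrightarrow> inv' (cyc3 a b c) = cyc3 c b a"
  by (rule inv_unique_comp) (auto simp: fun_eq_iff cyc3_apply split: if_splits)

lemma cyc3_conj:
  assumes "bij f" "distinct [a, b, c]"
  shows "f \<circ> cyc3 a b c \<circ> inv' f = cyc3 (f a) (f b) (f c)"
proof
  fix x
  obtain y where y: "x = f y" using assms(1) by (metis bij_pointE)
  have i: "inj f" using assms(1) by (rule bij_is_inj)
  have "distinct [f a, f b, f c]" using assms(2) inj_eq[OF i] by auto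
  then show "(f \<circ> cyc3 a b c \<circ> inv' f) x = cyc3 (f a) (f b) (f c) x"
    using assms(2) by (auto simp: y cyc3_apply inv_f_f[OF i] inj_eq[OF i])
qed

text \<open>As only \<open>P\<close> is moved by both, \<open>r\<close> fixes \<open>s P\<close> and
  \<open>s\<close> fixes \<open>r P\<close>. Then \<open>s \<circ> r\<close> and
  \<open>r \<circ> s\<close> differ only at \<open>P\<close> and at the preimages of
  \<open>P\<close> under \<open>s\<close> and \<open>r\<close>, and there they differ by the stated
  3-cycle.\<close>

lemma commutator_eq_cyc3:
  assumes s: "bij s" and r: "bij r" and P: "s P \<noteq> P" "r P \<noteq> P"
    and meet: "\<And>x. s x \<noteq> x \<Longrightarrow> r x \<noteq> x \<Longrightarrow> x = P"
  shows "distinct [P, s P, r P]" "s \<circ> r \<circ> inv' s \<circ> inv' r = cyc3 P (s P) (r P)"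
proof -
  note js = bij_is_inj[OF s] and ir = bij_is_inj[OF r]
  have r_sP: "r (s P) = s P" and s_rP: "s (r P) = r P"
    using meet[of "s P"] meet[of "r P"] P inj_eq[OF js] inj_eq[OF ir] by metis+
  show d: "distinct [P, s P, r P]"
    using P r_sP inj_eq[OF ir] by auto
  have "s (r x) = cyc3 P (s P) (r P) (r (s x))" for x
  proof (cases "s x = x \<or> r x = x")
    case False
    then have "x = P" using meet by blast
    then show ?thesis using d by (auto simp: cyc3_apply r_sP s_rP)
  next
    case True
    show ?thesis
    proof (cases "s x = P")
      case True': True
      then have "r x = x" using P(1) True by metis
      moreover have "x \<noteq> P" using True' P by auto
      ultimately show ?thesis using d True' by (auto simp: cyc3_apply)
    next
      case a: False
      show ?thesis
      proof (cases "r x = P")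
        case r_x: True
        then have "s x = x" "x \<noteq> P" using P(2) True by metis+
        then show ?thesis using d r_x by (auto simp: cyc3_apply)
      next
        case b: False
        show ?thesis
        proof (cases "x = P")
          case True then show ?thesis using d by (auto simp: cyc3_apply r_sP s_rP)
        next
          case c: False
          have "s (r x) = r (s x)"
          proof (cases "s x = x")
            case sx: True
            then have "s (r x) = r x"
            proof (cases "r x = x")
              case rx: False
              then have "r (r x) \<noteq> r x" using inj_eq[OF ir] by auto
              then show ?thesis using meet b by blast
            qed (use sx in auto)
            then show ?thesis using sx by simp
          next
            case sx: False
            then have rx: "r x = x" using True by simp
            from sx have "s (s x) \<noteq> s x" using inj_eq[OF js] by auto
            then have "r (s x) = s x" using meet a by blast
            then show ?thesis using rx by simp
          qed
          \<comment> \<open>Since \<open>x\<close>, \<open>s x\<close> and \<open>r x\<close> all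
            differ from \<open>P\<close>, the common value is a point that the 3-cycle
            fixes.\<close>
          moreover have "r (s x) \<noteq> P" "r (s x) \<noteq> s P" "r (s x) \<noteq> r P"
          proof -
            show "r (s x) \<noteq> r P" using a inj_eq[OF ir] by auto
            show "r (s x) \<noteq> s P" using c r_sP inj_eq[OF ir] inj_eq[OF js] by metis
            show "r (s x) \<noteq> P"
            proof
              assume *: "r (s x) = P"
              show False
              proof (cases "s x = x")
                case True then show False using * b by simp
              next
                case False
                then have "s (s x) \<noteq> s x" using inj_eq[OF js] by auto
                then have "r (s x) = s x" using meet a by blast
                then show False using * a by simp
              qed
            qed
          qed
          ultimately show ?thesis using d by (auto simp: cyc3_apply)
        qed
      qed
    qed
  qed
  then have "s \<circ> r = cyc3 P (s P) (r P) \<circ> (r \<circ> s)" by (simp add: fun_eq_iff)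
  then have "s \<circ> r \<circ> (inv' s \<circ> inv' r) = cyc3 P (s P) (r P) \<circ> ((r \<circ> s) \<circ> (inv' s \<circ> inv' r))"
    by (simp add: comp_assoc)
  also have "(r \<circ> s) \<circ> (inv' s \<circ> inv' r) = id"
    using s r by (simp add: fun_eq_iff surj_f_inv_f[OF bij_is_surj])
  finally show "s \<circ> r \<circ> inv' s \<circ> inv' r = cyc3 P (s P) (r P)" by (simp add: comp_def)
qed

locale perm_group =
  fixes S :: "'x set" and H :: "('x \<Rightarrow> 'x) set"
  assumes permutes: "f \<in> H \<Longrightarrow> f permutes S"
    and comp_closed: "f \<in> H \<Longrightarrow> g \<in> H \<Longrightarrow> f \<circ> g \<in> H"
    and inv_closed: "f \<in> H \<Longrightarrow> inv' f \<in> H"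
    and id_closed: "id \<in> H"
begin

text \<open>This relation is an equivalence preserved by \<open>H\<close>, and \<open>H\<close>
  contains every 3-cycle inside a class. Finding all 3-cycles thus becomes a question of
  connectedness.\<close>

definition linked :: "'x \<Rightarrow> 'x \<Rightarrow> bool" where
  "linked a b \<longleftrightarrow> a = b \<or> (\<exists>c. distinct [a, b, c] \<and> cyc3 a b c \<in> H)"

lemma conj_closed: "f \<in> H \<Longrightarrow> g \<in> H \<Longrightarrow> f \<circ> g \<circ> inv' f \<in> H"
  by (intro comp_closed inv_closed)

lemma cyc3_image_closed:
  assumes "f \<in> H" "distinct [a, b, c]" "cyc3 a b c \<in> H"
  shows "cyc3 (f a) (f b) (f c) \<in> H"
  using conj_closed[OF assms(1,3)] cyc3_conj[OF permutes_bij[OF permutes[OF assms(1)]] assms(2)]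
  by simp

lemma cyc3_reverse_closed: "distinct [a, b, c] \<Longrightarrow> cyc3 a b c \<in> H \<Longrightarrow> cyc3 c b a \<in> H"
  using inv_closed inv_cyc3 by metis

lemma linked_image:
  assumes "f \<in> H" "linked a b"
  shows "linked (f a) (f b)"
proof (cases "a = b")
  case False
  then obtain c where c: "distinct [a, b, c]" "cyc3 a b c \<in> H"
    using assms(2) by (auto simp: linked_def)
  have "inj f" using assms(1) permutes permutes_inj by blast
  then have "distinct [f a, f b, f c]" using c(1) by (simp add: inj_eq)
  then show ?thesis using cyc3_image_closed[OF assms(1) c] unfolding linked_def by blast
qed (simp add: linked_def)

lemma linked_sym:
  assumes "linked a b"
  shows "linked b a"
proof (cases "a = b")
  case False
  then obtain c where c: "distinct [a, b, c]" "cyc3 a b c \<in> H"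
    using assms by (auto simp: linked_def)
  then have "cyc3 b a c \<in> H"
    using cyc3_reverse_closed[OF c] cyc3_rotate[of c b a] by auto
  then show ?thesis using c(1) unfolding linked_def by auto
qed (simp add: linked_def)

text \<open>The inverse \<open>?f\<close> of \<open>cyc3 a b x\<close> sends \<open>b\<close> to
  \<open>a\<close> and fixes \<open>c\<close> unless \<open>c = x\<close>, so it carries the link
  between \<open>b\<close> and \<open>c\<close> to one between \<open>a\<close> and
  \<open>c\<close>. The coincidences \<open>c = x\<close> and \<open>y = a\<close> only need a given
  cycle to be rotated or inverted.\<close>

lemma linked_trans:
  assumes "linked a b" "linked b c"
  shows "linked a c"
proof (cases "a = b \<or> b = c \<or> a = c")
  case True
  then show ?thesis using assms by (auto simp: linked_def)
next
  case False
  then obtain x y where x: "distinct [a, b, x]" "cyc3 a b x \<in> H"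
    and y: "distinct [b, c, y]" "cyc3 b c y \<in> H"
    using assms by (auto simp: linked_def)
  let ?f = "inv' (cyc3 a b x)"
  have f: "?f \<in> H" "?f = cyc3 x b a" using inv_closed[OF x(2)] inv_cyc3[OF x(1)] by simp_all
  consider "c = x" | "y = a" | "c \<noteq> x" "y \<noteq> a" by blast
  then show ?thesis
  proof cases
    case 1
    then have "cyc3 a c b \<in> H" using f cyc3_rotate[of c b a] cyc3_rotate[of b a c] x by auto
    then show ?thesis using False x 1 unfolding linked_def by auto
  next
    case 2
    then have "cyc3 a b c \<in> H" using y cyc3_rotate[of a b c] by auto
    then have "cyc3 c b a \<in> H" using cyc3_reverse_closed False by auto
    then have "cyc3 a c b \<in> H" using False cyc3_rotate[of a c b] cyc3_rotate[of c b a] by auto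
    then show ?thesis using False unfolding linked_def by auto
  next
    case 3
    have "?f b = a" "?f c = c" using f(2) x(1) 3 False by (auto simp: cyc3_apply)
    moreover have "linked b c" by fact
    ultimately show ?thesis using linked_image[OF f(1), of b c] by simp
  qed
qed

lemma cyc3_common_edge:
  assumes "distinct [a, b, c, y]" "cyc3 a c y \<in> H" "cyc3 b c y \<in> H"
  shows "cyc3 a b c \<in> H"
proof -
  have "inv' (cyc3 a c y) = cyc3 y c a"
    using assms(1) by (intro inv_cyc3) auto
  moreover have "cyc3 b c y \<circ> cyc3 y c a = cyc3 a b c"
  proof
    fix x
    have "distinct [b, c, y]" "distinct [y, c, a]" "distinct [a, b, c]" using assms(1) by auto
    note ap = cyc3_apply[OF this(1)] cyc3_apply[OF this(2)] cyc3_apply[OF this(3)]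
    consider "x = a" | "x = b" | "x = c" | "x = y" | "x \<notin> {a, b, c, y}" by blast
    then show "(cyc3 b c y \<circ> cyc3 y c a) x = cyc3 a b c x"
      by cases (use assms(1) in \<open>auto simp: ap\<close>)
  qed
  ultimately have "cyc3 b c y \<circ> inv' (cyc3 a c y) = cyc3 a b c" by simp
  then show ?thesis using comp_closed[OF assms(3) inv_closed[OF assms(2)]] by simp
qed

text \<open>It suffices to have some \<open>cyc3 b c z\<close> next to \<open>cyc3 a c z\<close>,
  for \<open>cyc3_common_edge\<close> then cancels \<open>z\<close>. If \<open>x \<noteq> y\<close>,
  conjugating \<open>cyc3 a c y\<close> by \<open>cyc3 a b x\<close> yields
  \<open>cyc3 b c y\<close>; if \<open>x = y\<close>, a first use of the same cancellation yields
  \<open>cyc3 b c x\<close>.\<close>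

lemma cyc3_mem_if_linked:
  assumes d: "distinct [a, b, c]" and "linked a b" "linked a c"
  shows "cyc3 a b c \<in> H"
proof -
  obtain x y where x: "distinct [a, b, x]" "cyc3 a b x \<in> H"
    and y: "distinct [a, c, y]" "cyc3 a c y \<in> H"
    using assms by (auto simp: linked_def)
  consider "x = c" | "y = b" | "x \<noteq> c" "y \<noteq> b" "x = y" | "x \<noteq> c" "y \<noteq> b" "x \<noteq> y" by blast
  then show ?thesis
  proof cases
    case 1 then show ?thesis using x by simp
  next
    case 2
    then have "cyc3 b c a \<in> H" using cyc3_reverse_closed y by auto
    then show ?thesis using d cyc3_rotate[of a b c] by simp
  next
    case 3
    have "cyc3 b x a \<in> H" "cyc3 c x a \<in> H"
      using x y 3 cyc3_rotate[of a b x] cyc3_rotate[of a c x] by auto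
    then have "cyc3 b c x \<in> H"
      using cyc3_common_edge[of b c x a] 3 x(1) y(1) d by auto
    then show ?thesis
      using cyc3_common_edge[of a b c x] 3 x(1) y d by simp
  next
    case 4
    have "cyc3 (cyc3 a b x a) (cyc3 a b x c) (cyc3 a b x y) \<in> H"
      using cyc3_image_closed[OF x(2) y] .
    then have "cyc3 b c y \<in> H" using 4 d x(1) y(1) by (auto simp: cyc3_apply)
    then show ?thesis using cyc3_common_edge[of a b c y] y 4 d by simp
  qed
qed

end

section \<open>Shears on a finite set of points\<close>

lemma exists_third_index:
  fixes n i j :: nat
  assumes "3 \<le> n"
  obtains k where "k < n" "k \<noteq> i" "k \<noteq> j"
proof -
  have "card {i, j} < card {..<n}" using assms card_insert_le_m1[of 2 "{j}" i] by simp
  then have "\<not> {..<n} \<subseteq> {i, j}" by (meson card_mono finite.emptyI finite.insertI not_le)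
  then show ?thesis using that by blast
qed

text \<open>Fixing the coordinates from \<open>n\<close> on to 0 keeps the set finite and makes
  equality of points plain equality of functions.\<close>

definition points :: "nat \<Rightarrow> 'b::zero set \<Rightarrow> (nat \<Rightarrow> 'b) set" where
  "points n K = {x. (\<forall>i<n. x i \<in> K) \<and> (\<forall>i\<ge>n. x i = 0)}"

locale point_system =
  fixes n :: nat and K :: "'b::ab_group_add set" and H :: "((nat \<Rightarrow> 'b) \<Rightarrow> nat \<Rightarrow> 'b) set"
  assumes K_0: "0 \<in> K"
    and K_add: "a \<in> K \<Longrightarrow> b \<in> K \<Longrightarrow> a + b \<in> K"
    and K_minus: "a \<in> K \<Longrightarrow> - a \<in> K"
    and H_group: "perm_group (points n K) H"
begin

abbreviation "Pt \<equiv> points n K"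

sublocale perm_group Pt H by (rule H_group)

definition shear :: "nat \<Rightarrow> ((nat \<Rightarrow> 'b) \<Rightarrow> 'b) \<Rightarrow> (nat \<Rightarrow> 'b) \<Rightarrow> nat \<Rightarrow> 'b" where
  "shear i f x = (if x \<in> Pt then x(i := x i + f x) else x)"

definition fns :: "nat \<Rightarrow> ((nat \<Rightarrow> 'b) \<Rightarrow> 'b) set" where
  "fns i = {f. \<forall>x\<in>Pt. f x \<in> K \<and> (\<forall>t\<in>K. f (x(i := t)) = f x)}"

text \<open>An additive group of functions; elements of \<open>H\<close> are later produced through
  closure properties of these groups rather than as words in generators.\<close>

definition A :: "nat \<Rightarrow> ((nat \<Rightarrow> 'b) \<Rightarrow> 'b) set" where
  "A i = {f \<in> fns i. shear i f \<in> H}"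

lemma K_diff: "a \<in> K \<Longrightarrow> b \<in> K \<Longrightarrow> a - b \<in> K"
  using K_add[of a "- b"] K_minus by simp


lemma Pt_upd: "x \<in> Pt \<Longrightarrow> i < n \<Longrightarrow> t \<in> K \<Longrightarrow> x(i := t) \<in> Pt"
  by (auto simp: points_def)

lemma Pt_K: "x \<in> Pt \<Longrightarrow> x i \<in> K"
  by (cases "i < n") (auto simp: points_def K_0)

lemma fns_K: "f \<in> fns i \<Longrightarrow> x \<in> Pt \<Longrightarrow> f x \<in> K"
  by (simp add: fns_def)

lemma fns_upd: "f \<in> fns i \<Longrightarrow> x \<in> Pt \<Longrightarrow> t \<in> K \<Longrightarrow> f (x(i := t)) = f x"
  by (simp add: fns_def)

lemma A_fns: "f \<in> A i \<Longrightarrow> f \<in> fns i"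
  by (simp add: A_def)

lemma fns_add: "f \<in> fns i \<Longrightarrow> g \<in> fns i \<Longrightarrow> (\<lambda>x. f x + g x) \<in> fns i"
  by (simp add: fns_def K_add)

lemma fns_minus: "f \<in> fns i \<Longrightarrow> (\<lambda>x. - f x) \<in> fns i"
  by (simp add: fns_def K_minus)


lemma shear_comp:
  assumes "i < n" "f \<in> fns i" "g \<in> fns i"
  shows "shear i f \<circ> shear i g = shear i (\<lambda>x. f x + g x)"
  using assms
  by (auto simp: shear_def fun_eq_iff Pt_upd K_add Pt_K fns_K fns_upd add_ac)

lemma shear_zero: "shear i (\<lambda>_. 0) = id"
  by (auto simp: shear_def fun_eq_iff)

lemma shear_cong: "(\<And>x. x \<in> Pt \<Longrightarrow> f x = g x) \<Longrightarrow> shear i f = shear i g"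
  by (auto simp: shear_def fun_eq_iff)

lemma inv_shear:
  assumes "i < n" "f \<in> fns i"
  shows "inv' (shear i f) = shear i (\<lambda>x. - f x)"
  using assms by (intro inv_unique_comp) (simp_all add: shear_comp fns_minus shear_zero)

lemma A_zero: "(\<lambda>_. 0) \<in> A i"
  using shear_zero id_closed by (simp add: A_def fns_def K_0)

lemma A_add: "i < n \<Longrightarrow> f \<in> A i \<Longrightarrow> g \<in> A i \<Longrightarrow> (\<lambda>x. f x + g x) \<in> A i"
  using comp_closed[of "shear i f" "shear i g"] by (simp add: A_def shear_comp fns_add)

lemma A_minus: "i < n \<Longrightarrow> f \<in> A i \<Longrightarrow> (\<lambda>x. - f x) \<in> A i"
  using inv_closed[of "shear i f"] by (simp add: A_def inv_shear fns_minus)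

lemma A_diff: "i < n \<Longrightarrow> f \<in> A i \<Longrightarrow> g \<in> A i \<Longrightarrow> (\<lambda>x. f x - g x) \<in> A i"
  using A_add[OF _ _ A_minus, of i f g] by simp

lemma A_sum: "i < n \<Longrightarrow> (\<And>s. s \<in> S \<Longrightarrow> f s \<in> A i) \<Longrightarrow> (\<lambda>x. \<Sum>s\<in>S. f s x) \<in> A i"
proof (induction S rule: infinite_finite_induct)
  case (insert s S)
  then show ?case using A_add[of i "f s" "\<lambda>x. \<Sum>s\<in>S. f s x"] by simp
qed (simp_all add: A_zero)

lemma A_cong:
  assumes "i < n" "f \<in> A i" "\<And>x. x \<in> Pt \<Longrightarrow> g x = f x"
  shows "g \<in> A i"
proof -
  have "g \<in> fns i"
    using assms A_fns[OF assms(2)] by (simp add: fns_def Pt_upd)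
  then show ?thesis using assms shear_cong[of g f i] by (simp add: A_def)
qed

text \<open>Because \<open>g\<close> does not depend on coordinate \<open>i\<close>, conjugating the
  shear in direction \<open>i\<close> by the shear in direction \<open>j\<close> merely shifts the
  argument of \<open>f\<close>. The commutator is then again a shear in direction
  \<open>i\<close>.\<close>

lemma A_commutator:
  assumes ij: "i < n" "j < n" "i \<noteq> j" and f: "f \<in> A i" and g: "g \<in> A j" "g \<in> fns i"
  shows "(\<lambda>x. f (x(j := x j + g x)) - f x) \<in> A i"
proof -
  let ?f = "\<lambda>x. f (x(j := x j + g x))"
  note f' = A_fns[OF f] and g' = A_fns[OF g(1)]
  have fns: "?f \<in> fns i"
    unfolding fns_def using ij f' g' g(2)
    by (auto simp: fns_K fns_upd Pt_upd K_add Pt_K fun_upd_twist[of i j])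
  have "inv' (shear j g) \<circ> shear i f \<circ> shear j g = shear i ?f"
    unfolding inv_shear[OF ij(2) g']
  proof
    fix x
    show "(shear j (\<lambda>x. - g x) \<circ> shear i f \<circ> shear j g) x = shear i ?f x"
    proof (cases "x \<in> Pt")
      case True
      let ?y = "x(j := x j + g x)"
      have y: "?y \<in> Pt" using True ij g' by (simp add: fns_K Pt_upd K_add Pt_K)
      then have fy: "f ?y \<in> K" using f' by (simp add: fns_K)
      have 1: "x i + f ?y \<in> K" using True fy by (simp add: Pt_K K_add)
      have z: "?y(i := x i + f ?y) \<in> Pt" by (rule Pt_upd[OF y ij(1) 1])
      \<comment> \<open>\<open>g\<close> ignores both coordinates \<open>i\<close> and
        \<open>j\<close>, so the last shear subtracts exactly what the first one added.\<close>
      have "g (?y(i := x i + f ?y)) = g x"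
        using fns_upd[OF g(2) y 1] fns_upd[OF g' True, of "x j + g x"] True g'
        by (simp add: fns_K K_add Pt_K)
      then show ?thesis using True y z ij by (auto simp: shear_def fun_eq_iff)
    qed (simp add: shear_def)
  qed
  moreover have "inv' (shear j g) \<circ> shear i f \<circ> shear j g \<in> H"
    using f g by (intro comp_closed inv_closed) (auto simp: A_def)
  ultimately have "?f \<in> A i" using fns by (simp add: A_def)
  then show ?thesis using A_diff ij f by blast
qed

end

section \<open>Free coordinatewise actions\<close>

text \<open>The equivariant function in the coordinates \<open>J\<close> with value \<open>c\<close> at \<open>y\<close> and support the \<open>\<Gamma>\<close>-orbit of \<open>y\<close>.
  The choice operator is harmless only when the stabiliser of \<open>y\<close> in the coordinates \<open>J\<close> is trivial.\<close>

definition bump :: "(nat \<Rightarrow> 'b \<Rightarrow> 'b) set \<Rightarrow> nat \<Rightarrow> nat set \<Rightarrow> (nat \<Rightarrow> 'b) \<Rightarrow> 'b \<Rightarrow> (nat \<Rightarrow> 'b) \<Rightarrow> 'b::zero" where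
  "bump \<Gamma> i J y c x =
    (if \<exists>\<gamma>\<in>\<Gamma>. \<forall>j\<in>J. x j = \<gamma> j (y j)
     then (SOME \<gamma>. \<gamma> \<in> \<Gamma> \<and> (\<forall>j\<in>J. x j = \<gamma> j (y j))) i c else 0)"

text \<open>Collects what the combinatorial part uses about the field: freeness in every single
  coordinate outside \<open>F\<close>, bumps in one variable, and enough elements of
  \<open>K\<close>. The conclusion of \<open>G_free\<close> is an equality of families of functions
  on the whole type, which makes the choice inside \<open>bump\<close> unique.\<close>

locale free_system = point_system n K H
  for n :: nat and K :: "'b::ab_group_add set" and H +
  fixes F :: "'b set" and \<Gamma> :: "(nat \<Rightarrow> 'b \<Rightarrow> 'b) set"
  assumes n_ge_3: "3 \<le> n"
    and finite_K: "finite K"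
    and F_subset: "F \<subseteq> K"
    and F_0: "0 \<in> F"
    and finite_G: "finite \<Gamma>"
    and G_id: "(\<lambda>i x. x) \<in> \<Gamma>"
    and G_comp: "\<gamma> \<in> \<Gamma> \<Longrightarrow> \<delta> \<in> \<Gamma> \<Longrightarrow> (\<lambda>i x. \<gamma> i (\<delta> i x)) \<in> \<Gamma>"
    and G_inv: "\<gamma> \<in> \<Gamma> \<Longrightarrow> \<exists>\<delta>\<in>\<Gamma>. \<forall>i x. \<delta> i (\<gamma> i x) = x \<and> \<gamma> i (\<delta> i x) = x"
    and G_K: "\<gamma> \<in> \<Gamma> \<Longrightarrow> a \<in> K \<Longrightarrow> \<gamma> i a \<in> K"
    and G_add: "\<gamma> \<in> \<Gamma> \<Longrightarrow> a \<in> K \<Longrightarrow> b \<in> K \<Longrightarrow> \<gamma> i (a + b) = \<gamma> i a + \<gamma> i b"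
    and G_free: "\<gamma> \<in> \<Gamma> \<Longrightarrow> i < n \<Longrightarrow> a \<in> K - F \<Longrightarrow> \<gamma> i a = a \<Longrightarrow> \<gamma> = (\<lambda>i x. x)"
    and H_equiv: "\<phi> \<in> H \<Longrightarrow> \<gamma> \<in> \<Gamma> \<Longrightarrow> x \<in> points n K \<Longrightarrow>
        \<phi> (\<lambda>i. \<gamma> i (x i)) = (\<lambda>i. \<gamma> i (\<phi> x i))"
    and H_F: "\<phi> \<in> H \<Longrightarrow> x \<in> points n K \<Longrightarrow> \<forall>i<n. x i \<in> F \<Longrightarrow> i < n \<Longrightarrow> \<phi> x i \<in> F"
    and bump_single: "i < n \<Longrightarrow> j < n \<Longrightarrow> i \<noteq> j \<Longrightarrow> y j \<in> K - F \<Longrightarrow> c \<in> K \<Longrightarrow>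
        bump \<Gamma> i {j} y c \<in> A i"
    and K_large: "3 * (card \<Gamma>)\<^sup>2 * card F < card K"
begin

abbreviation one :: "nat \<Rightarrow> 'b \<Rightarrow> 'b" where "one \<equiv> (\<lambda>i x. x)"

lemma G_0: "\<gamma> \<in> \<Gamma> \<Longrightarrow> \<gamma> i 0 = 0"
  using G_add[of \<gamma> 0 0 i] K_0 by simp

lemma G_minus: "\<gamma> \<in> \<Gamma> \<Longrightarrow> a \<in> K \<Longrightarrow> \<gamma> i (- a) = - \<gamma> i a"
  using G_add[of \<gamma> a "- a" i] K_minus[of a] G_0[of \<gamma> i]
  by (simp add: eq_neg_iff_add_eq_0 add.commute)

lemma G_diff: "\<gamma> \<in> \<Gamma> \<Longrightarrow> a \<in> K \<Longrightarrow> b \<in> K \<Longrightarrow> \<gamma> i (a - b) = \<gamma> i a - \<gamma> i b"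
  using G_add[of \<gamma> a "- b" i] G_minus[of \<gamma> b i] K_minus[of b] by simp

lemma G_solve:
  assumes "\<gamma> \<in> \<Gamma>" "\<delta> \<in> \<Gamma>"
  obtains \<epsilon> where "\<epsilon> \<in> \<Gamma>" "\<And>i a b. \<gamma> i a = \<delta> i b \<longleftrightarrow> a = \<epsilon> i b"
proof -
  obtain \<gamma>' where g: "\<gamma>' \<in> \<Gamma>" "\<forall>i x. \<gamma>' i (\<gamma> i x) = x \<and> \<gamma> i (\<gamma>' i x) = x"
    using G_inv[OF assms(1)] by blast
  show ?thesis
    by (rule that[OF G_comp[OF g(1) assms(2)]]) (use g(2) in metis)
qed

lemma G_eq_iff: "\<gamma> \<in> \<Gamma> \<Longrightarrow> \<gamma> i a = \<gamma> i b \<longleftrightarrow> a = b"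
  using G_inv[of \<gamma>] by metis

lemma G_unique:
  assumes "\<gamma> \<in> \<Gamma>" "\<delta> \<in> \<Gamma>" "i < n" "a \<in> K - F" "\<gamma> i a = \<delta> i a"
  shows "\<gamma> = \<delta>"
proof -
  obtain \<epsilon> where e: "\<epsilon> \<in> \<Gamma>" "\<And>i a b. \<gamma> i a = \<delta> i b \<longleftrightarrow> a = \<epsilon> i b"
    using G_solve assms(1,2) by metis
  then have "\<epsilon> = one" using G_free[OF e(1) assms(3,4)] assms(5) by metis
  then have "\<gamma> i a = \<delta> i a" for i a using e(2) by simp
  then show ?thesis by (simp add: fun_eq_iff)
qed


lemma card_F: "card F \<ge> 1"
  using F_0 finite_subset[OF F_subset finite_K] by (metis One_nat_def Suc_leI card_gt_0_iff empty_iff)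

lemma card_G: "card \<Gamma> \<ge> 1"
  using G_id finite_G by (metis One_nat_def Suc_leI card_gt_0_iff empty_iff)

definition act :: "(nat \<Rightarrow> 'b \<Rightarrow> 'b) \<Rightarrow> (nat \<Rightarrow> 'b) \<Rightarrow> nat \<Rightarrow> 'b" where
  "act \<gamma> x = (\<lambda>i. \<gamma> i (x i))"

lemma act_apply [simp]: "act \<gamma> x i = \<gamma> i (x i)"
  by (simp add: act_def)

lemma act_Pt: "\<gamma> \<in> \<Gamma> \<Longrightarrow> x \<in> Pt \<Longrightarrow> act \<gamma> x \<in> Pt"
  by (auto simp: points_def G_K G_0)

lemma act_upd: "act \<gamma> (x(i := t)) = (act \<gamma> x)(i := \<gamma> i t)"
  by (auto simp: act_def)

abbreviation "bmp \<equiv> bump \<Gamma>"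

lemma bump_zero: "\<not> (\<exists>\<gamma>\<in>\<Gamma>. \<forall>j\<in>J. x j = \<gamma> j (y j)) \<Longrightarrow> bmp i J y c x = 0"
  unfolding bump_def by (rule if_not_P)

lemma bump_eq:
  assumes "k \<in> J" "k < n" "y k \<in> K - F" "\<gamma> \<in> \<Gamma>" "\<forall>j\<in>J. x j = \<gamma> j (y j)"
  shows "bmp i J y c x = \<gamma> i c"
proof -
  have "(SOME \<gamma>. \<gamma> \<in> \<Gamma> \<and> (\<forall>j\<in>J. x j = \<gamma> j (y j))) = \<gamma>"
  proof (rule some_equality)
    fix \<delta> assume d: "\<delta> \<in> \<Gamma> \<and> (\<forall>j\<in>J. x j = \<delta> j (y j))"
    then have "\<delta> k (y k) = \<gamma> k (y k)" using assms(1,5) by metis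
    then show "\<delta> = \<gamma>" using G_unique d assms(2-4) by blast
  qed (use assms in auto)
  then show ?thesis using assms unfolding bump_def by auto
qed

text \<open>Agreement in one coordinate outside \<open>F\<close> leaves only the identity of
  \<Gamma>, by freeness. On the slice \<open>x k = y k\<close> a bump is thus an ordinary indicator
  function, and the computations below are made there.\<close>

lemma bump_at:
  assumes "k \<in> J" "k < n" "y k \<in> K - F" "x k = y k"
  shows "bmp i J y c x = (if \<forall>j\<in>J. x j = y j then c else 0)"
proof (cases "\<forall>j\<in>J. x j = y j")
  case True
  then show ?thesis using bump_eq[of k J y one x i c] assms(1-3) G_id by simp
next
  case False
  have "\<not> (\<exists>\<gamma>\<in>\<Gamma>. \<forall>j\<in>J. x j = \<gamma> j (y j))"
  proof
    assume "\<exists>\<gamma>\<in>\<Gamma>. \<forall>j\<in>J. x j = \<gamma> j (y j)"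
    then obtain \<gamma> where g: "\<gamma> \<in> \<Gamma>" "\<forall>j\<in>J. x j = \<gamma> j (y j)" by blast
    then have "\<gamma> = one" using G_free[OF g(1) assms(2,3)] assms(1,4) by metis
    then show False using g False by simp
  qed
  then show ?thesis unfolding if_not_P[OF False] by (rule bump_zero)
qed

text \<open>Equivariance reduces an identity of functions to one slice \<open>x k = b\<close>:
  \<Gamma> carries every point whose coordinate \<open>k\<close> lies in the orbit of
  \<open>b\<close> into that slice.\<close>

definition equiv_fn :: "nat \<Rightarrow> ((nat \<Rightarrow> 'b) \<Rightarrow> 'b) \<Rightarrow> bool" where
  "equiv_fn i f \<longleftrightarrow> (\<forall>\<gamma>\<in>\<Gamma>. \<forall>x\<in>Pt. f (act \<gamma> x) = \<gamma> i (f x))"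

lemma equiv_fnD: "equiv_fn i f \<Longrightarrow> \<gamma> \<in> \<Gamma> \<Longrightarrow> x \<in> Pt \<Longrightarrow> f (act \<gamma> x) = \<gamma> i (f x)"
  by (simp add: equiv_fn_def)

lemma equiv_bump:
  assumes "k \<in> J" "k < n" "y k \<in> K - F"
  shows "equiv_fn i (bmp i J y c)"
  unfolding equiv_fn_def
proof (intro ballI)
  fix \<gamma> x assume g: "\<gamma> \<in> \<Gamma>" and x: "x \<in> Pt"
  show "bmp i J y c (act \<gamma> x) = \<gamma> i (bmp i J y c x)"
  proof (cases "\<exists>\<delta>\<in>\<Gamma>. \<forall>j\<in>J. x j = \<delta> j (y j)")
    case True
    then obtain \<delta> where d: "\<delta> \<in> \<Gamma>" "\<forall>j\<in>J. x j = \<delta> j (y j)" by blast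
    then show ?thesis
      using bump_eq[of k J y \<delta> x i c] bump_eq[of k J y "\<lambda>i x. \<gamma> i (\<delta> i x)" "act \<gamma> x" i c]
        assms G_comp[OF g d(1)] by simp
  next
    case False
    have "\<not> (\<exists>\<delta>\<in>\<Gamma>. \<forall>j\<in>J. act \<gamma> x j = \<delta> j (y j))"
    proof
      assume "\<exists>\<delta>\<in>\<Gamma>. \<forall>j\<in>J. act \<gamma> x j = \<delta> j (y j)"
      then obtain \<delta> where d: "\<delta> \<in> \<Gamma>" "\<forall>j\<in>J. \<gamma> j (x j) = \<delta> j (y j)" by auto
      then show False using False G_solve[OF g d(1)] by metis
    qed
    then show ?thesis using False g by (simp add: bump_zero G_0)
  qed
qed

lemma equiv_diff:
  assumes "equiv_fn i f" "equiv_fn i g" "f \<in> fns i" "g \<in> fns i"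
  shows "equiv_fn i (\<lambda>x. f x - g x)"
  using assms by (auto simp: equiv_fn_def G_diff fns_K)

lemma equiv_shift:
  assumes "equiv_fn i f" "equiv_fn j g" "g \<in> fns j" "j < n"
  shows "equiv_fn i (\<lambda>x. f (x(j := x j + g x)))"
  unfolding equiv_fn_def
proof (intro ballI)
  fix \<gamma> x assume g: "\<gamma> \<in> \<Gamma>" and x: "x \<in> Pt"
  have "act \<gamma> (x(j := x j + g x)) = (act \<gamma> x)(j := act \<gamma> x j + g (act \<gamma> x))"
    using g x assms by (simp add: act_upd equiv_fnD G_add Pt_K fns_K)
  moreover have "x(j := x j + g x) \<in> Pt"
    using x assms by (simp add: Pt_upd Pt_K K_add fns_K)
  ultimately show "f ((act \<gamma> x)(j := act \<gamma> x j + g (act \<gamma> x))) = \<gamma> i (f (x(j := x j + g x)))"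
    using equiv_fnD[OF assms(1) g] by metis
qed

lemma bump_K: 
  assumes "k \<in> J" "k < n" "y k \<in> K - F" "c \<in> K"
  shows "bmp i J y c x \<in> K"
proof (cases "\<exists>\<delta>\<in>\<Gamma>. \<forall>j\<in>J. x j = \<delta> j (y j)")
  case True
  then show ?thesis using bump_eq[of k J y _ x i c] G_K assms by metis
qed (simp add: bump_zero K_0)

lemma bump_upd: "i' \<notin> J \<Longrightarrow> bmp i J y c (x(i' := t)) = bmp i J y c x"
proof -
  assume "i' \<notin> J"
  then have "(\<forall>j\<in>J. (x(i' := t)) j = \<gamma> j (y j)) \<longleftrightarrow> (\<forall>j\<in>J. x j = \<gamma> j (y j))" for \<gamma>
    by auto
  then show ?thesis by (simp only: bump_def)
qed

lemma bump_fns: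
  assumes "k \<in> J" "k < n" "y k \<in> K - F" "c \<in> K" "i' \<notin> J"
  shows "bmp i J y c \<in> fns i'"
  using assms by (auto simp: fns_def bump_upd intro: bump_K)

section \<open>Generic values by counting\<close>

lemma card_UN_le_mult:
  assumes "finite S" "\<And>\<gamma>. \<gamma> \<in> S \<Longrightarrow> card (f \<gamma>) \<le> m"
  shows "card (\<Union>\<gamma>\<in>S. f \<gamma>) \<le> card S * m"
  using card_UN_le[OF assms(1), of f] sum_bounded_above[of S "\<lambda>\<gamma>. card (f \<gamma>)" m] assms(2)
  by simp


lemma size_bound:
  assumes "a \<le> card F" "b \<le> card \<Gamma> * 1" "c \<le> card \<Gamma> * (card \<Gamma> * card F)"
  shows "a + b + c \<le> 3 * (card \<Gamma>)\<^sup>2 * card F"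
proof -
  have "1 * card F \<le> (card \<Gamma> * card \<Gamma>) * card F"
    using card_G by (intro mult_right_mono) (simp_all add: one_le_mult_iff)
  moreover have "card \<Gamma> * 1 \<le> (card \<Gamma> * card \<Gamma>) * card F"
    using mult_le_mono[of "card \<Gamma>" "card \<Gamma> * card \<Gamma>" 1 "card F"] card_G card_F by simp
  ultimately show ?thesis
    using assms unfolding power2_eq_square mult.assoc by linarith
qed

text \<open>The three sizes are those of a copy of \<open>F\<close>, of one forbidden value per
  element of \<Gamma>, and of \<open>card F\<close> forbidden values per pair of elements.
  \<open>K_large\<close> is the statement that such sets cannot cover \<open>K\<close>.\<close>

lemma exists_avoiding:
  assumes "finite B1" "finite B2" "finite B3"
    and "card B1 \<le> card F" "card B2 \<le> card \<Gamma> * 1" "card B3 \<le> card \<Gamma> * (card \<Gamma> * card F)"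
  obtains u where "u \<in> K" "u \<notin> B1" "u \<notin> B2" "u \<notin> B3"
proof -
  have "card (B1 \<union> B2 \<union> B3) \<le> card B1 + card B2 + card B3"
    using card_Un_le[of "B1 \<union> B2" B3] card_Un_le[of B1 B2] by linarith
  then have "card (B1 \<union> B2 \<union> B3) < card K"
    using size_bound[OF assms(4-6)] K_large by linarith
  then have "\<not> K \<subseteq> B1 \<union> B2 \<union> B3"
    using assms(1-3) by (meson card_mono finite_UnI not_le)
  then show ?thesis using that by blast
qed

lemma card_fibre:
  assumes "\<gamma> \<in> \<Gamma>"
  shows "finite {v. b = \<gamma> k (t + v)}" "card {v. b = \<gamma> k (t + v)} \<le> 1"
proof -
  obtain \<delta> where "\<forall>i x. \<delta> i (\<gamma> i x) = x \<and> \<gamma> i (\<delta> i x) = x"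
    using G_inv[OF assms] by blast
  then have w: "{v. b = \<gamma> k (t + v)} \<subseteq> {\<delta> k b - t}" by auto
  then show "finite {v. b = \<gamma> k (t + v)}" by (rule finite_subset) simp
  show "card {v. b = \<gamma> k (t + v)} \<le> 1" using card_mono[OF _ w] by simp
qed

lemma exists_other_orbits:
  assumes "k < n"
  obtains v where "v \<in> K - F" "\<And>\<gamma>. \<gamma> \<in> \<Gamma> \<Longrightarrow> a \<noteq> \<gamma> k v" "\<And>\<gamma>. \<gamma> \<in> \<Gamma> \<Longrightarrow> b \<noteq> \<gamma> k v"
proof -
  define B where "B t = (\<Union>\<gamma>\<in>\<Gamma>. {v. t = \<gamma> k (0 + v)})" for t
  have B: "finite (B t)" "card (B t) \<le> card \<Gamma> * 1" for t
    unfolding B_def using card_fibre(1) finite_G apply blast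
    unfolding B_def using card_fibre(2) by (intro card_UN_le_mult finite_G)
  have "card \<Gamma> * 1 \<le> card \<Gamma> * (card \<Gamma> * card F)"
    using mult_le_mono[OF card_G card_F] by (intro mult_le_mono2) simp
  with B(2)[of b] have "card (B b) \<le> card \<Gamma> * (card \<Gamma> * card F)" by linarith
  then obtain v where "v \<in> K" "v \<notin> F" "v \<notin> B a" "v \<notin> B b"
    using exists_avoiding[of F "B a" "B b"] B finite_subset[OF F_subset finite_K] by blast
  then show ?thesis using that[of v] unfolding B_def by auto
qed

text \<open>For \<open>\<gamma> \<noteq> \<delta>\<close>, two solutions \<open>u\<close> of the
  last equation differ by a value on which \<gamma> and \<delta> agree, hence by an element of
  \<open>F\<close>; each pair excludes at most \<open>card F\<close> choices. For
  \<open>\<gamma> = \<delta>\<close> the equation says that \<gamma> fixes \<open>b\<close>.\<close>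

lemma exists_generic_u:
  assumes b: "b \<in> K - F" and k: "k < n"
  obtains u where "u \<in> K" "b + u \<in> K - F"
    "\<And>\<gamma>. \<gamma> \<in> \<Gamma> \<Longrightarrow> b \<noteq> \<gamma> k (b + u)"
    "\<And>\<gamma> \<delta>. \<gamma> \<in> \<Gamma> \<Longrightarrow> \<delta> \<in> \<Gamma> \<Longrightarrow> b + \<gamma> k u = \<delta> k (b + u) \<Longrightarrow> \<gamma> = one"
proof -
  define B1 where "B1 = {u. b + u \<in> F}"
  define B2 where "B2 = (\<Union>\<gamma>\<in>\<Gamma>. {u. b = \<gamma> k (b + u)})"
  define S where "S \<gamma> \<delta> = {u \<in> K. \<gamma> \<noteq> \<delta> \<and> b + \<gamma> k u = \<delta> k (b + u)}" for \<gamma> \<delta>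
  define B3 where "B3 = (\<Union>\<gamma>\<in>\<Gamma>. \<Union>\<delta>\<in>\<Gamma>. S \<gamma> \<delta>)"
  have finF: "finite F" using F_subset finite_K by (rule finite_subset)
  have B1: "B1 = (\<lambda>x. x - b) ` F" unfolding B1_def by (auto simp: image_iff) (metis add_diff_cancel_left')
  have S: "card (S \<gamma> \<delta>) \<le> card F" if g: "\<gamma> \<in> \<Gamma>" "\<delta> \<in> \<Gamma>" for \<gamma> \<delta>
  proof (cases "S \<gamma> \<delta> = {}")
    case False
    then obtain w where w: "w \<in> S \<gamma> \<delta>" by blast
    have "S \<gamma> \<delta> \<subseteq> (\<lambda>x. w + x) ` F"
    proof
      fix u assume u: "u \<in> S \<gamma> \<delta>"
      have K: "u \<in> K" "w \<in> K" "b \<in> K" "u - w \<in> K" using u w b by (auto simp: S_def K_diff)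
      have "\<gamma> k (u - w) = (b + \<gamma> k u) - (b + \<gamma> k w)" using g K by (simp add: G_diff)
      also have "\<dots> = \<delta> k (b + u) - \<delta> k (b + w)" using u w by (simp add: S_def)
      also have "\<dots> = \<delta> k (u - w)" using g K by (simp add: G_diff G_add)
      finally have "\<gamma> k (u - w) = \<delta> k (u - w)" .
      then have "u - w \<in> F" using G_unique[OF g k, of "u - w"] u K by (auto simp: S_def)
      then show "u \<in> (\<lambda>x. w + x) ` F" by (auto simp: image_iff) (metis add.commute diff_add_cancel)
    qed
    then show ?thesis using surj_card_le[OF finF] by blast
  qed simp
  have "card B1 \<le> card F" unfolding B1 by (rule card_image_le[OF finF])
  moreover have "card B2 \<le> card \<Gamma> * 1"
    unfolding B2_def using card_fibre by (intro card_UN_le_mult finite_G)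
  moreover have "card B3 \<le> card \<Gamma> * (card \<Gamma> * card F)"
    unfolding B3_def using S by (intro card_UN_le_mult finite_G)
  moreover have "finite B1" unfolding B1 using finF by simp
  moreover have "finite B2" unfolding B2_def using card_fibre(1) finite_G by blast
  moreover have "finite B3" unfolding B3_def S_def using finite_G finite_K by simp
  ultimately obtain u where u: "u \<in> K" "u \<notin> B1" "u \<notin> B2" "u \<notin> B3"
    using exists_avoiding by metis
  show ?thesis
  proof (rule that[of u])
    show "b + u \<in> K - F" using u b by (auto simp: B1_def K_add)
    show "b \<noteq> \<gamma> k (b + u)" if "\<gamma> \<in> \<Gamma>" for \<gamma> using u that by (auto simp: B2_def)
    fix \<gamma> \<delta> assume g: "\<gamma> \<in> \<Gamma>" "\<delta> \<in> \<Gamma>" "b + \<gamma> k u = \<delta> k (b + u)"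
    then have "\<gamma> = \<delta>" using u by (auto simp: B3_def S_def)
    then have "\<gamma> k b = b" using g u(1) b by (simp add: G_add)
    then show "\<gamma> = one" using G_free[OF g(1) k b] by simp
  qed (use u in auto)
qed

text \<open>\<open>v\<close> will be the place of the compensating bump. A point with coordinate
  \<open>b\<close> must not meet it, either before or after a shift by a conjugate of
  \<open>u\<close>.\<close>

lemma exists_generic_v:
  assumes b: "b \<in> K - F" and k: "k < n" and u: "u \<in> K"
  obtains v where "v \<in> K - F"
    "\<And>\<gamma>. \<gamma> \<in> \<Gamma> \<Longrightarrow> b \<noteq> \<gamma> k v"
    "\<And>\<gamma> \<delta>. \<gamma> \<in> \<Gamma> \<Longrightarrow> \<delta> \<in> \<Gamma> \<Longrightarrow> b + \<gamma> k u \<noteq> \<delta> k v"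
proof -
  define B2 where "B2 = (\<Union>\<gamma>\<in>\<Gamma>. {v. b = \<gamma> k (0 + v)})"
  define B3 where "B3 = (\<Union>\<gamma>\<in>\<Gamma>. \<Union>\<delta>\<in>\<Gamma>. {v. b + \<gamma> k u = \<delta> k (0 + v)})"
  have finF: "finite F" using F_subset finite_K by (rule finite_subset)
  have "card B2 \<le> card \<Gamma> * 1"
    unfolding B2_def using card_fibre by (intro card_UN_le_mult finite_G)
  moreover have "card B3 \<le> card \<Gamma> * (card \<Gamma> * card F)"
    unfolding B3_def using card_fibre card_F by (intro card_UN_le_mult finite_G) (meson le_trans)
  moreover have "finite B2" unfolding B2_def using card_fibre(1) finite_G by blast
  moreover have "finite B3" unfolding B3_def using card_fibre(1) finite_G by blast
  ultimately obtain v where v: "v \<in> K" "v \<notin> F" "v \<notin> B2" "v \<notin> B3"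
    using exists_avoiding[of F B2 B3] finF by blast
  show ?thesis
    by (rule that[of v]) (use v in \<open>auto simp: B2_def B3_def\<close>)
qed


section \<open>Pairs of opposite bumps in all coordinates but one\<close>

definition two_point :: "nat \<Rightarrow> nat set \<Rightarrow> nat \<Rightarrow> (nat \<Rightarrow> 'b) \<Rightarrow> 'b \<Rightarrow> 'b \<Rightarrow> (nat \<Rightarrow> 'b) \<Rightarrow> 'b" where
  "two_point i J k y v c x = bmp i J y c x - bmp i J (y(k := v)) c x"

text \<open>A difference under a shift takes opposite values at the two ends of the shift, which is
  why bumps come in pairs; \<open>k\<close> records the coordinate in which the two are
  displaced.\<close>

definition two_point_closed :: "nat \<Rightarrow> nat set \<Rightarrow> nat \<Rightarrow> bool" where
  "two_point_closed i J k \<longleftrightarrow>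
    (\<forall>y v c. (\<forall>j\<in>J. y j \<in> K - F) \<and> v \<in> K - F \<and> c \<in> K \<longrightarrow> two_point i J k y v c \<in> A i)"

lemma two_point_closedD:
  "two_point_closed i J k \<Longrightarrow> \<forall>j\<in>J. y j \<in> K - F \<Longrightarrow> v \<in> K - F \<Longrightarrow> c \<in> K \<Longrightarrow> two_point i J k y v c \<in> A i"
  by (simp add: two_point_closed_def)

lemma two_point_closed_single:
  assumes "i < n" "k < n" "i \<noteq> k"
  shows "two_point_closed i {k} k"
  unfolding two_point_closed_def
proof (intro allI impI, elim conjE)
  fix y v c assume *: "\<forall>j\<in>{k}. y j \<in> K - F" "v \<in> K - F" "c \<in> K"
  then show "two_point i {k} k y v c \<in> A i"
    unfolding two_point_def using bump_single[OF assms, of y c] bump_single[OF assms, of "y(k := v)" c]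
    by (intro A_diff) (auto simp: assms)
qed

text \<open>Let \<open>f\<close> be a two-point function in the coordinates \<open>J\<close>, supported at points with \<open>k\<close>-th coordinate \<open>b + u\<close>
  or \<open>v\<close>. Shifting \<open>x\<^sub>k\<close> by a bump with value \<open>u\<close> at \<open>x\<^sub>l = y\<^sub>l\<close>, and then \<open>x\<^sub>l\<close> by a bump supported
  at \<open>x\<^sub>k = b\<close>, leaves only points with \<open>x\<^sub>k = b\<close> up to \<open>\<Gamma>\<close>; for generic \<open>u\<close> and \<open>v\<close> there are just two.\<close>

lemma two_point_closed_step:
  assumes i: "i < n" "i \<notin> J" and J: "J \<subseteq> {..<n}" and k: "k \<in> J"
    and l: "l < n" "l \<notin> J" "l \<noteq> i" and cl: "two_point_closed i J k"
  shows "two_point_closed i (insert l J) l"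
  unfolding two_point_closed_def
proof (intro allI impI, elim conjE)
  fix y w' c
  assume y: "\<forall>j\<in>insert l J. y j \<in> K - F" and w': "w' \<in> K - F" and c: "c \<in> K"
  have kn: "k < n" and ki: "k \<noteq> i" "k \<noteq> l" using k J i l by auto
  define b where "b = y k"
  define w where "w = y l"
  \<comment> \<open>The shift of coordinate \<open>l\<close> by \<open>d\<close> takes
    \<open>w'\<close> to \<open>w\<close>, so the bump at \<open>w\<close>, pulled back along it, is
    the bump at \<open>w'\<close>.\<close>
  define d where "d = w - w'"
  have b: "b \<in> K - F" and w: "w \<in> K - F" using y k by (auto simp: b_def w_def)
  have d: "d \<in> K" using w w' by (auto simp: d_def K_diff)
  obtain u where u: "u \<in> K" "b + u \<in> K - F" "\<And>\<gamma>. \<gamma> \<in> \<Gamma> \<Longrightarrow> b \<noteq> \<gamma> k (b + u)"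
    "\<And>\<gamma> \<delta>. \<gamma> \<in> \<Gamma> \<Longrightarrow> \<delta> \<in> \<Gamma> \<Longrightarrow> b + \<gamma> k u = \<delta> k (b + u) \<Longrightarrow> \<gamma> = one"
    using exists_generic_u[OF b kn] by metis
  obtain v where v: "v \<in> K - F" "\<And>\<gamma>. \<gamma> \<in> \<Gamma> \<Longrightarrow> b \<noteq> \<gamma> k v"
    "\<And>\<gamma> \<delta>. \<gamma> \<in> \<Gamma> \<Longrightarrow> \<delta> \<in> \<Gamma> \<Longrightarrow> b + \<gamma> k u \<noteq> \<delta> k v"
    using exists_generic_v[OF b kn u(1)] by metis
  define yz where "yz = y(k := b + u)"
  define yv where "yv = y(k := v)"
  have yv': "yz(k := v) = yv" by (simp add: yz_def yv_def)
  define f where "f = two_point i J k yz v c"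
  have f: "f \<in> A i" unfolding f_def
    by (rule two_point_closedD[OF cl]) (use y u v c in \<open>auto simp: yz_def\<close>)
  have f_eq: "f x = bmp i J yz c x - bmp i J yv c x" for x
    by (simp add: f_def two_point_def yv')
  define g where "g = bmp k {l} y u"
  have g: "g \<in> A k" "g \<in> fns i" unfolding g_def
    using bump_single[OF kn l(1) ki(2), of y u] bump_fns[of l "{l}" y u i k] w u(1) l
    by (auto simp: w_def)
  define h where "h = bmp l {k} y d"
  have h: "h \<in> A l" "h \<in> fns i" unfolding h_def
    using bump_single[OF l(1) kn ki(2)[symmetric], of y d] bump_fns[of k "{k}" y d i l] b d kn ki
    by (auto simp: b_def)
  define f1 where "f1 x = f (x(k := x k + g x)) - f x" for x
  have f1: "f1 \<in> A i" unfolding f1_def using A_commutator[OF i(1) kn ki(1)[symmetric] f g] by simp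
  define f2 where "f2 x = f1 (x(l := x l + h x)) - f1 x" for x
  have f2: "f2 \<in> A i" unfolding f2_def using A_commutator[OF i(1) l(1) _ f1 h] l(3) by simp
  define J' where "J' = insert l J"
  define y' where "y' = y(l := w')"
  have kJ: "k \<in> J'" "l \<in> J'" "y' k = b" "y k = b" "y l = w" "y' l = w'"
    using k ki by (auto simp: J'_def y'_def b_def w_def)
  have ykF: "yz k \<in> K - F" "yv k \<in> K - F" "y' k \<in> K - F" "y k \<in> K - F"
    using u v b kJ by (auto simp: yz_def yv_def)
  \<comment> \<open>On this slice both bumps of \<open>f\<close> vanish. The shift leads to
    \<open>b + \<gamma> k u\<close> only if coordinate \<open>l\<close> of \<open>x\<close> is
    \<open>\<gamma> l w\<close>; by the choice of \<open>u\<close> and \<open>v\<close> it then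
    meets the bump at \<open>b + u\<close> only for trivial \<gamma>, and the bump at
    \<open>v\<close> never.\<close>
  have f1_at: "f1 x = bmp i J' y c x" if x: "x \<in> Pt" "x k = b" for x
  proof -
    have b_eq: "bmp i J' y c x = (if \<forall>j\<in>J'. x j = y j then c else 0)"
      using bump_at[of k J' y x i c] kJ kn ykF x by simp
    have fx: "f x = 0"
    proof -
      have "bmp i J yz c x = 0" "bmp i J yv c x = 0"
        by (rule bump_zero; use k x(2) u(3) v(2) in \<open>auto simp: yz_def yv_def intro!: bexI[of _ k]\<close>)+
      then show ?thesis by (simp add: f_eq)
    qed
    show ?thesis
    proof (cases "\<exists>\<gamma>\<in>\<Gamma>. x l = \<gamma> l w")
      case True
      then obtain \<gamma> where \<gamma>: "\<gamma> \<in> \<Gamma>" "x l = \<gamma> l w" by blast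
      have gx: "g x = \<gamma> k u"
        unfolding g_def using bump_eq[of l "{l}" y \<gamma> x k u] l(1) w \<gamma> by (simp add: w_def)
      let ?x = "x(k := b + \<gamma> k u)"
      have f1x: "f1 x = bmp i J yz c ?x - bmp i J yv c ?x"
        unfolding f1_def fx gx x(2) by (simp add: f_eq)
      have "bmp i J yv c ?x = 0"
        by (rule bump_zero) (use k v(3) \<gamma> in \<open>auto simp: yv_def intro!: bexI[of _ k]\<close>)
      moreover have "bmp i J yz c ?x = bmp i J' y c x"
      proof (cases "\<gamma> = one")
        case one: True
        have "(\<forall>j\<in>J. ?x j = yz j) \<longleftrightarrow> (\<forall>j\<in>J'. x j = y j)"
          using one x(2) \<gamma>(2) kJ l(2) by (auto simp: yz_def J'_def)
        then show ?thesis
          using bump_at[of k J yz ?x i c] k kn ykF one b_eq by (simp add: yz_def)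
      next
        case False
        then have "\<And>\<delta>. \<delta> \<in> \<Gamma> \<Longrightarrow> b + \<gamma> k u \<noteq> \<delta> k (b + u)" using u(4)[OF \<gamma>(1)] by blast
        then have "bmp i J yz c ?x = 0"
          by (intro bump_zero) (use k in \<open>auto simp: yz_def intro!: bexI[of _ k]\<close>)
        moreover have "x l \<noteq> w" using False G_free[OF \<gamma>(1) l(1) w] \<gamma>(2) by metis
        ultimately show ?thesis using b_eq kJ by auto
      qed
      ultimately show ?thesis using f1x by simp
    next
      case False
      then have "g x = 0" unfolding g_def by (intro bump_zero) (auto simp: w_def)
      then have "f1 x = 0" by (simp add: f1_def)
      moreover have "x l \<noteq> w" using bexI[OF _ G_id, of "\<lambda>\<gamma>. x l = \<gamma> l w"] False by blast
      ultimately show ?thesis using b_eq kJ by auto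
    qed
  qed
  have f2_at: "f2 x = bmp i J' y' c x - bmp i J' y c x" if x: "x \<in> Pt" "x k = b" for x
  proof -
    have hx: "h x = d"
      unfolding h_def using bump_at[of k "{k}" y x l d] kn x(2) b by (simp add: b_def)
    let ?x = "x(l := x l + d)"
    have "?x \<in> Pt" using x(1) d l(1) by (simp add: Pt_upd K_add Pt_K)
    then have "f2 x = bmp i J' y c ?x - bmp i J' y c x"
      unfolding f2_def hx using f1_at[of ?x] f1_at[of x] x ki by simp
    moreover have "(\<forall>j\<in>J'. ?x j = y j) \<longleftrightarrow> (\<forall>j\<in>J'. x j = y' j)"
      using kJ l(2) by (auto simp: y'_def J'_def d_def w_def algebra_simps)
    then have "bmp i J' y c ?x = bmp i J' y' c x"
      using bump_at[of k J' y ?x i c] bump_at[of k J' y' x i c] kJ kn ykF x ki by simp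
    ultimately show ?thesis by simp
  qed
  have eqs: "equiv_fn i (bmp i J' y' c)" "equiv_fn i (bmp i J' y c)"
    using equiv_bump kJ kn ykF by metis+
  have fnsB: "bmp i J' y' c \<in> fns i" "bmp i J' y c \<in> fns i"
    using bump_fns[of k J' y' c i i] bump_fns[of k J' y c i i] kJ kn ykF c i l by (auto simp: J'_def)
  have ef: "equiv_fn i f"
    unfolding f_eq[abs_def]
    using bump_fns[of k J yz c i i] bump_fns[of k J yv c i i] ykF k kn i c
    by (intro equiv_diff equiv_bump[where k = k]) auto
  have eg: "equiv_fn k g" unfolding g_def using equiv_bump[of l "{l}" y k u] l w by (simp add: w_def)
  have eh: "equiv_fn l h" unfolding h_def using equiv_bump[of k "{k}" y l d] kn b by (simp add: b_def)
  have "(\<lambda>x. f (x(k := x k + g x))) \<in> fns i"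
    using A_fns[OF A_add[OF i(1) f1 f]] by (simp add: f1_def)
  then have ef1: "equiv_fn i f1" unfolding f1_def[abs_def]
    by (intro equiv_diff equiv_shift[OF ef eg A_fns[OF g(1)] kn] ef A_fns[OF f])
  have "(\<lambda>x. f1 (x(l := x l + h x))) \<in> fns i"
    using A_fns[OF A_add[OF i(1) f2 f1]] by (simp add: f2_def)
  then have ef2: "equiv_fn i f2" unfolding f2_def[abs_def]
    by (intro equiv_diff equiv_shift[OF ef1 eh A_fns[OF h(1)] l(1)] ef1 A_fns[OF f1])
  \<comment> \<open>Both sides are equivariant, so the slice \<open>x k = b\<close> settles all
    points it is moved to by \<Gamma>. Elsewhere \<open>h\<close> and the two bumps vanish.\<close>
  have "two_point i J' l y w' c x = - f2 x" if x: "x \<in> Pt" for x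
  proof (cases "\<exists>\<gamma>\<in>\<Gamma>. x k = \<gamma> k b")
    case True
    then obtain \<gamma> \<delta> where g: "\<gamma> \<in> \<Gamma>" "x k = \<gamma> k b" "\<delta> \<in> \<Gamma>" "\<forall>i x. \<delta> i (\<gamma> i x) = x \<and> \<gamma> i (\<delta> i x) = x"
      using G_inv by metis
    define x' where "x' = act \<delta> x"
    have x': "x' \<in> Pt" "x' k = b" "x = act \<gamma> x'"
      using g(2,4) act_Pt[OF g(3) x] by (simp_all add: x'_def act_def)
    have K: "bmp i J' y' c x' \<in> K" "bmp i J' y c x' \<in> K"
      using fns_K[OF fnsB(1) x'(1)] fns_K[OF fnsB(2) x'(1)] .
    have "f2 x = \<gamma> i (f2 x')" using equiv_fnD[OF ef2 g(1) x'(1)] x'(3) by simp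
    also have "\<dots> = \<gamma> i (bmp i J' y' c x') - \<gamma> i (bmp i J' y c x')"
      using f2_at[OF x'(1,2)] K by (simp add: G_diff g(1))
    also have "\<dots> = bmp i J' y' c x - bmp i J' y c x"
      using equiv_fnD[OF eqs(1) g(1) x'(1)] equiv_fnD[OF eqs(2) g(1) x'(1)] x'(3) by simp
    finally show ?thesis by (simp add: two_point_def y'_def)
  next
    case False
    then have "h x = 0" unfolding h_def by (intro bump_zero) (auto simp: b_def)
    then have "f2 x = 0" by (simp add: f2_def)
    moreover have "bmp i J' y' c x = 0" "bmp i J' y c x = 0"
      using False kJ by (auto intro!: bump_zero)
    ultimately show ?thesis by (simp add: two_point_def y'_def)
  qed
  then have "two_point i J' l y w' c \<in> A i"
    using A_cong[OF i(1) A_minus[OF i(1) f2]] by simp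
  then show "two_point i (insert l J) l y w' c \<in> A i" by (simp add: J'_def)
qed

lemma exists_two_point_closed:
  assumes i: "i < n" and "finite J" "J \<noteq> {}" "J \<subseteq> {..<n}" "i \<notin> J"
  shows "\<exists>k\<in>J. two_point_closed i J k"
  using assms(2-5)
proof (induction J rule: finite_ne_induct)
  case (singleton k)
  then show ?case using two_point_closed_single[OF i, of k] by auto
next
  case (insert l J)
  then obtain k where "k \<in> J" "two_point_closed i J k" by auto
  then show ?case using two_point_closed_step[of i J k l] insert i by auto
qed

text \<open>Each step displaces the bumps in the coordinate just added, so adding \<open>k\<close>
  last makes \<open>k\<close> the displaced one. The third index ensures that a nonempty set is left
  to start from.\<close>

lemma two_point_closed_all:
  assumes "i < n" "k < n" "i \<noteq> k"
  shows "two_point_closed i ({..<n} - {i}) k"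
proof -
  let ?J = "{..<n} - {i, k}"
  obtain j where "j < n" "j \<noteq> i" "j \<noteq> k" by (rule exists_third_index[OF n_ge_3])
  then have "?J \<noteq> {}" by auto
  then obtain k' where k': "k' \<in> ?J" "two_point_closed i ?J k'"
    using exists_two_point_closed[OF assms(1), of ?J] by auto
  have "two_point_closed i (insert k ?J) k"
    using k' assms by (intro two_point_closed_step) auto
  moreover have "insert k ?J = {..<n} - {i}" using assms by auto
  ultimately show ?thesis by simp
qed

section \<open>The induced permutations of \<Gamma>-orbits\<close>

definition nonfixed :: "(nat \<Rightarrow> 'b) set" where
  "nonfixed = {x \<in> Pt. \<exists>i<n. x i \<notin> F}"

definition generic :: "(nat \<Rightarrow> 'b) set" where
  "generic = {x \<in> Pt. \<forall>i<n. x i \<notin> F}"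

definition orb :: "(nat \<Rightarrow> 'b) \<Rightarrow> (nat \<Rightarrow> 'b) set" where
  "orb x = (\<lambda>\<gamma>. act \<gamma> x) ` \<Gamma>"

definition orbs :: "(nat \<Rightarrow> 'b) set set" where
  "orbs = orb ` nonfixed"

definition ind :: "((nat \<Rightarrow> 'b) \<Rightarrow> nat \<Rightarrow> 'b) \<Rightarrow> (nat \<Rightarrow> 'b) set \<Rightarrow> (nat \<Rightarrow> 'b) set" where
  "ind \<phi> W = (if W \<in> orbs then \<phi> ` W else W)"

lemma finite_Pt: "finite Pt"
proof -
  have "Pt \<subseteq> {f. \<forall>x. (x \<in> {..<n} \<longrightarrow> f x \<in> K) \<and> (x \<notin> {..<n} \<longrightarrow> f x = 0)}"
    by (auto simp: points_def)
  then show ?thesis using finite_subset finite_set_of_finite_funs[OF _ finite_K, of "{..<n}" 0] by blast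
qed

lemma nonfixed_Pt: "x \<in> nonfixed \<Longrightarrow> x \<in> Pt" by (simp add: nonfixed_def)

lemma generic_nonfixed: "x \<in> generic \<Longrightarrow> x \<in> nonfixed" using n_ge_3 by (auto simp: nonfixed_def generic_def intro!: exI[of _ 0])

lemma finite_orbits: "finite orbs"
  using finite_subset[OF _ finite_Pt, of nonfixed] nonfixed_Pt by (auto simp: orbs_def)

lemma orb_self: "x \<in> orb x"
  using G_id by (auto simp: orb_def act_def intro!: image_eqI[of _ _ "one"])

lemma orb_act:
  assumes "\<gamma> \<in> \<Gamma>"
  shows "orb (act \<gamma> x) = orb x"
proof
  show "orb (act \<gamma> x) \<subseteq> orb x"
    using G_comp[OF _ assms] by (auto simp: orb_def act_def image_iff)
  obtain \<delta> where d: "\<delta> \<in> \<Gamma>" "\<forall>i x. \<delta> i (\<gamma> i x) = x \<and> \<gamma> i (\<delta> i x) = x"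
    using G_inv[OF assms] by blast
  show "orb x \<subseteq> orb (act \<gamma> x)"
  proof
    fix y assume "y \<in> orb x"
    then obtain \<epsilon> where e: "\<epsilon> \<in> \<Gamma>" "y = act \<epsilon> x" by (auto simp: orb_def)
    then have "y = act (\<lambda>i x. \<epsilon> i (\<delta> i x)) (act \<gamma> x)" using d by (simp add: act_def)
    then show "y \<in> orb (act \<gamma> x)" using G_comp[OF e(1) d(1)] by (auto simp: orb_def)
  qed
qed

lemma orb_eq_iff: "orb x = orb y \<longleftrightarrow> (\<exists>\<gamma>\<in>\<Gamma>. x = act \<gamma> y)"
proof
  assume "orb x = orb y"
  then have "x \<in> orb y" using orb_self by metis
  then show "\<exists>\<gamma>\<in>\<Gamma>. x = act \<gamma> y" by (auto simp: orb_def)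
qed (use orb_act in auto)

lemma orb_orbits: "x \<in> nonfixed \<Longrightarrow> orb x \<in> orbs" by (simp add: orbs_def)

text \<open>\<open>H\<close> maps points over \<open>F\<close> to points over \<open>F\<close> and
  is closed under inverses, so it also preserves the complement.\<close>

lemma H_nonfixed:
  assumes "\<phi> \<in> H" "x \<in> nonfixed"
  shows "\<phi> x \<in> nonfixed"
proof (rule ccontr)
  assume not: "\<phi> x \<notin> nonfixed"
  have p: "\<phi> permutes Pt" by (rule permutes[OF assms(1)])
  have "\<phi> x \<in> Pt" using permutes_in_image[OF p] nonfixed_Pt[OF assms(2)] by simp
  with not have "\<forall>i<n. \<phi> x i \<in> F" by (auto simp: nonfixed_def)
  then have "\<forall>i<n. inv' \<phi> (\<phi> x) i \<in> F"
    using H_F[OF inv_closed[OF assms(1)] \<open>\<phi> x \<in> Pt\<close>] by blast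
  then show False using assms(2) permutes_inverses(2)[OF p] by (auto simp: nonfixed_def)
qed

lemma H_image_orb:
  assumes "\<phi> \<in> H" "x \<in> nonfixed"
  shows "\<phi> ` orb x = orb (\<phi> x)"
  using H_equiv[OF assms(1) _ nonfixed_Pt[OF assms(2)]] by (auto simp: orb_def act_def image_image)

lemma ind_orb: "\<phi> \<in> H \<Longrightarrow> x \<in> nonfixed \<Longrightarrow> ind \<phi> (orb x) = orb (\<phi> x)"
  by (simp add: ind_def orb_orbits H_image_orb)

lemma ind_comp:
  assumes "\<phi> \<in> H" "\<psi> \<in> H"
  shows "ind (\<phi> \<circ> \<psi>) = ind \<phi> \<circ> ind \<psi>"
proof
  fix W show "ind (\<phi> \<circ> \<psi>) W = (ind \<phi> \<circ> ind \<psi>) W"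
  proof (cases "W \<in> orbs")
    case True
    then obtain x where "x \<in> nonfixed" "W = orb x" by (auto simp: orbs_def)
    then show ?thesis using ind_orb comp_closed[OF assms] assms H_nonfixed by simp
  qed (simp add: ind_def)
qed

lemma ind_id: "ind id = id"
  by (auto simp: ind_def fun_eq_iff)

lemma ind_inv:
  assumes "\<phi> \<in> H"
  shows "inv' (ind \<phi>) = ind (inv' \<phi>)"
  by (rule inv_unique_comp)
    (use ind_comp[OF assms inv_closed[OF assms]] ind_comp[OF inv_closed[OF assms] assms]
      permutes_inv_o[OF permutes[OF assms]] ind_id in simp_all)

lemma ind_permutes:
  assumes "\<phi> \<in> H"
  shows "ind \<phi> permutes orbs"
proof (rule bij_imp_permutes)
  have id: "ind (inv' \<phi>) (ind \<phi> W) = W" "ind \<phi> (ind (inv' \<phi>) W) = W" for W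
    using ind_comp[OF assms inv_closed[OF assms]] ind_comp[OF inv_closed[OF assms] assms]
      permutes_inv_o[OF permutes[OF assms]] ind_id by (metis comp_apply id_apply)+
  have im: "ind \<psi> W \<in> orbs" if "\<psi> \<in> H" "W \<in> orbs" for \<psi> W
    using that H_nonfixed ind_orb by (auto simp: orbs_def)
  show "bij_betw (ind \<phi>) orbs orbs"
    by (rule bij_betw_byWitness[where f' = "ind (inv' \<phi>)"])
      (use id im[OF assms] im[OF inv_closed[OF assms]] in auto)
qed (simp add: ind_def)

lemma ind_group: "perm_group orbs (ind ` H)"
proof
  fix f g assume fg: "f \<in> ind ` H" "g \<in> ind ` H"
  show "f permutes orbs" using fg ind_permutes by auto
  show "f \<circ> g \<in> ind ` H" using fg ind_comp comp_closed by (auto simp: image_iff) metis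
  show "inv' f \<in> ind ` H" using fg ind_inv inv_closed by auto
qed (use ind_id id_closed in \<open>auto simp: image_iff intro!: bexI[of _ id]\<close>)


interpretation Om: perm_group orbs "ind ` H" by (rule ind_group)

section \<open>3-cycles of orbits\<close>

lemma two_point_nonzeroD:
  assumes "two_point i J k y v c x \<noteq> 0"
  shows "\<exists>\<gamma>\<in>\<Gamma>. (\<forall>j\<in>J. x j = \<gamma> j (y j)) \<or> (\<forall>j\<in>J. x j = \<gamma> j ((y(k := v)) j))"
  using assms bump_zero[of J x y i c] bump_zero[of J x "y(k := v)" i c]
  unfolding two_point_def by (metis diff_0_right)

text \<open>The two shears share the bump at \<open>P\<close>, while their compensating bumps sit at
  values \<open>v\<close> and \<open>w\<close> of a third coordinate \<open>k\<close>, in orbits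
  distinct from each other and from that of \<open>P k\<close>. An orbit moved by both must then be
  \<open>orb P\<close>, and the commutator is a 3-cycle.\<close>

lemma cyc3_translates:
  assumes P: "P \<in> generic" and ij: "i < n" "j < n" "i \<noteq> j" and c: "c \<in> K" "c \<noteq> 0" and d: "d \<in> K" "d \<noteq> 0"
  defines "Q \<equiv> P(i := P i + c)" and "R \<equiv> P(j := P j + d)"
  shows "distinct [orb P, orb Q, orb R]" "cyc3 (orb P) (orb Q) (orb R) \<in> ind ` H"
proof -
  obtain k where k: "k < n" "k \<noteq> i" "k \<noteq> j" by (rule exists_third_index[OF n_ge_3])
  have PP: "P \<in> Pt" "P \<in> nonfixed" "\<And>j. j < n \<Longrightarrow> P j \<in> K - F" using P generic_nonfixed Pt_K by (auto simp: generic_def)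
  obtain v where v: "v \<in> K - F" "\<And>\<gamma>. \<gamma> \<in> \<Gamma> \<Longrightarrow> P k \<noteq> \<gamma> k v"
    using exists_other_orbits[OF k(1), of "P k" "P k"] by metis
  obtain w where w: "w \<in> K - F" "\<And>\<gamma>. \<gamma> \<in> \<Gamma> \<Longrightarrow> P k \<noteq> \<gamma> k w" "\<And>\<gamma>. \<gamma> \<in> \<Gamma> \<Longrightarrow> v \<noteq> \<gamma> k w"
    using exists_other_orbits[OF k(1), of "P k" v] by metis
  define f where "f = two_point i ({..<n} - {i}) k P v c"
  define g where "g = two_point j ({..<n} - {j}) k P w d"
  have f: "f \<in> A i" unfolding f_def
    by (rule two_point_closedD[OF two_point_closed_all]) (use k ij PP v c in auto)
  have g: "g \<in> A j" unfolding g_def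
    by (rule two_point_closedD[OF two_point_closed_all]) (use k ij PP w d in auto)
  let ?s = "shear i f" and ?r = "shear j g"
  have H: "?s \<in> H" "?r \<in> H" using f g by (auto simp: A_def)
  have fP: "f P = c"
    unfolding f_def two_point_def using k ij PP v
    by (subst bump_at[where k = k], simp_all, subst bump_zero) (auto intro!: bexI[of _ k])
  have gP: "g P = d"
    unfolding g_def two_point_def using k ij PP w
    by (subst bump_at[where k = k], simp_all, subst bump_zero) (auto intro!: bexI[of _ k])
  have sP: "?s P = Q" "?r P = R" using fP gP PP by (simp_all add: shear_def Q_def R_def)
  have iP: "ind ?s (orb P) = orb Q" "ind ?r (orb P) = orb R"
    using ind_orb[OF H(1) PP(2)] ind_orb[OF H(2) PP(2)] sP by simp_all
  \<comment> \<open>Coordinate \<open>k\<close> is untouched, so an element of \<Gamma> relating the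
    two points fixes \<open>P k\<close> and is trivial.\<close>
  have ne: "orb (P(l := P l + a)) \<noteq> orb P" if "a \<noteq> 0" "k \<noteq> l" for l a
  proof
    assume "orb (P(l := P l + a)) = orb P"
    then obtain \<gamma> where \<gamma>: "\<gamma> \<in> \<Gamma>" "P(l := P l + a) = act \<gamma> P" by (auto simp: orb_eq_iff)
    have "\<gamma> k (P k) = P k" using fun_cong[OF \<gamma>(2), of k] that by simp
    then have "\<gamma> = one" using G_free[OF \<gamma>(1) k(1)] PP k by blast
    then show False using fun_cong[OF \<gamma>(2), of l] that by simp
  qed
  have meet: "W = orb P" if W: "ind ?s W \<noteq> W" "ind ?r W \<noteq> W" for W
  proof -
    obtain x where x: "x \<in> nonfixed" "W = orb x"
      using W(1) by (auto simp: ind_def orbs_def split: if_splits)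
    have "?s x \<noteq> x" "?r x \<noteq> x" using W ind_orb H x by metis+
    then have fg: "f x \<noteq> 0" "g x \<noteq> 0" by (auto simp: shear_def)
    obtain \<gamma> where \<gamma>: "\<gamma> \<in> \<Gamma>"
      and 1: "(\<forall>l\<in>{..<n} - {i}. x l = \<gamma> l (P l)) \<or> (\<forall>l\<in>{..<n} - {i}. x l = \<gamma> l ((P(k := v)) l))"
      using two_point_nonzeroD[OF fg(1)[unfolded f_def]] by blast
    obtain \<delta> where \<delta>: "\<delta> \<in> \<Gamma>"
      and 2: "(\<forall>l\<in>{..<n} - {j}. x l = \<delta> l (P l)) \<or> (\<forall>l\<in>{..<n} - {j}. x l = \<delta> l ((P(k := w)) l))"
      using two_point_nonzeroD[OF fg(2)[unfolded g_def]] by blast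
    have ki: "k \<in> {..<n} - {i}" "k \<in> {..<n} - {j}" using k by auto
    have "x k = \<gamma> k (P k) \<or> x k = \<gamma> k v" using 1 ki by auto
    moreover have "x k = \<delta> k (P k) \<or> x k = \<delta> k w" using 2 ki by auto
    moreover have "\<gamma> k (P k) \<noteq> \<delta> k w" "\<gamma> k v \<noteq> \<delta> k (P k)" "\<gamma> k v \<noteq> \<delta> k w"
      using G_solve[OF \<gamma> \<delta>] G_solve[OF \<delta> \<gamma>] v w by metis+
    ultimately have "x k = \<gamma> k (P k)" "x k = \<delta> k (P k)" by auto
    \<comment> \<open>With a single element of \<Gamma>, one condition describes all coordinates but
      \<open>i\<close> and the other all but \<open>j\<close>; together they describe
      \<open>x\<close> completely.\<close>
    then have eq: "\<gamma> = \<delta>" using G_unique[OF \<gamma> \<delta> k(1) PP(3)[OF k(1)]] by simp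
    have "x k \<noteq> \<gamma> k v" "x k \<noteq> \<delta> k w"
      using \<open>x k = \<gamma> k (P k)\<close> eq \<open>\<gamma> k (P k) \<noteq> \<delta> k w\<close> v(2)[OF G_id] G_eq_iff[OF \<gamma>] by auto
    then have a: "\<forall>l\<in>{..<n} - {i}. x l = \<gamma> l (P l)" and b: "\<forall>l\<in>{..<n} - {j}. x l = \<delta> l (P l)"
      using 1 2 ki by auto
    have "x l = \<gamma> l (P l)" for l
    proof (cases "l < n")
      case True then show ?thesis using a b eq ij(3) by (cases "l = i") auto
    next
      case False then show ?thesis using PP(1) x(1) \<gamma> by (auto simp: nonfixed_def points_def G_0)
    qed
    then have "x = act \<gamma> P" by (simp add: fun_eq_iff)
    then show ?thesis using x(2) orb_act[OF \<gamma>] by simp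
  qed
  have bij: "bij (ind ?s)" "bij (ind ?r)"
    using ind_permutes H permutes_bij by blast+
  note * = commutator_eq_cyc3[OF bij, of "orb P", unfolded iP, OF _ _ meet]
  have "orb Q \<noteq> orb P" "orb R \<noteq> orb P" unfolding Q_def R_def using ne c d k by auto
  note * = *[OF this]
  show "distinct [orb P, orb Q, orb R]" using *(1) by blast
  have "ind ?s \<circ> ind ?r \<circ> inv' (ind ?s) \<circ> inv' (ind ?r) \<in> ind ` H"
    using H by (intro Om.comp_closed Om.inv_closed) auto
  then show "cyc3 (orb P) (orb Q) (orb R) \<in> ind ` H" using *(2) by simp
qed

lemma generic_nonempty: "\<exists>a. a \<in> K - F" "\<exists>x. x \<in> generic"
proof -
  have "0 < n" using n_ge_3 by simp
  then obtain a where a: "a \<in> K - F" using exists_other_orbits by metis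
  then show "\<exists>a. a \<in> K - F" by blast
  have "(\<lambda>i. if i < n then a else 0) \<in> generic" using a by (auto simp: generic_def points_def)
  then show "\<exists>x. x \<in> generic" by blast
qed

text \<open>The 3-cycle needs a displacement in a second direction \<open>j\<close> as well; any
  nonzero one will do, such as the element \<open>a\<close> outside \<open>F\<close>. The new value
  \<open>t\<close> may itself lie in \<open>F\<close>.\<close>

lemma linked_translate:
  assumes P: "P \<in> generic" and i: "i < n" and t: "t \<in> K"
  shows "Om.linked (orb P) (orb (P(i := t)))"
proof (cases "t = P i")
  case True
  then show ?thesis by (simp add: Om.linked_def)
next
  case False
  obtain a where a: "a \<in> K - F" using generic_nonempty by blast
  obtain j where j: "j < n" "j \<noteq> i" by (rule exists_third_index[OF n_ge_3])
  have "t - P i \<in> K" using t P Pt_K by (auto simp: generic_def K_diff)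
  moreover have "a \<noteq> 0" using a F_0 by auto
  ultimately show ?thesis
    using cyc3_translates[OF P i j(1) j(2)[symmetric], of "t - P i" a] False a
    unfolding Om.linked_def by (metis Diff_iff add_diff_cancel_left' diff_add_cancel eq_iff_diff_eq_0 add.commute)
qed

lemma linked_generic:
  assumes P: "P \<in> generic" and Q: "Q \<in> generic"
  shows "Om.linked (orb P) (orb Q)"
proof -
  \<comment> \<open>Exchanging one coordinate at a time keeps every intermediate point
    generic.\<close>
  define R where "R m i = (if i < m then Q i else P i)" for m i :: nat
  have RY: "R m \<in> generic" for m using P Q by (auto simp: R_def generic_def points_def)
  have "Om.linked (orb P) (orb (R m))" if "m \<le> n" for m
    using that
  proof (induction m)
    case 0
    have "R 0 = P" by (auto simp: R_def)
    then show ?case by (simp add: Om.linked_def)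
  next
    case (Suc m)
    have "R (Suc m) = (R m)(m := Q m)" by (auto simp: R_def fun_eq_iff)
    then have "Om.linked (orb (R m)) (orb (R (Suc m)))"
      using linked_translate[OF RY, of m "Q m"] Suc.prems Q Pt_K by (auto simp: generic_def)
    then show ?case using Suc Om.linked_trans by (meson Suc_leD)
  qed
  moreover have "R n = Q" using P Q by (auto simp: R_def generic_def points_def fun_eq_iff)
  ultimately show ?thesis by auto
qed

text \<open>Induction on the number of coordinates in \<open>F\<close>. A shear by a bump at
  \<open>x j\<close> moves one such coordinate out of \<open>F\<close>, yet fixes a generic
  \<open>Q\<close> whose coordinate \<open>j\<close> lies in another orbit. Its inverse turns the
  link from \<open>Q\<close> to the improved point into a link from \<open>Q\<close> to
  \<open>x\<close>.\<close>

lemma linked_nonfixed: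
  assumes P: "P \<in> generic" and x: "x \<in> nonfixed"
  shows "Om.linked (orb P) (orb x)"
  using x
proof (induction "card {i. i < n \<and> x i \<in> F}" arbitrary: x rule: less_induct)
  case less
  show ?case
  proof (cases "x \<in> generic")
    case True
    then show ?thesis by (rule linked_generic[OF P])
  next
    case False
    have xP: "x \<in> Pt" by (rule nonfixed_Pt[OF less.prems])
    obtain i where i: "i < n" "x i \<in> F" using False xP by (auto simp: generic_def)
    obtain j where j: "j < n" "x j \<notin> F" using less.prems by (auto simp: nonfixed_def)
    have ij: "i \<noteq> j" using i j by auto
    have xj: "x j \<in> K - F" using j Pt_K[OF xP] by auto
    obtain a where a: "a \<in> K - F" using generic_nonempty by blast
    have c: "a - x i \<in> K" using a Pt_K[OF xP] by (auto simp: K_diff)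
    define \<phi> where "\<phi> = shear i (bmp i {j} x (a - x i))"
    have \<phi>: "\<phi> \<in> H" unfolding \<phi>_def using bump_single[OF i(1) j(1) ij, of x, OF xj c] by (simp add: A_def)
    have "bmp i {j} x (a - x i) x = a - x i"
      using bump_at[of j "{j}" x x] j(1) xj by simp
    then have \<phi>x: "\<phi> x = x(i := a)" unfolding \<phi>_def by (simp add: shear_def xP)
    have "{l. l < n \<and> (\<phi> x) l \<in> F} \<subset> {l. l < n \<and> x l \<in> F}"
      using i a by (auto simp: \<phi>x split: if_splits)
    then have "card {l. l < n \<and> (\<phi> x) l \<in> F} < card {l. l < n \<and> x l \<in> F}"
      by (intro psubset_card_mono) auto
    then have 1: "Om.linked (orb P) (orb (\<phi> x))"
      using less.hyps[of "\<phi> x"] H_nonfixed[OF \<phi> less.prems] by blast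
    obtain b where b: "b \<in> K - F" "\<And>\<gamma>. \<gamma> \<in> \<Gamma> \<Longrightarrow> x j \<noteq> \<gamma> j b"
      using exists_other_orbits[OF j(1), of "x j" "x j"] by metis
    define Q where "Q = P(j := b)"
    have Q: "Q \<in> generic" using P b j by (auto simp: Q_def generic_def points_def)
    have "bmp i {j} x (a - x i) Q = 0"
    proof (rule bump_zero, rule notI)
      assume "\<exists>\<gamma>\<in>\<Gamma>. \<forall>l\<in>{j}. Q l = \<gamma> l (x l)"
      then obtain \<gamma> where g: "\<gamma> \<in> \<Gamma>" "b = \<gamma> j (x j)" by (auto simp: Q_def)
      then show False using G_solve[OF g(1) G_id] b(2) by metis
    qed
    then have "\<phi> Q = Q" unfolding \<phi>_def by (simp add: shear_def)
    then have fixQ: "ind \<phi> (orb Q) = orb Q" using ind_orb[OF \<phi> generic_nonfixed[OF Q]] by simp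
    have inj: "inj (ind \<phi>)" using ind_permutes[OF \<phi>] permutes_inj by blast
    have "Om.linked (orb Q) (orb (\<phi> x))"
      using Om.linked_trans[OF linked_generic[OF Q P] 1] .
    then have "Om.linked (ind \<phi> (orb Q)) (ind \<phi> (orb x))"
      using fixQ ind_orb[OF \<phi> less.prems] by simp
    then have "Om.linked (orb Q) (orb x)"
      using Om.linked_image[OF Om.inv_closed[of "ind \<phi>"]] \<phi> inv_f_f[OF inj] by (metis imageI)
    then show ?thesis using Om.linked_trans[OF linked_generic[OF P Q]] by blast
  qed
qed

theorem cyc3_mem_ind:
  assumes "a \<in> orbs" "b \<in> orbs" "c \<in> orbs" "distinct [a, b, c]"
  shows "cyc3 a b c \<in> ind ` H"
proof -
  obtain P where P: "P \<in> generic" using generic_nonempty by blast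
  have l: "Om.linked (orb P) W" if "W \<in> orbs" for W
    using that linked_nonfixed[OF P] by (auto simp: orbs_def)
  show ?thesis
    using assms Om.cyc3_mem_if_linked Om.linked_trans[OF Om.linked_sym[OF l] l] by blast
qed

text \<open>The points \<open>(a, 0, ..., 0)\<close> with \<open>a\<close> outside \<open>F\<close>
  already number \<open>card K - card F\<close>, and every orbit has at most
  \<open>card \<Gamma>\<close> points; \<open>K_large\<close> does the rest.\<close>

lemma card_orbs: "card \<Gamma> \<le> card orbs"
proof -
  define e where "e a = (\<lambda>i::nat. if i = 0 then a else 0)" for a :: 'b
  have n: "0 < n" using n_ge_3 by simp
  have e: "e ` (K - F) \<subseteq> nonfixed" using n K_0 by (auto simp: e_def nonfixed_def points_def)
  have "nonfixed \<subseteq> \<Union> orbs" using orb_self by (auto simp: orbs_def)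
  have finX: "finite nonfixed" using finite_subset[OF _ finite_Pt] nonfixed_Pt by blast
  have "card K - card F \<le> card (K - F)" by (rule diff_card_le_card_Diff) (use F_subset finite_K finite_subset in blast)
  also have "\<dots> = card (e ` (K - F))"
    by (rule card_image[symmetric]) (auto simp: inj_on_def e_def fun_eq_iff split: if_splits)
  also have "\<dots> \<le> card nonfixed" by (rule card_mono[OF finX e])
  also have "nonfixed \<subseteq> (\<Union>W\<in>orbs. W)" using orb_self by (auto simp: orbs_def)
  then have "card nonfixed \<le> card (\<Union>W\<in>orbs. W)"
    by (rule card_mono[rotated]) (use finite_orbits finite_G in \<open>auto simp: orbs_def orb_def\<close>)
  also have "\<dots> \<le> card orbs * card \<Gamma>"
    by (rule card_UN_le_mult[OF finite_orbits]) (auto simp: orbs_def orb_def intro: card_image_le[OF finite_G])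
  finally have 1: "card K - card F \<le> card orbs * card \<Gamma>" .
  have "1 * card F \<le> (card \<Gamma> * card \<Gamma>) * card F"
    using card_G by (intro mult_right_mono) (simp_all add: one_le_mult_iff)
  moreover have "(card \<Gamma> * card \<Gamma>) * 1 \<le> (card \<Gamma> * card \<Gamma>) * card F"
    using card_F by (intro mult_le_mono2)
  ultimately have "card \<Gamma> * card \<Gamma> < card orbs * card \<Gamma>"
    using 1 K_large unfolding power2_eq_square mult.assoc by linarith
  then show ?thesis by simp
qed

end

section \<open>Cyclic extensions of prime degree\<close>

lemma card_nth_roots_le:
  fixes a :: "'b::field"
  assumes "0 < k"
  shows "finite {z. z ^ k = a} \<and> card {z. z ^ k = a} \<le> k"
proof -
  let ?P = "monom 1 k + [:- a:]"
  have "degree ?P = k" using assms by (subst degree_add_eq_left) (simp_all add: degree_monom_eq)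
  moreover from this have "?P \<noteq> 0" using assms by auto
  moreover have "{z. poly ?P z = 0} = {z. z ^ k = a}" by (simp add: poly_monom add_eq_0_iff)
  ultimately show ?thesis using poly_roots_finite[of ?P] card_poly_roots_bound[of ?P] by simp
qed

text \<open>Both fields are cut out of an algebraically closed field as fixed points of powers of
  Frobenius. Closure under the field operations is then a computation, and only the cardinality
  needs an argument.\<close>

locale cyclic_extension =
  fixes p m E :: nat and K F :: "'b::alg_closed_field set"
  assumes prime_p: "Factorial_Ring.prime p" and CHAR: "CHAR('b) = p"
    and prime_m: "Factorial_Ring.prime m" and E: "2 \<le> E" "E \<le> m" "E < p"
    and K: "K = {x. x ^ (p ^ m) = x}" and F: "F = {x. x ^ p = x}"
begin

lemma p_gt_1: "1 < p"
  using prime_p prime_gt_1_nat by blast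

lemma fr_add: "(x + y :: 'b) ^ (p ^ s) = x ^ (p ^ s) + y ^ (p ^ s)"
  using freshmans_dream'[where ?'a = 'b, of "p ^ s" s x y] prime_p CHAR by simp

lemma fr_uminus: "(- x :: 'b) ^ (p ^ s) = - (x ^ (p ^ s))"
  using fr_add[of x "- x" s] p_gt_1 by (simp add: zero_power eq_neg_iff_add_eq_0 add.commute)

lemma fr_diff: "(x - y :: 'b) ^ (p ^ s) = x ^ (p ^ s) - y ^ (p ^ s)"
  using fr_add[of x "- y" s] fr_uminus by simp

lemma fr_sum: "(\<Sum>a\<in>S. f a :: 'b) ^ (p ^ s) = (\<Sum>a\<in>S. f a ^ (p ^ s))"
  using p_gt_1 by (induction S rule: infinite_finite_induct) (auto simp: fr_add zero_power)

lemma fr_fr: "((x :: 'b) ^ (p ^ s)) ^ (p ^ t) = x ^ (p ^ (s + t))"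
  by (simp add: power_mult[symmetric] power_add)

lemma fr_inj: "(x :: 'b) ^ (p ^ s) = y ^ (p ^ s) \<Longrightarrow> x = y"
  using fr_diff[of x y s] by simp

lemma F_K: "F \<subseteq> K"
proof
  fix x assume "x \<in> F"
  then have "x ^ (p ^ s) = x" for s
    by (induction s) (auto simp: F power_mult)
  then show "x \<in> K" by (simp add: K)
qed

lemma F_fr: "x \<in> F \<Longrightarrow> x ^ (p ^ s) = x"
  by (induction s) (auto simp: F power_mult)


lemma K_iff: "x \<in> K \<longleftrightarrow> x ^ (p ^ m) = x"
  by (simp add: K)

lemma fixed_closed:
  fixes s :: nat
  defines "S \<equiv> {x :: 'b. x ^ (p ^ s) = x}"
  shows "0 \<in> S" "1 \<in> S" "x \<in> S \<Longrightarrow> y \<in> S \<Longrightarrow> x + y \<in> S" "x \<in> S \<Longrightarrow> - x \<in> S"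
  "x \<in> S \<Longrightarrow> y \<in> S \<Longrightarrow> x - y \<in> S" "x \<in> S \<Longrightarrow> y \<in> S \<Longrightarrow> x * y \<in> S"
  "x \<in> S \<Longrightarrow> inverse x \<in> S" "x \<in> S \<Longrightarrow> y \<in> S \<Longrightarrow> x / y \<in> S" "x \<in> S \<Longrightarrow> x ^ k \<in> S"
proof -
  have "(x ^ k) ^ (p ^ s) = (x ^ (p ^ s)) ^ k" for x :: 'b
    by (simp add: mult.commute flip: power_mult)
  then show "x \<in> S \<Longrightarrow> x ^ k \<in> S" by (simp add: S_def)
qed (use p_gt_1 in \<open>auto simp: S_def zero_power fr_add fr_uminus fr_diff power_mult_distrib
      power_inverse power_divide\<close>)

lemma F_eq: "F = {x. x ^ (p ^ 1) = x}"
  by (simp add: F)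

lemma K_closed:
  "0 \<in> K" "1 \<in> K" "x \<in> K \<Longrightarrow> y \<in> K \<Longrightarrow> x + y \<in> K" "x \<in> K \<Longrightarrow> - x \<in> K"
  "x \<in> K \<Longrightarrow> y \<in> K \<Longrightarrow> x - y \<in> K" "x \<in> K \<Longrightarrow> y \<in> K \<Longrightarrow> x * y \<in> K"
  "x \<in> K \<Longrightarrow> inverse x \<in> K" "x \<in> K \<Longrightarrow> y \<in> K \<Longrightarrow> x / y \<in> K" "x \<in> K \<Longrightarrow> x ^ k \<in> K"
  unfolding K by (rule fixed_closed; assumption)+

lemma F_closed:
  "0 \<in> F" "1 \<in> F" "x \<in> F \<Longrightarrow> y \<in> F \<Longrightarrow> x + y \<in> F" "x \<in> F \<Longrightarrow> - x \<in> F"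
  "x \<in> F \<Longrightarrow> y \<in> F \<Longrightarrow> x - y \<in> F" "x \<in> F \<Longrightarrow> y \<in> F \<Longrightarrow> x * y \<in> F"
  "x \<in> F \<Longrightarrow> inverse x \<in> F" "x \<in> F \<Longrightarrow> y \<in> F \<Longrightarrow> x / y \<in> F" "x \<in> F \<Longrightarrow> x ^ k \<in> F"
  unfolding F_eq by (rule fixed_closed; assumption)+


text \<open>The polynomial \<open>X^(p^s) - X\<close> has derivative -1, hence no repeated root, so
  the multiset of its roots is a set whose size is the degree.\<close>

lemma card_fixed: "0 < s \<Longrightarrow> finite {x :: 'b. x ^ (p ^ s) = x} \<and> card {x :: 'b. x ^ (p ^ s) = x} = p ^ s"
proof -
  assume s: "0 < s"
  define P :: "'b poly" where "P = monom 1 (p ^ s) + monom (- 1) 1"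
  have q: "1 < p ^ s" using p_gt_1 s by (rule one_less_power)
  have deg: "degree P = p ^ s" unfolding P_def
    by (subst degree_add_eq_left) (use q in \<open>auto simp: degree_monom_eq\<close>)
  then have P0: "P \<noteq> 0" using q by (metis degree_0 not_one_less_zero)
  have roots: "{x. poly P x = 0} = {x :: 'b. x ^ (p ^ s) = x}"
    by (auto simp: P_def poly_monom add_eq_0_iff)
  have "of_nat (p ^ s) = (0 :: 'b)" using CHAR s by (simp add: of_nat_eq_0_iff_char_dvd)
  then have der: "pderiv P = [:- 1:]" by (simp add: P_def pderiv_add pderiv_monom monom_0 flip: of_nat_power)
  obtain A where A: "size A = degree P" "P = smult (lead_coeff P) (\<Prod>x\<in>#A. [:- x, 1:])"
    using alg_closed_imp_factorization[OF P0] by blast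
  have set_A: "set_mset A = {x. poly P x = 0}"
  proof -
    have "poly P x = lead_coeff P * (\<Prod>y\<in>#A. x - y)" for x
      by (subst A(2)) (simp add: poly_prod_mset image_mset.compositionality o_def)
    then show ?thesis using P0 by (auto simp: prod_mset_zero_iff)
  qed
  have "count A x \<le> 1" for x
  proof (rule ccontr)
    assume "\<not> ?thesis"
    then have "{#x, x#} \<subseteq># A" by (auto simp: subseteq_mset_def)
    then obtain B where B: "A = {#x, x#} + B" by (metis subset_mset.le_iff_add)
    have "P = [:- x, 1:] * ([:- x, 1:] * smult (lead_coeff P) (\<Prod>y\<in>#B. [:- y, 1:]))"
      by (subst A(2)) (simp add: B mult_ac)
    then obtain R where "P = [:- x, 1:] * ([:- x, 1:] * R)" by blast
    then have "poly (pderiv P) x = 0" by (simp only: pderiv_mult) simp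
    then show False by (simp add: der)
  qed
  then have "mset_set (set_mset A) = A"
    by (intro multiset_eqI) (metis One_nat_def count_eq_zero_iff count_mset_set(1,3) finite_set_mset
        le_Suc_eq le_zero_eq)
  then have "card (set_mset A) = p ^ s" using A(1) deg by (metis size_mset_set)
  then show ?thesis using set_A roots by (metis finite_set_mset)
qed

lemma finite_K: "finite K" and card_K: "card K = p ^ m"
  using card_fixed[of m] prime_gt_0_nat[OF prime_m] by (auto simp: K)

lemma finite_F: "finite F" and card_F: "card F = p"
  using card_fixed[of 1] by (auto simp: F)

text \<open>Multiplying by an element of \<open>F\<close> is therefore repeated addition, which
  makes the groups \<open>A i\<close> closed under scalars from \<open>F\<close>.\<close>

lemma F_eq_of_nat: "F = of_nat ` {..<p}"
proof -
  have "of_nat r \<in> F" for r by (induction r) (auto simp: F_closed)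
  then have sub: "of_nat ` {..<p} \<subseteq> F" by blast
  have "inj_on (of_nat :: nat \<Rightarrow> 'b) {..<p}"
  proof (rule linorder_inj_onI)
    fix x y assume "x < y" "x \<in> {..<p}" "y \<in> {..<p}"
    then have "\<not> p dvd (y - x)" by (intro nat_dvd_not_less) auto
    then have "of_nat (y - x) \<noteq> (0 :: 'b)" by (simp add: of_nat_eq_0_iff_char_dvd CHAR)
    then show "of_nat x \<noteq> (of_nat y :: 'b)" using \<open>x < y\<close> by (auto simp: of_nat_diff)
  qed auto
  then have "card (of_nat ` {..<p} :: 'b set) = card F" by (simp add: card_image card_F)
  then show ?thesis using card_subset_eq[OF finite_F sub] by simp
qed

lemma fr_mod_m: "x \<in> K \<Longrightarrow> x ^ (p ^ s) = x ^ (p ^ (s mod m))"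
proof -
  assume x: "x \<in> K"
  have "x ^ (p ^ (m * t)) = x" for t
    by (induction t) (use x in \<open>auto simp: K_iff power_add power_mult\<close>)
  then have "x ^ (p ^ (m * (s div m) + s mod m)) = x ^ (p ^ (s mod m))"
    by (simp only: power_add power_mult)
  then show ?thesis by simp
qed

text \<open>As \<open>m\<close> is prime, \<open>s\<close> is invertible modulo \<open>m\<close>;
  iterating the given power of Frobenius until the exponent is 1 modulo \<open>m\<close> shows that
  Frobenius itself fixes \<open>x\<close>.\<close>

lemma fr_fixed_F:
  assumes x: "x \<in> K" and s: "x ^ (p ^ s) = x" "0 < s" "s < m"
  shows "x \<in> F"
proof -
  have "coprime s m" using prime_m s by (metis coprime_commute nat_dvd_not_less prime_imp_coprime)
  then obtain a b where "s * a = m * b + 1" using bezout_nat[of s m] s(2) by auto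
  then have "(s * a) mod m = 1 mod m" by (simp only: mod_mult_self4)
  then have "(s * a) mod m = 1" using prime_gt_1_nat[OF prime_m] by simp
  moreover have "x ^ (p ^ (s * t)) = x" for t
    by (induction t) (use s in \<open>auto simp: power_add power_mult\<close>)
  ultimately have "x ^ (p ^ 1) = x" using fr_mod_m[OF x, of "s * a"] by simp
  then show ?thesis by (simp add: F)
qed

lemma fr_distinct:
  assumes x: "x \<in> K - F" and st: "s < m" "t < m" and eq: "x ^ (p ^ s) = x ^ (p ^ t)"
  shows "s = t"
proof -
  have *: "s = t" if "s \<le> t" "t < m" "x ^ (p ^ s) = x ^ (p ^ t)" for s t
  proof (rule ccontr)
    assume "s \<noteq> t"
    have "x ^ (p ^ s) = (x ^ (p ^ (t - s))) ^ (p ^ s)" using that by (simp add: fr_fr)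
    then have "x ^ (p ^ (t - s)) = x" using fr_inj by metis
    then show False using fr_fixed_F[of x "t - s"] x that \<open>s \<noteq> t\<close> by force
  qed
  show ?thesis using *[of s t] *[of t s] st eq by (cases "s \<le> t") auto
qed

text \<open>Outside \<open>F\<close> the \<open>m\<close> conjugates of \<open>x\<close> would be
  distinct roots of \<open>z^(E - 1) = x^(E - 1)\<close>, which has at most \<open>E - 1 < m\<close>
  roots.\<close>

lemma root_in_F:
  assumes x: "x \<in> K" and y: "x ^ (E - 1) \<in> F"
  shows "x \<in> F"
proof (rule ccontr)
  assume "x \<notin> F"
  then have "inj_on (\<lambda>s. x ^ (p ^ s)) {..<m}"
    using fr_distinct x by (auto simp: inj_on_def)
  then have "card ((\<lambda>s. x ^ (p ^ s)) ` {..<m}) = m" by (simp add: card_image)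
  moreover have "(\<lambda>s. x ^ (p ^ s)) ` {..<m} \<subseteq> {z. z ^ (E - 1) = x ^ (E - 1)}"
  proof
    fix z assume "z \<in> (\<lambda>s. x ^ (p ^ s)) ` {..<m}"
    then obtain s where "z = x ^ (p ^ s)" by blast
    then have "z ^ (E - 1) = (x ^ (E - 1)) ^ (p ^ s)" by (simp add: power_mult[symmetric] mult.commute)
    then show "z \<in> {z. z ^ (E - 1) = x ^ (E - 1)}" using F_fr[OF y] by simp
  qed
  moreover have "finite {z. z ^ (E - 1) = x ^ (E - 1)}" "card {z. z ^ (E - 1) = x ^ (E - 1)} \<le> E - 1"
    using card_nth_roots_le[of "E - 1"] E by auto
  ultimately have "m \<le> E - 1" using card_mono by (metis le_trans)
  then show False using E by simp
qed

definition tr :: "'b \<Rightarrow> 'b" where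
  "tr x = (\<Sum>s<m. x ^ (p ^ s))"

lemma tr_F: "x \<in> K \<Longrightarrow> tr x \<in> F"
proof -
  assume x: "x \<in> K"
  have "tr x ^ (p ^ 1) = (\<Sum>s<m. x ^ (p ^ Suc s))" unfolding tr_def fr_sum fr_fr by simp
  also have "\<dots> = (\<Sum>s<Suc m. x ^ (p ^ s)) - x ^ (p ^ 0)" unfolding sum.lessThan_Suc_shift by simp
  also have "\<dots> = tr x" using x by (simp add: tr_def K_iff)
  finally show ?thesis by (simp add: F)
qed

text \<open>For \<open>0 < k < p - 1\<close> some nonzero \<open>s\<close> in \<open>F\<close> has
  \<open>s^k \<noteq> 1\<close>, and scaling by \<open>s\<close> shows that the sum vanishes. For
  \<open>k = 0\<close> the sum is \<open>p = 0\<close>, as \<open>0^0 = 1\<close>. The upper bound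
  stops just short of \<open>2 * (p - 1)\<close>, where the sum would be -1 again.\<close>

lemma power_sum_F:
  assumes "k \<le> 2 * (p - 1) - 1"
  shows "(\<Sum>r\<in>F. r ^ k) = (if k = p - 1 then - 1 else 0)"
proof -
  have F1: "r ^ (p - 1) = 1" if "r \<in> F" "r \<noteq> 0" for r
  proof -
    have "r ^ (p - 1) * r = r" using that p_gt_1 by (simp add: F flip: power_Suc2)
    then show ?thesis using that by simp
  qed
  have small: "(\<Sum>r\<in>F. r ^ k) = 0" if k: "0 < k" "k < p - 1" for k
  proof -
    have "\<exists>s\<in>F - {0}. s ^ k \<noteq> 1"
    proof (rule ccontr)
      assume "\<not> ?thesis"
      then have "F - {0} \<subseteq> {z. z ^ k = 1}" by auto
      moreover have "finite {z::'b. z ^ k = 1}" "card {z::'b. z ^ k = 1} \<le> k"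
        using card_nth_roots_le[of k] k by auto
      ultimately have "card (F - {0}) \<le> k" using card_mono by (metis le_trans)
      then show False using k by (simp add: card_F F_closed finite_F)
    qed
    then obtain s where s: "s \<in> F" "s \<noteq> 0" "s ^ k \<noteq> 1" by blast
    have "(\<Sum>r\<in>F. r ^ k) = (\<Sum>r\<in>F. (s * r) ^ k)"
      by (rule sum.reindex_bij_witness[of _ "\<lambda>r. s * r" "\<lambda>r. inverse s * r"]) (use s in \<open>auto simp: F_closed mult.assoc[symmetric]\<close>)
    also have "\<dots> = s ^ k * (\<Sum>r\<in>F. r ^ k)" by (simp add: power_mult_distrib sum_distrib_left)
    finally have "(1 - s ^ k) * (\<Sum>r\<in>F. r ^ k) = 0" by (simp add: algebra_simps)
    then show ?thesis using s by simp
  qed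
  have p0: "of_nat p = (0 :: 'b)" by (simp add: of_nat_eq_0_iff_char_dvd CHAR)
  consider "k = 0" | "0 < k" "k < p - 1" | "k = p - 1" | "p - 1 < k" by linarith
  then show ?thesis
  proof cases
    case 1 then show ?thesis using p0 p_gt_1 by (simp add: card_F)
  next
    case 2 then show ?thesis using small by simp
  next
    case 3
    have "(\<Sum>r\<in>F. r ^ k) = 0 ^ k + (\<Sum>r\<in>F - {0}. r ^ k)"
      by (rule sum.remove) (simp_all add: finite_F F_closed)
    also have "(\<Sum>r\<in>F - {0}. r ^ k) = of_nat (p - 1)" using F1 3 by (simp add: card_F F_closed finite_F)
    finally show ?thesis using 3 p0 p_gt_1 by (simp add: zero_power of_nat_diff)
  next
    case 4
    have "(\<Sum>r\<in>F. r ^ k) = (\<Sum>r\<in>F. r ^ (k - (p - 1)))"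
    proof (rule sum.cong)
      fix r assume "r \<in> F"
      have "r ^ k = r ^ (k - (p - 1)) * r ^ (p - 1)" using 4 by (simp flip: power_add)
      then show "r ^ k = r ^ (k - (p - 1))" using F1[OF \<open>r \<in> F\<close>] 4 by (cases "r = 0") (auto simp: zero_power)
    qed simp
    then show ?thesis using small[of "k - (p - 1)"] 4 assms by simp
  qed
qed

end

section \<open>Shears by monomials\<close>

definition weight :: "nat \<Rightarrow> (nat \<Rightarrow> nat) \<Rightarrow> nat \<Rightarrow> nat" where
  "weight n e i = (\<Prod>k\<in>{i..<n}. e k)"

context cyclic_extension
begin

text \<open>Being the identity outside \<open>K\<close>, a twist has an inverse on the whole type,
  and the one with parameters 1 and 0 is literally the identity.\<close>

definition twist :: "(nat \<Rightarrow> nat) \<Rightarrow> 'b \<Rightarrow> nat \<Rightarrow> nat \<Rightarrow> 'b \<Rightarrow> 'b" where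
  "twist w l s i x = (if x \<in> K then l ^ w i * x ^ (p ^ s) else x)"

definition twists :: "(nat \<Rightarrow> nat) \<Rightarrow> (nat \<Rightarrow> 'b \<Rightarrow> 'b) set" where
  "twists w = {twist w l s | l s. l \<in> K \<and> l ^ (E - 1) = 1 \<and> s < m}"

end

locale tame_action = cyclic_extension p m E K F + point_system n K H
  for p m E n :: nat and K F :: "'b::alg_closed_field set" and H +
  fixes e :: "nat \<Rightarrow> nat"
  assumes n_ge_3: "3 \<le> n"
    and e_pos: "i < n \<Longrightarrow> 0 < e i"
    and E_prod: "E = (\<Prod>i<n. e i)"
    and gen: "i < n \<Longrightarrow> (\<lambda>x. x (Suc i mod n) ^ e i) \<in> A i"
    and H_equiv: "\<phi> \<in> H \<Longrightarrow> \<gamma> \<in> twists (weight n e) \<Longrightarrow> x \<in> points n K \<Longrightarrow>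
        \<phi> (\<lambda>i. \<gamma> i (x i)) = (\<lambda>i. \<gamma> i (\<phi> x i))"
    and H_F: "\<phi> \<in> H \<Longrightarrow> x \<in> points n K \<Longrightarrow> \<forall>i<n. x i \<in> F \<Longrightarrow> i < n \<Longrightarrow> \<phi> x i \<in> F"
    and K_large: "3 * (m * E)\<^sup>2 * p < p ^ m"
begin

lemma A_scale:
  assumes "i < n" "f \<in> A i" "r \<in> F"
  shows "(\<lambda>x. r * f x) \<in> A i"
proof -
  obtain k where "r = of_nat k" using assms(3) by (auto simp: F_eq_of_nat)
  moreover have "(\<lambda>x. of_nat k * f x) \<in> A i"
  proof (induction k)
    case (Suc k)
    then show ?case using A_add[OF assms(1,2) Suc] by (simp add: algebra_simps)
  qed (simp add: A_zero)
  ultimately show ?thesis by simp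
qed

text \<open>Weighting by \<open>- r^(p - 1 - k)\<close> and summing over \<open>F\<close> leaves
  only \<open>l = k\<close>: the exponents \<open>p - 1 - k + l\<close> stay within the range of
  \<open>power_sum_F\<close> because \<open>k \<ge> 1\<close> and \<open>a < p\<close>.\<close>

lemma A_extract:
  assumes i: "i < n" and k: "1 \<le> k" "k \<le> a" "a < p"
    and f: "\<And>r. r \<in> F \<Longrightarrow> (\<lambda>x. \<Sum>l\<le>a. r ^ l * h l x) \<in> A i"
  shows "h k \<in> A i"
proof -
  have "(\<lambda>x. \<Sum>r\<in>F. - (r ^ (p - 1 - k)) * (\<Sum>l\<le>a. r ^ l * h l x)) \<in> A i"
    by (intro A_sum A_scale f i) (auto simp: F_closed)
  moreover have "h k x = (\<Sum>r\<in>F. - (r ^ (p - 1 - k)) * (\<Sum>l\<le>a. r ^ l * h l x))" for x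
  proof -
    have "(\<Sum>r\<in>F. - (r ^ (p - 1 - k)) * (\<Sum>l\<le>a. r ^ l * h l x))
        = (\<Sum>r\<in>F. \<Sum>l\<le>a. - (r ^ (p - 1 - k + l)) * h l x)"
      by (simp add: sum_distrib_left power_add mult_ac)
    also have "\<dots> = (\<Sum>l\<le>a. - (\<Sum>r\<in>F. r ^ (p - 1 - k + l)) * h l x)"
      by (subst sum.swap) (simp add: sum_distrib_right sum_negf)
    also have "\<dots> = (\<Sum>l\<le>a. if l = k then h k x else 0)"
    proof (rule sum.cong)
      fix l assume "l \<in> {..a}"
      then have "p - 1 - k + l \<le> 2 * (p - 1) - 1" "p - 1 - k + l = p - 1 \<longleftrightarrow> l = k" using k by auto
      then show "- (\<Sum>r\<in>F. r ^ (p - 1 - k + l)) * h l x = (if l = k then h k x else 0)"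
        using power_sum_F[of "p - 1 - k + l"] by simp
    qed simp
    also have "\<dots> = h k x" using k by simp
    finally show ?thesis by simp
  qed
  ultimately show ?thesis using A_cong[OF i] by blast
qed

text \<open>Exactly \<open>k\<close> of the \<open>a\<close> factors \<open>x j\<close> are replaced
  by \<open>g\<close>: this is the \<open>r^k\<close> term in the expansion of
  \<open>(x j + r * g x)^a\<close>, up to a binomial coefficient.\<close>

lemma A_subst:
  assumes ij: "i < n" "j < n" "i \<noteq> j" and a: "a < p" and k: "1 \<le> k" "k \<le> a"
    and f: "(\<lambda>x. x j ^ a * M x) \<in> A i" and g: "g \<in> A j" "g \<in> fns i"
    and M: "\<And>x t. M (x(j := t)) = M x"
  shows "(\<lambda>x. x j ^ (a - k) * g x ^ k * M x) \<in> A i"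
proof -
  \<comment> \<open>The term for \<open>l = 0\<close> is 0 because the commutator subtracts the
    unshifted monomial.\<close>
  define h where "h l x = (if l = 0 then 0 else of_nat (a choose l) * x j ^ (a - l) * g x ^ l * M x)"
    for l and x :: "nat \<Rightarrow> 'b"
  have "(\<lambda>x. \<Sum>l\<le>a. r ^ l * h l x) \<in> A i" if r: "r \<in> F" for r
  proof -
    have "(\<lambda>x. r * g x) \<in> fns i"
      using g(2) r F_K by (auto simp: fns_def K_closed)
    then have "(\<lambda>x. (x(j := x j + r * g x)) j ^ a * M (x(j := x j + r * g x)) - x j ^ a * M x) \<in> A i"
      using A_commutator[OF ij f A_scale[OF ij(2) g(1) r]] by simp
    moreover have "(x(j := x j + r * g x)) j ^ a * M (x(j := x j + r * g x)) - x j ^ a * M x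
        = (\<Sum>l\<le>a. r ^ l * h l x)" for x
    proof -
      have "(x j + r * g x) ^ a = (r * g x + x j) ^ a" by (simp add: add.commute)
      also have "\<dots> = (\<Sum>l\<le>a. of_nat (a choose l) * (r * g x) ^ l * x j ^ (a - l))"
        by (rule binomial_ring)
      finally have "(x j + r * g x) ^ a * M x - x j ^ a * M x
          = (\<Sum>l\<le>a. of_nat (a choose l) * (r * g x) ^ l * x j ^ (a - l) * M x) - x j ^ a * M x"
        by (simp add: sum_distrib_right)
      also have "\<dots> = (\<Sum>l\<le>a. r ^ l * h l x)"
        by (subst (1 2) sum.atMost_shift) (simp add: h_def power_mult_distrib mult_ac)
      finally show ?thesis by (simp add: M)
    qed
    ultimately show ?thesis by simp
  qed
  then have hk: "h k \<in> A i" using A_extract[OF ij(1) k a] by blast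
  \<comment> \<open>Since \<open>a < p\<close>, not even the factorial of \<open>a\<close> is
    divisible by \<open>p\<close>, so the binomial coefficient can be divided out inside
    \<open>F\<close>.\<close>
  have "\<not> p dvd (a choose k)"
    using prime_dvd_fact_iff[OF prime_p, of a] binomial_fact_lemma[OF k(2)] a
    by (metis dvd_mult not_le)
  then have nz: "of_nat (a choose k) \<noteq> (0 :: 'b)" by (simp add: of_nat_eq_0_iff_char_dvd CHAR)
  have "of_nat r \<in> F" for r by (induction r) (auto simp: F_closed)
  then have "(\<lambda>x. inverse (of_nat (a choose k)) * h k x) \<in> A i"
    by (intro A_scale ij(1) hk) (auto simp: F_closed)
  then show ?thesis
    by (rule A_cong[OF ij(1)]) (use nz k in \<open>simp add: h_def\<close>)
qed

text \<open>The exponent \<open>arc i j\<close> is \<open>e i * e (i+1) * ... * e (j-1)\<close>, with indices read cyclically.\<close>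

definition arc_set :: "nat \<Rightarrow> nat \<Rightarrow> nat set" where
  "arc_set i j = {k. k < n \<and> (if i < j then i \<le> k \<and> k < j else i \<le> k \<or> k < j)}"

definition arc :: "nat \<Rightarrow> nat \<Rightarrow> nat" where
  "arc i j = (\<Prod>k\<in>arc_set i j. e k)"

lemma arc_mult:
  assumes "i < n" "j < n" "i \<noteq> j"
  shows "arc i j * arc j i = E"
proof -
  have "arc i j * arc j i = (\<Prod>k\<in>arc_set i j \<union> arc_set j i. e k)"
    unfolding arc_def by (rule prod.union_disjoint[symmetric]) (use assms in \<open>auto simp: arc_set_def split: if_splits\<close>)
  also have "arc_set i j \<union> arc_set j i = {..<n}"
    using assms by (auto simp: arc_set_def)
  finally show ?thesis by (simp add: E_prod)
qed

lemma arc_pos: "0 < arc i j"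
  unfolding arc_def by (rule prod_pos) (auto simp: arc_set_def e_pos)

lemma arc_less_p:
  assumes "i < n" "j < n" "i \<noteq> j"
  shows "arc i j < p"
proof -
  have "arc i j * 1 \<le> arc i j * arc j i" using arc_pos[of j i] by (intro mult_le_mono2) simp
  then show ?thesis using arc_mult[OF assms] E by simp
qed

lemma arc_Suc_self: "i < n \<Longrightarrow> arc i (Suc i mod n) = e i"
proof -
  assume i: "i < n"
  have "arc_set i (Suc i mod n) = {i}"
    using i n_ge_3 by (cases "Suc i = n") (auto simp: arc_set_def)
  then show ?thesis by (simp add: arc_def)
qed

lemma arc_Suc:
  assumes "i < n" "j < n" "i \<noteq> j" "Suc j mod n \<noteq> i"
  shows "arc i (Suc j mod n) = arc i j * e j"
proof -
  have "arc_set i (Suc j mod n) = insert j (arc_set i j)"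
    using assms by (cases "Suc j = n") (auto simp: arc_set_def split: if_splits)
  moreover have "j \<notin> arc_set i j" using assms by (auto simp: arc_set_def)
  moreover have "finite (arc_set i j)" by (simp add: arc_set_def)
  ultimately show ?thesis by (simp add: arc_def mult.commute)
qed

lemma power_fns: "j \<noteq> i \<Longrightarrow> (\<lambda>x. x j ^ a) \<in> fns i"
  by (simp add: fns_def K_closed Pt_K)

text \<open>One step along the cycle substitutes the next generator for all factors
  \<open>x j\<close> at once. The bound on \<open>t\<close> stops the walk before it returns to
  \<open>i\<close>.\<close>

lemma arc_mem_aux:
  assumes i: "i < n"
  shows "Suc t < n \<Longrightarrow> (\<lambda>x. x ((i + Suc t) mod n) ^ arc i ((i + Suc t) mod n)) \<in> A i"
proof (induction t)
  case 0
  then show ?case using gen[OF i] arc_Suc_self[OF i] by simp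
next
  case (Suc t)
  define j where "j = (i + Suc t) mod n"
  define l where "l = Suc j mod n"
  have n: "0 < n" using i by simp
  have neq: "(i + d) mod n \<noteq> i" if "0 < d" "d < n" for d
    using i that by (cases "i + d < n") (auto simp: mod_if[of "i + d"])
  have l_eq: "l = (i + Suc (Suc t)) mod n" by (simp add: l_def j_def mod_Suc_eq)
  have jl: "j < n" "l < n" "j \<noteq> i" "l \<noteq> i" using n neq[of "Suc t"] neq[of "Suc (Suc t)"] Suc.prems
    by (auto simp: j_def l_eq)
  have "l \<noteq> j" using jl n_ge_3 by (cases "Suc j = n") (auto simp: l_def)
  have IH: "(\<lambda>x. x j ^ arc i j) \<in> A i" using Suc by (simp add: j_def)
  have g: "(\<lambda>x. x l ^ e j) \<in> A j" unfolding l_def by (rule gen[OF jl(1)])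
  have "(\<lambda>x. x j ^ (arc i j - arc i j) * (x l ^ e j) ^ arc i j * 1) \<in> A i"
    using arc_less_p[OF i jl(1)] arc_pos[of i j] jl IH g
    by (intro A_subst[OF i jl(1)] power_fns) auto
  moreover have "arc i l = arc i j * e j" unfolding l_def using jl i by (intro arc_Suc) (auto simp: l_def)
  ultimately show ?case unfolding l_eq[symmetric] by (simp add: power_mult[symmetric] mult.commute)
qed

lemma arc_mem:
  assumes "i < n" "j < n" "i \<noteq> j"
  shows "(\<lambda>x. x j ^ arc i j) \<in> A i"
proof -
  define t where "t = (if i < j then j - i - 1 else n + j - i - 1)"
  have "Suc t < n" "(i + Suc t) mod n = j" using assms by (auto simp: t_def)
  then show ?thesis using arc_mem_aux[OF assms(1), of t] by simp
qed

text \<open>To raise the exponent by \<open>E - 1\<close>, replace one factor \<open>x\<^sub>j\<close> by \<open>x\<^sub>k ^ arc j k\<close> and then substitute monomials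
  in \<open>x\<^sub>j\<close> back for these \<open>arc j k\<close> factors: since \<open>arc j k * arc k j = E\<close>, the factor \<open>x\<^sub>j\<close> turns into \<open>x\<^sub>j ^ E\<close>.\<close>

lemma monomial_mem:
  assumes "i < n" "j < n" "i \<noteq> j"
  shows "(\<lambda>x. x j ^ (arc i j + (E - 1) * t)) \<in> A i"
  using assms
proof (induction t arbitrary: i j)
  case 0
  then show ?case using arc_mem by simp
next
  case (Suc t)
  note ij = Suc.prems
  obtain k where k: "k < n" "k \<noteq> i" "k \<noteq> j" using exists_third_index[OF n_ge_3] by metis
  \<comment> \<open>One of the \<open>b\<close> factors \<open>x k\<close> is replaced by
    \<open>x j ^ d\<close>, where \<open>d\<close> carries the excess already obtained for the pair
    \<open>k\<close>, \<open>j\<close>; the other \<open>b - 1\<close> are replaced by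
    \<open>x j ^ c\<close>.\<close>
  define a b c d where "a = arc i j" and "b = arc j k" and "c = arc k j" and "d = c + (E - 1) * t"
  have bc: "b * c = E" unfolding b_def c_def using arc_mult ij k by simp
  have pos: "1 \<le> a" "1 \<le> b" "1 \<le> c" using arc_pos unfolding a_def b_def c_def by (simp_all add: Suc_leI)
  have less: "a < p" "b < p" using arc_less_p ij k unfolding a_def b_def by auto
  have 1: "(\<lambda>x. x j ^ (a - 1) * (x k ^ b) ^ 1 * 1) \<in> A i"
    using arc_mem ij k pos less unfolding a_def b_def
    by (intro A_subst[OF ij(1,2,3)] power_fns) auto
  have "(\<lambda>x. x k ^ (b - 1) * (x j ^ d) ^ 1 * x j ^ (a - 1)) \<in> A i"
  proof (rule A_subst[where a = b])
    show "(\<lambda>x. x k ^ b * x j ^ (a - 1)) \<in> A i" using 1 by (simp add: mult.commute)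
    show "(\<lambda>x. x j ^ d) \<in> A k" unfolding d_def c_def using k ij by (intro Suc.IH) auto
  qed (use ij k pos less in \<open>auto intro: power_fns\<close>)
  then have 2: "(\<lambda>x. x k ^ (b - 1) * x j ^ (d + (a - 1))) \<in> A i"
    by (simp add: power_add mult.assoc)
  \<comment> \<open>For \<open>b = 1\<close> no factor \<open>x k\<close> is left, while
    \<open>A_subst\<close> has to replace at least one.\<close>
  have 3: "(\<lambda>x. x j ^ (c * (b - 1) + (d + (a - 1)))) \<in> A i"
  proof (cases "b = 1")
    case True
    then show ?thesis using 2 by simp
  next
    case False
    have "(\<lambda>x. x k ^ (b - 1 - (b - 1)) * (x j ^ c) ^ (b - 1) * x j ^ (d + (a - 1))) \<in> A i"
    proof (rule A_subst[where a = "b - 1"])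
      show "(\<lambda>x. x j ^ c) \<in> A k" unfolding c_def using k ij by (intro arc_mem) auto
    qed (use 2 ij k pos less False in \<open>auto intro: power_fns\<close>)
    then show ?thesis by (simp add: power_add power_mult)
  qed
  have "c * (b - 1) + c = E" using bc pos by (metis Suc_diff_1 add.commute less_eq_Suc_le mult.commute mult_Suc_right One_nat_def)
  then have "c * (b - 1) + (d + (a - 1)) = a + (E - 1) * Suc t"
    using pos E unfolding d_def by simp
  then show ?case using 3 by (simp add: a_def)
qed


section \<open>Interpolated bumps and the properties of \<Gamma>\<close>

abbreviation "w \<equiv> weight n e"
abbreviation "\<Gamma> \<equiv> twists w"

lemma root_of_unity_E: "l ^ (E - 1) = 1 \<Longrightarrow> l ^ E = (l :: 'b)"
  using E power_minus_mult[of E l] by simp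

text \<open>This says that \<open>x j ^ arc i j\<close> scales like \<open>x i\<close>. If the arc
  passes the end of the index range, the exponent is \<open>E * w i\<close> instead of
  \<open>w i\<close>, which is harmless because \<open>l^E = l\<close>.\<close>

lemma weight_arc:
  assumes ij: "i < n" "j < n" "i \<noteq> j" and l: "l ^ (E - 1) = (1 :: 'b)"
  shows "l ^ (w j * arc i j) = l ^ w i"
proof (cases "i < j")
  case True
  have "w i = (\<Prod>k\<in>arc_set i j \<union> {j..<n}. e k)"
    unfolding weight_def by (rule prod.cong) (use True ij in \<open>auto simp: arc_set_def\<close>)
  also have "\<dots> = arc i j * w j"
    unfolding arc_def weight_def by (rule prod.union_disjoint) (use True in \<open>auto simp: arc_set_def\<close>)
  finally show ?thesis by (simp add: mult.commute)
next
  case False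
  have "arc i j = (\<Prod>k\<in>{..<j} \<union> {i..<n}. e k)"
    unfolding arc_def by (rule prod.cong) (use False ij in \<open>auto simp: arc_set_def\<close>)
  also have "\<dots> = prod e {..<j} * w i"
    unfolding weight_def by (rule prod.union_disjoint) (use False in auto)
  finally have "w j * arc i j = (prod e {..<j} * w j) * w i" by (simp add: mult_ac)
  also have "prod e {..<j} * w j = (\<Prod>k\<in>{..<j} \<union> {j..<n}. e k)"
    unfolding weight_def by (rule prod.union_disjoint[symmetric]) auto
  also have "\<dots> = E" unfolding E_prod by (rule prod.cong) (use ij in auto)
  finally show ?thesis using root_of_unity_E[OF l] by (simp add: power_mult)
qed

text \<open>The exponent \<open>prod e {..<j}\<close> inverts \<open>w j\<close> on the roots of
  unity concerned, so every such root is a \<open>w j\<close>-th power of another and is determined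
  by its own \<open>w j\<close>-th power.\<close>

lemma weight_root:
  assumes "j < n" and l: "l ^ (E - 1) = (1 :: 'b)"
  shows "(l ^ prod e {..<j}) ^ w j = l"
proof -
  have "prod e {..<j} * w j = (\<Prod>k\<in>{..<j} \<union> {j..<n}. e k)"
    unfolding weight_def by (rule prod.union_disjoint[symmetric]) auto
  also have "\<dots> = E" unfolding E_prod by (rule prod.cong) (use assms in auto)
  finally show ?thesis using root_of_unity_E[OF l] by (simp flip: power_mult)
qed

lemma K_power_card: "x \<in> K \<Longrightarrow> x ^ (p ^ m - 1) = (if x = 0 then 0 else 1)"
proof -
  assume x: "x \<in> K"
  have point_map: "1 < p ^ m" using p_gt_1 prime_gt_0_nat[OF prime_m] by (rule one_less_power)
  then have "0 < p ^ m" by linarith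
  from power_minus_mult[OF this, of x] have "x ^ (p ^ m - 1) * x = x" using x by (simp only: K_iff)
  then show ?thesis using point_map by (cases "x = 0") (simp_all add: zero_power)
qed

text \<open>The interpolating function is \<open>z ^ arc i j\<close> times a polynomial over \<open>F\<close> in \<open>z ^ (E - 1)\<close>:
  Lagrange interpolation at the conjugates of \<open>b ^ (E - 1)\<close>, whose coefficients are traces.\<close>

lemma single_bump_mem:
  assumes ij: "i < n" "j < n" "i \<noteq> j" and b: "y j \<in> K - F" and c: "c \<in> K"
  shows "bump \<Gamma> i {j} y c \<in> A i"
proof -
  define a where "a = arc i j"
  define b where "b = y j"
  define y0 where "y0 = b ^ (E - 1)"
  \<comment> \<open>Division by \<open>b ^ a\<close> compensates the factor \<open>x j ^ a\<close>
    in the interpolating function.\<close>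
  define d where "d = c / b ^ a"
  define Q where "Q = p ^ m - 1"
  have bK: "b \<in> K" "b \<notin> F" and b0: "b \<noteq> 0" using b F_closed by (auto simp: b_def)
  have y0: "y0 \<in> K" "y0 \<notin> F" using bK root_in_F by (auto simp: y0_def K_closed)
  have d: "d \<in> K" using c bK by (simp add: d_def K_closed)
  \<comment> \<open>These are the coefficients of \<open>d * (1 - (T - y0)^Q)\<close>, which on
    \<open>K\<close> is \<open>d\<close> at \<open>T = y0\<close> and 0 elsewhere by
    \<open>K_power_card\<close>. Taking traces of coefficients sums the conjugates of this
    polynomial.\<close>
  define u where "u k = d * ((if k = 0 then 1 else 0) - of_nat (Q choose k) * (- y0) ^ (Q - k))" for k
  have of_nat_F: "of_nat r \<in> F" for r by (induction r) (auto simp: F_closed)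
  then have of_nat_K: "of_nat r \<in> K" for r using F_K by blast
  have u: "u k \<in> K" for k unfolding u_def
    by (auto intro!: K_closed(1-6) K_closed(9) d y0 of_nat_K simp: K_closed)
  define f where "f x = (\<Sum>k\<le>Q. tr (u k) * x j ^ (a + (E - 1) * k))" for x
  have f: "f \<in> A i" unfolding f_def[abs_def] a_def
    by (intro A_sum A_scale monomial_mem ij tr_F u)
  have f_eq: "f x = x j ^ a * (\<Sum>s<m. if x j ^ (E - 1) = y0 ^ (p ^ s) then d ^ (p ^ s) else 0)"
    if x: "x j \<in> K" for x
  proof -
    define T where "T = x j ^ (E - 1)"
    have T: "T \<in> K" using x by (simp add: T_def K_closed)
    have "f x = (\<Sum>k\<le>Q. \<Sum>s<m. x j ^ a * (u k ^ (p ^ s) * T ^ k))"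
      unfolding f_def tr_def power_add power_mult T_def[symmetric]
      by (simp add: sum_distrib_right sum_distrib_left mult_ac)
    also have "\<dots> = (\<Sum>s<m. \<Sum>k\<le>Q. x j ^ a * (u k ^ (p ^ s) * T ^ k))" by (rule sum.swap)
    also have "\<dots> = x j ^ a * (\<Sum>s<m. \<Sum>k\<le>Q. u k ^ (p ^ s) * T ^ k)"
      by (simp add: sum_distrib_left)
    also have "(\<Sum>s<m. \<Sum>k\<le>Q. u k ^ (p ^ s) * T ^ k) = (\<Sum>s<m. if T = y0 ^ (p ^ s) then d ^ (p ^ s) else 0)"
    proof (rule sum.cong)
      fix s
      define z where "z = y0 ^ (p ^ s)"
      have "(if k = 0 then 1 else 0 :: 'b) ^ (p ^ s) = (if k = 0 then 1 else 0)" for k :: nat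
        using p_gt_1 by (simp add: zero_power)
      moreover have "((- y0) ^ k) ^ (p ^ s) = (- z) ^ k" for k
        by (simp add: z_def fr_uminus[symmetric] mult.commute flip: power_mult)
      ultimately have "u k ^ (p ^ s) * T ^ k
          = d ^ (p ^ s) * ((if k = 0 then 1 else 0) - of_nat (Q choose k) * (- z) ^ (Q - k) * T ^ k)" for k
        unfolding u_def power_mult_distrib fr_diff F_fr[OF of_nat_F] by (simp add: algebra_simps)
      then have "(\<Sum>k\<le>Q. u k ^ (p ^ s) * T ^ k) = d ^ (p ^ s) *
          ((\<Sum>k\<le>Q. if k = 0 then 1 else 0) - (\<Sum>k\<le>Q. of_nat (Q choose k) * T ^ k * (- z) ^ (Q - k)))"
        by (simp add: sum_distrib_left[symmetric] sum_subtractf mult_ac)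
      also have "\<dots> = d ^ (p ^ s) * (1 - (T + - z) ^ Q)"
        using binomial_ring[of T "- z" Q] by simp
      also have "(T + - z) ^ Q = (if T + - z = 0 then 0 else 1)"
        unfolding Q_def by (rule K_power_card) (use T y0 in \<open>auto simp: z_def K_closed\<close>)
      finally show "(\<Sum>k\<le>Q. u k ^ (p ^ s) * T ^ k) = (if T = y0 ^ (p ^ s) then d ^ (p ^ s) else 0)"
        by (simp add: z_def)
    qed simp
    finally show ?thesis by (simp add: T_def)
  qed
  have at_orbit: "f x = \<gamma> i c" if \<gamma>: "\<gamma> \<in> \<Gamma>" "x j = \<gamma> j b" for x \<gamma>
  proof -
    obtain l s where l: "l \<in> K" "l ^ (E - 1) = 1" "s < m" "\<gamma> = twist w l s"
      using \<gamma>(1) by (auto simp: twists_def)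
    have xj: "x j = l ^ w j * b ^ (p ^ s)" using \<gamma>(2) l(4) bK by (simp add: twist_def)
    have "x j ^ (E - 1) = (l ^ (E - 1)) ^ w j * (b ^ (E - 1)) ^ (p ^ s)"
      by (simp add: xj power_mult_distrib mult.commute flip: power_mult)
    then have T: "x j ^ (E - 1) = y0 ^ (p ^ s)" unfolding l(2) y0_def by simp
    \<comment> \<open>\<open>y0\<close> is not in \<open>F\<close>, so its \<open>m\<close>
      conjugates are distinct and one summand survives.\<close>
    have "(\<Sum>t<m. if x j ^ (E - 1) = y0 ^ (p ^ t) then d ^ (p ^ t) else 0)
        = (\<Sum>t<m. if t = s then d ^ (p ^ s) else 0)"
      unfolding T using fr_distinct[of y0] y0 l(3) by (intro sum.cong) auto
    also have "\<dots> = d ^ (p ^ s)" using l(3) by simp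
    finally have "f x = x j ^ a * d ^ (p ^ s)"
      using f_eq[of x] xj l(1) bK by (simp add: K_closed)
    also have "\<dots> = l ^ (w j * a) * ((b ^ a) ^ (p ^ s) * d ^ (p ^ s))"
      by (simp add: xj power_mult_distrib mult.commute flip: power_mult)
    also have "(b ^ a) ^ (p ^ s) * d ^ (p ^ s) = c ^ (p ^ s)"
      unfolding power_mult_distrib[symmetric] using b0 by (simp add: d_def)
    also have "l ^ (w j * a) = l ^ w i" unfolding a_def by (rule weight_arc[OF ij l(2)])
    finally show ?thesis using c by (simp add: l(4) twist_def)
  qed
  have off_orbit: "f x = 0" if x: "x j \<in> K" and no: "\<not> (\<exists>\<gamma>\<in>\<Gamma>. x j = \<gamma> j b)" for x
  proof -
    have "x j ^ (E - 1) \<noteq> y0 ^ (p ^ s)" if s: "s < m" for s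
    proof
      assume eq: "x j ^ (E - 1) = y0 ^ (p ^ s)"
      \<comment> \<open>Equal powers with exponent \<open>E - 1\<close> make this quotient a root of
        unity; writing it as \<open>l ^ w j\<close> exhibits \<open>x j\<close> as the image of
        \<open>b\<close> under a twist.\<close>
      define v where "v = x j / b ^ (p ^ s)"
      have "y0 ^ (p ^ s) = (b ^ (p ^ s)) ^ (E - 1)" by (simp add: y0_def mult.commute flip: power_mult)
      then have v: "v ^ (E - 1) = 1" "v \<in> K"
        using eq b0 x bK by (auto simp: v_def power_divide K_closed)
      define l where "l = v ^ prod e {..<j}"
      have "l ^ w j = v" unfolding l_def by (rule weight_root[OF ij(2) v(1)])
      then have "x j = twist w l s j b" using b0 bK by (simp add: twist_def v_def)
      moreover have "l ^ (E - 1) = (v ^ (E - 1)) ^ prod e {..<j}"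
        by (simp add: l_def mult.commute flip: power_mult)
      then have "l ^ (E - 1) = 1" using v(1) by simp
      moreover have "l \<in> K" using v by (simp add: l_def K_closed)
      ultimately show False using no s by (auto simp: twists_def)
    qed
    then show ?thesis using f_eq[of x] x by simp
  qed
  have "bump \<Gamma> i {j} y c x = f x" if x: "x \<in> Pt" for x
  proof (cases "\<exists>\<gamma>\<in>\<Gamma>. x j = \<gamma> j b")
    case True
    then have "\<exists>\<gamma>. \<gamma> \<in> \<Gamma> \<and> x j = \<gamma> j b" by blast
    from someI_ex[OF this] show ?thesis
      using True at_orbit[of "SOME \<gamma>. \<gamma> \<in> \<Gamma> \<and> x j = \<gamma> j b" x] by (simp add: bump_def b_def)
  next
    case False
    then show ?thesis using off_orbit[of x] Pt_K[OF x] by (simp add: bump_def b_def)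
  qed
  then show ?thesis using A_cong[OF ij(1) f] by simp
qed

text \<open>Scalings therefore commute with Frobenius, which is what makes the twists
  compose.\<close>

lemma mu_F: "l \<in> K \<Longrightarrow> l ^ (E - 1) = 1 \<Longrightarrow> l \<in> F"
  using root_in_F[of l] F_closed(2) by simp

lemma twist_comp:
  assumes "l \<in> K" "l ^ (E - 1) = 1" "k \<in> K" "k ^ (E - 1) = 1"
  shows "(\<lambda>i x. twist w l s i (twist w k t i x)) = twist w (l * k) ((s + t) mod m)"
proof (intro ext)
  fix i x
  show "twist w l s i (twist w k t i x) = twist w (l * k) ((s + t) mod m) i x"
  proof (cases "x \<in> K")
    case True
    have "(k ^ w i) ^ (p ^ s) = k ^ w i"
      using F_fr[of "k ^ w i" s] mu_F[OF assms(3,4)] by (simp add: F_closed)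
    then show ?thesis
      using True assms fr_mod_m[OF True, of "s + t"]
      by (simp add: twist_def K_closed power_mult_distrib fr_fr add.commute)
  qed (simp add: twist_def)
qed

lemma twistI: "l \<in> K \<Longrightarrow> l ^ (E - 1) = 1 \<Longrightarrow> s < m \<Longrightarrow> twist w l s \<in> \<Gamma>"
  unfolding twists_def by blast

lemma twist_id: "twist w 1 0 = (\<lambda>i x. x)"
  by (auto simp: twist_def fun_eq_iff)

lemma finite_twists: "finite \<Gamma>" and card_twists_le: "card \<Gamma> \<le> m * E"
proof -
  define U where "U = {l \<in> K. l ^ (E - 1) = 1}"
  have U: "finite U" "card U \<le> E"
  proof -
    show "finite U" using finite_K by (simp add: U_def)
    have "card U \<le> card {z::'b. z ^ (E - 1) = 1}"
      using card_nth_roots_le[of "E - 1" "1 :: 'b"] E by (intro card_mono) (auto simp: U_def)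
    then show "card U \<le> E" using card_nth_roots_le[of "E - 1" "1 :: 'b"] E by auto
  qed
  have eq: "\<Gamma> = (\<lambda>(l, s). twist w l s) ` (U \<times> {..<m})"
    by (auto simp: twists_def U_def)
  show "finite \<Gamma>" unfolding eq using U by simp
  have "card \<Gamma> \<le> card (U \<times> {..<m})" unfolding eq by (rule card_image_le) (use U in simp)
  also have "\<dots> \<le> m * E" using U by (simp add: card_cartesian_product mult.commute)
  finally show "card \<Gamma> \<le> m * E" .
qed

text \<open>Raising to the power \<open>E - 1\<close> removes the scaling. As
  \<open>a ^ (E - 1)\<close> is still outside \<open>F\<close>, the Frobenius exponent must be 0,
  and then \<open>l ^ w i = 1\<close> gives \<open>l = 1\<close> by
  \<open>weight_root\<close>.\<close>

lemma twist_free: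
  assumes g: "\<gamma> \<in> \<Gamma>" and i: "i < n" and a: "a \<in> K - F" and fixed: "\<gamma> i a = a"
  shows "\<gamma> = (\<lambda>i x. x)"
proof -
  obtain l s where l: "l \<in> K" "l ^ (E - 1) = 1" "s < m" "\<gamma> = twist w l s"
    using g by (auto simp: twists_def)
  have eq: "l ^ w i * a ^ (p ^ s) = a" using fixed a l(4) by (simp add: twist_def)
  have "(l ^ w i * a ^ (p ^ s)) ^ (E - 1) = (l ^ (E - 1)) ^ w i * (a ^ (E - 1)) ^ (p ^ s)"
    by (simp add: power_mult_distrib mult.commute flip: power_mult)
  then have "(a ^ (E - 1)) ^ (p ^ s) = (a ^ (E - 1)) ^ (p ^ 0)" using l(2) by (simp add: eq)
  then have s: "s = 0"
    using fr_distinct[of "a ^ (E - 1)" s 0] root_in_F[of a] a l(3) by (auto simp: K_closed)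
  then have "l ^ w i = 1" using eq a F_closed(1) by auto
  moreover have "(l ^ w i) ^ prod e {..<i} = l"
    using weight_root[OF i l(2)] by (simp add: mult.commute flip: power_mult)
  ultimately have "l = 1" by simp
  then show ?thesis using s l(4) twist_id by simp
qed

sublocale free_system n K H F \<Gamma>
proof (unfold_locales)
  show "3 \<le> n" by (rule n_ge_3)
  show "finite K" by (rule finite_K)
  show "F \<subseteq> K" by (rule F_K)
  show "0 \<in> F" by (rule F_closed)
  show "finite \<Gamma>" by (rule finite_twists)
  have m: "0 < m" using prime_gt_0_nat[OF prime_m] .
  show "(\<lambda>i x. x) \<in> \<Gamma>"
    unfolding twist_id[symmetric] using m by (intro twistI) (simp_all add: K_closed)
  show "(\<lambda>i x. \<gamma> i (\<delta> i x)) \<in> \<Gamma>" if g: "\<gamma> \<in> \<Gamma>" and d: "\<delta> \<in> \<Gamma>" for \<gamma> \<delta>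
  proof -
    obtain l s where l: "l \<in> K" "l ^ (E - 1) = 1" "\<gamma> = twist w l s"
      using g by (auto simp: twists_def)
    obtain k t where k: "k \<in> K" "k ^ (E - 1) = 1" "\<delta> = twist w k t"
      using d by (auto simp: twists_def)
    show ?thesis unfolding l(3) k(3) twist_comp[OF l(1,2) k(1,2)]
      using l k m by (intro twistI) (auto simp: K_closed power_mult_distrib)
  qed
  show "\<exists>\<delta>\<in>\<Gamma>. \<forall>i x. \<delta> i (\<gamma> i x) = x \<and> \<gamma> i (\<delta> i x) = x" if g: "\<gamma> \<in> \<Gamma>" for \<gamma>
  proof -
    obtain l s where l: "l \<in> K" "l ^ (E - 1) = 1" "s < m" "\<gamma> = twist w l s"
      using g by (auto simp: twists_def)
    \<comment> \<open>The reduction modulo \<open>m\<close> matters for \<open>s = 0\<close>, where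
      \<open>m - s\<close> would be out of range.\<close>
    define \<delta> where "\<delta> = twist w (inverse l) ((m - s) mod m)"
    have inv: "inverse l \<in> K" "inverse l ^ (E - 1) = 1"
      using l by (auto simp: K_closed power_inverse)
    have l0: "l \<noteq> 0" using l(2) E by (auto simp: zero_power)
    have sm: "(s + (m - s) mod m) mod m = 0" "((m - s) mod m + s) mod m = 0"
      using l(3) by (simp_all add: mod_add_right_eq mod_add_left_eq)
    have "(\<lambda>i x. \<delta> i (\<gamma> i x)) = (\<lambda>i x. x)" "(\<lambda>i x. \<gamma> i (\<delta> i x)) = (\<lambda>i x. x)"
      unfolding \<delta>_def l(4) twist_comp[OF inv l(1,2)] twist_comp[OF l(1,2) inv] sm
      using l0 twist_id by simp_all
    then have "\<forall>i x. \<delta> i (\<gamma> i x) = x \<and> \<gamma> i (\<delta> i x) = x" by (metis (no_types))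
    moreover have "\<delta> \<in> \<Gamma>" unfolding \<delta>_def using inv m by (intro twistI) auto
    ultimately show ?thesis by blast
  qed
  show "\<gamma> i a \<in> K" if "\<gamma> \<in> \<Gamma>" "a \<in> K" for \<gamma> i a
    using that by (auto simp: twists_def twist_def K_closed)
  show "\<gamma> i (a + b) = \<gamma> i a + \<gamma> i b" if "\<gamma> \<in> \<Gamma>" "a \<in> K" "b \<in> K" for \<gamma> i a b
    using that by (auto simp: twists_def twist_def K_closed fr_add algebra_simps)
  show "\<gamma> = (\<lambda>i x. x)" if "\<gamma> \<in> \<Gamma>" "i < n" "a \<in> K - F" "\<gamma> i a = a" for \<gamma> i a
    by (rule twist_free[OF that])
  show "\<phi> (\<lambda>i. \<gamma> i (x i)) = (\<lambda>i. \<gamma> i (\<phi> x i))" if "\<phi> \<in> H" "\<gamma> \<in> \<Gamma>" "x \<in> Pt" for \<phi> \<gamma> x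
    by (rule H_equiv[OF that])
  show "\<phi> x i \<in> F" if "\<phi> \<in> H" "x \<in> Pt" "\<forall>i<n. x i \<in> F" "i < n" for \<phi> x i
    by (rule H_F[OF that])
  show "bump \<Gamma> i {j} y c \<in> A i" if "i < n" "j < n" "i \<noteq> j" "y j \<in> K - F" "c \<in> K" for i j y c
    using that by (intro single_bump_mem)
  have "3 * (card \<Gamma>)\<^sup>2 * card F \<le> 3 * (m * E)\<^sup>2 * p"
    using card_twists_le by (simp add: card_F power_mono)
  then show "3 * (card \<Gamma>)\<^sup>2 * card F < card K" using K_large by (simp add: card_K)
qed

lemma m_le_card_orbs: "m \<le> card orbs"
proof -
  obtain a where a: "a \<in> K - F" using generic_nonempty by blast
  have "inj_on (twist w 1) {..<m}"
  proof (rule inj_onI)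
    fix s t assume st: "s \<in> {..<m}" "t \<in> {..<m}" and eq: "twist w 1 s = twist w 1 t"
    from fun_cong[OF fun_cong[OF eq, of 0], of a] show "s = t"
      using a fr_distinct[of a s t] st by (simp add: twist_def)
  qed
  then have "m = card (twist w 1 ` {..<m})" by (simp add: card_image)
  also have "\<dots> \<le> card \<Gamma>"
    by (rule card_mono[OF finite_twists]) (auto intro!: twistI simp: K_closed)
  also have "\<dots> \<le> card orbs" by (rule card_orbs)
  finally show ?thesis .
qed

end

section \<open>Evaluation of polynomials\<close>

definition eval_monom :: "(nat \<Rightarrow> 'c::comm_semiring_1) \<Rightarrow> (nat \<Rightarrow>\<^sub>0 nat) \<Rightarrow> 'c" where
  "eval_monom v m = (\<Prod>k\<in>Poly_Mapping.keys m. v k ^ Poly_Mapping.lookup m k)"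

text \<open>With \<open>mp_const\<close> for \<open>h\<close> this is substitution, with
  \<open>to_ac\<close> it is evaluation at a point over the algebraic closure; both inherit the
  homomorphism laws from one locale.\<close>

definition eval_poly :: "('a::comm_semiring_1 \<Rightarrow> 'c::comm_semiring_1) \<Rightarrow> (nat \<Rightarrow> 'c) \<Rightarrow> 'a mpoly \<Rightarrow> 'c" where
  "eval_poly h v P = (\<Sum>m\<in>Poly_Mapping.keys P. h (Poly_Mapping.lookup P m) * eval_monom v m)"

lemma mp_subst_eq: "mp_subst = eval_poly mp_const"
  by (simp add: fun_eq_iff mp_subst_def eval_poly_def eval_monom_def)

lemma mpoly_induct [case_names zero single add]:
  fixes P :: "'a::comm_semiring_1 mpoly"
  assumes "Q 0" "\<And>m c. Q (Poly_Mapping.single m c)" "\<And>f g. Q f \<Longrightarrow> Q g \<Longrightarrow> Q (f + g)"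
  shows "Q P"
proof (induction P rule: update_induct)
  case (update f a b)
  have "Poly_Mapping.update a b f = f + Poly_Mapping.single a b"
    using update(1) by (intro poly_mapping_eqI) (auto simp: lookup_update lookup_add lookup_single in_keys_iff when_def)
  then show ?case using assms(2,3) update by simp
qed (rule assms(1))

lemma eval_monom_superset:
  assumes "finite B" "Poly_Mapping.keys m \<subseteq> B"
  shows "eval_monom v m = (\<Prod>k\<in>B. v k ^ Poly_Mapping.lookup m k)"
  unfolding eval_monom_def by (rule prod.mono_neutral_left) (use assms in \<open>auto simp: in_keys_iff\<close>)

lemma eval_monom_0: "eval_monom v 0 = 1"
  by (simp add: eval_monom_def)

lemma eval_monom_single: "eval_monom v (Poly_Mapping.single k a) = v k ^ a"
  by (subst eval_monom_superset[of "{k}"]) auto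

lemma eval_monom_add: "eval_monom v (m + m') = eval_monom v m * eval_monom v m'"
proof -
  let ?B = "Poly_Mapping.keys m \<union> Poly_Mapping.keys m'"
  have "Poly_Mapping.keys (m + m') \<subseteq> ?B" by (rule keys_add)
  then show ?thesis
    using eval_monom_superset[of ?B m v] eval_monom_superset[of ?B m' v] eval_monom_superset[of ?B "m + m'" v]
    by (simp add: lookup_add power_add prod.distrib)
qed

locale coeff_hom =
  fixes h :: "'a::comm_semiring_1 \<Rightarrow> 'c::comm_semiring_1"
  assumes h_0: "h 0 = 0" and h_1: "h 1 = 1" and h_add: "h (a + b) = h a + h b"
    and h_mult: "h (a * b) = h a * h b"
begin

lemma eval_add: "eval_poly h v (P + Q) = eval_poly h v P + eval_poly h v Q"
  unfolding eval_poly_def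
  by (rule setsum_keys_plus_distrib[of "\<lambda>m c. h c * eval_monom v m"])
    (simp_all add: h_0 h_add distrib_right)

lemma eval_0: "eval_poly h v 0 = 0"
  by (simp add: eval_poly_def)

lemma eval_single: "eval_poly h v (Poly_Mapping.single m c) = h c * eval_monom v m"
  by (cases "c = 0") (auto simp: eval_poly_def h_0)

lemma eval_mult: "eval_poly h v (P * Q) = eval_poly h v P * eval_poly h v Q"
proof (induction P rule: mpoly_induct)
  case (single m c)
  show ?case
    by (induction Q rule: mpoly_induct)
      (simp_all add: eval_0 eval_single mult_single h_mult eval_monom_add mult_ac eval_add distrib_left distrib_right)
qed (simp_all add: eval_0 eval_add distrib_right)

lemma eval_1: "eval_poly h v 1 = 1"
  using eval_single[of v 0 1] by (simp add: h_1 eval_monom_0)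

lemma eval_power: "eval_poly h v (P ^ k) = eval_poly h v P ^ k"
  by (induction k) (simp_all add: eval_1 eval_mult)

lemma eval_const: "eval_poly h v (mp_const c) = h c"
  by (simp add: mp_const_def eval_single eval_monom_0)

lemma eval_var: "eval_poly h v (mp_var k) = v k"
  by (simp add: mp_var_def eval_single eval_monom_single h_1)

lemma eval_sum: "eval_poly h v (\<Sum>a\<in>S. f a) = (\<Sum>a\<in>S. eval_poly h v (f a))"
  by (induction S rule: infinite_finite_induct) (simp_all add: eval_0 eval_add)

lemma eval_prod: "eval_poly h v (\<Prod>a\<in>S. f a) = (\<Prod>a\<in>S. eval_poly h v (f a))"
  by (induction S rule: infinite_finite_induct) (simp_all add: eval_1 eval_mult)

lemma eval_subst: "eval_poly h v (mp_subst \<sigma> P) = eval_poly h (\<lambda>k. eval_poly h v (\<sigma> k)) P"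
  unfolding mp_subst_def eval_poly_def[of h "\<lambda>k. eval_poly h v (\<sigma> k)"] eval_monom_def
  by (simp add: eval_sum eval_mult eval_const eval_prod eval_power)

end


interpretation const_hom: coeff_hom mp_const
proof
  fix a b :: 'a
  show "mp_const (a + b) = mp_const a + mp_const b" by (simp add: mp_const_def single_add)
  show "mp_const (a * b) = mp_const a * mp_const b" by (simp add: mp_const_def mult_single)
qed (simp_all add: mp_const_def)

interpretation ac_hom: coeff_hom to_ac
  by unfold_locales simp_all

lemma mp_subst_var: "mp_subst mp_var P = P"
proof (induction P rule: mpoly_induct)
  case (single m c)
  have "(\<Prod>k\<in>S. mp_var k ^ Poly_Mapping.lookup m k :: 'a mpoly) =
      Poly_Mapping.single (\<Sum>k\<in>S. Poly_Mapping.single k (Poly_Mapping.lookup m k)) 1" for S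
  proof (induction S rule: infinite_finite_induct)
    case (insert k S)
    have "(mp_var k :: 'a mpoly) ^ a = Poly_Mapping.single (Poly_Mapping.single k a) 1" for a
      by (induction a) (simp_all add: mp_var_def mult_single single_add[symmetric])
    then show ?case using insert by (simp add: mult_single)
  qed simp_all
  moreover have "(\<Sum>k\<in>Poly_Mapping.keys m. Poly_Mapping.single k (Poly_Mapping.lookup m k)) = m"
    by (intro poly_mapping_eqI) (simp add: lookup_sum lookup_single when_def in_keys_iff)
  ultimately have "eval_monom mp_var m = (Poly_Mapping.single m 1 :: 'a mpoly)"
    by (simp add: eval_monom_def)
  then show ?case
    unfolding mp_subst_eq const_hom.eval_single by (simp add: mp_const_def mult_single)
qed (simp_all add: mp_subst_eq const_hom.eval_0 const_hom.eval_add)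

lemma poly_ring_zero: "0 \<in> poly_ring n"
  by (simp add: poly_ring_def)

lemma poly_ring_add: "P \<in> poly_ring n \<Longrightarrow> Q \<in> poly_ring n \<Longrightarrow> P + Q \<in> poly_ring n"
  unfolding poly_ring_def using keys_add[of P Q] by blast

lemma poly_ring_mult:
  assumes "P \<in> poly_ring n" "Q \<in> poly_ring n"
  shows "P * Q \<in> poly_ring n"
  unfolding poly_ring_def
proof (intro CollectI ballI)
  fix m assume "m \<in> Poly_Mapping.keys (P * Q)"
  then obtain a b where "m = a + b" "a \<in> Poly_Mapping.keys P" "b \<in> Poly_Mapping.keys Q"
    using keys_mult[of P Q] by blast
  then show "Poly_Mapping.keys m \<subseteq> {..<n}"
    using assms keys_add[of a b] unfolding poly_ring_def by blast
qed

lemma poly_ring_const: "mp_const c \<in> poly_ring n"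
  by (simp add: poly_ring_def mp_const_def)

lemma poly_ring_one: "1 \<in> poly_ring n"
  by (simp add: poly_ring_def)

lemma poly_ring_var: "k < n \<Longrightarrow> mp_var k \<in> poly_ring n"
  by (simp add: poly_ring_def mp_var_def)

lemma poly_ring_power: "P \<in> poly_ring n \<Longrightarrow> P ^ k \<in> poly_ring n"
  by (induction k) (simp_all add: poly_ring_one poly_ring_mult)

lemma poly_ring_prod: "(\<And>s. s \<in> S \<Longrightarrow> f s \<in> poly_ring n) \<Longrightarrow> prod f S \<in> poly_ring n"
  by (induction S rule: infinite_finite_induct) (simp_all add: poly_ring_one poly_ring_mult)

lemma poly_ring_sum: "(\<And>s. s \<in> S \<Longrightarrow> f s \<in> poly_ring n) \<Longrightarrow> sum f S \<in> poly_ring n"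
  by (induction S rule: infinite_finite_induct) (simp_all add: poly_ring_zero poly_ring_add)

lemma poly_ring_subst:
  assumes "P \<in> poly_ring n" "\<And>k. k < n \<Longrightarrow> \<sigma> k \<in> poly_ring n"
  shows "mp_subst \<sigma> P \<in> poly_ring n"
  unfolding mp_subst_def
  by (intro poly_ring_sum poly_ring_mult poly_ring_const poly_ring_prod poly_ring_power assms(2))
    (use assms(1) in \<open>auto simp: poly_ring_def\<close>)

definition elem_sub :: "nat \<Rightarrow> nat \<Rightarrow> nat \<Rightarrow> 'a::comm_semiring_1 \<Rightarrow> nat \<Rightarrow> 'a mpoly" where
  "elem_sub i j e r k = (if k = i then mp_var i + mp_const r * mp_var j ^ e else mp_var k)"

lemma elem_aut_eq: "elem_aut n i j e r = restrict (mp_subst (elem_sub i j e r)) (poly_ring n)"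
  by (simp add: elem_aut_def elem_sub_def[abs_def])

lemma elem_aut_closed: "i < n \<Longrightarrow> j < n \<Longrightarrow> P \<in> poly_ring n \<Longrightarrow> elem_aut n i j e r P \<in> poly_ring n"
  unfolding elem_aut_eq elem_sub_def[abs_def]
  by (simp, rule poly_ring_subst)
    (simp_all add: poly_ring_add poly_ring_mult poly_ring_const poly_ring_power poly_ring_var)

lemma elem_aut_inverse:
  assumes "i < n" "j < n" "i \<noteq> j" "P \<in> poly_ring n"
  shows "elem_aut n i j e (- r) (elem_aut n i j e r P) = (P :: 'a::comm_ring_1 mpoly)"
proof -
  have "mp_subst (elem_sub i j e (- r)) (elem_sub i j e r k) = mp_var k" for k
  proof -
    have "mp_const (- r) + mp_const r = (0 :: 'a mpoly)"
      using const_hom.h_add[of "- r" r] by (simp add: mp_const_def)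
    then have "mp_const (- r) * mp_var j ^ e + mp_const r * mp_var j ^ e = (0 :: 'a mpoly)"
      by (simp flip: distrib_right)
    then show ?thesis
      using assms(3) by (simp add: elem_sub_def mp_subst_eq const_hom.eval_add const_hom.eval_mult
          const_hom.eval_var const_hom.eval_const const_hom.eval_power add.assoc)
  qed
  then have "mp_subst (elem_sub i j e (- r)) (mp_subst (elem_sub i j e r) P) = P"
    unfolding mp_subst_eq const_hom.eval_subst[unfolded mp_subst_eq] by (simp add: mp_subst_var[unfolded mp_subst_eq])
  then show ?thesis
    using assms(4) elem_aut_closed[OF assms(1,2,4), of e r] by (simp add: elem_aut_eq)
qed

lemma elem_aut_Bij:
  assumes "i < n" "j < n" "i \<noteq> j"
  shows "elem_aut n i j e (r :: 'a::comm_ring_1) \<in> Bij (poly_ring n)"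
proof -
  have "bij_betw (elem_aut n i j e r) (poly_ring n) (poly_ring n)"
    by (rule bij_betw_byWitness[where f' = "elem_aut n i j e (- r)"])
      (use elem_aut_closed assms elem_aut_inverse[OF assms, of _ e r] elem_aut_inverse[OF assms, of _ e "- r"] in auto)
  then show ?thesis by (simp add: Bij_def elem_aut_eq)
qed

lemma eval_elem_aut:
  assumes "P \<in> poly_ring n"
  shows "eval_poly to_ac x (elem_aut n i j e r P) = eval_poly to_ac (x(i := x i + to_ac r * x j ^ e)) P"
proof -
  have "(\<lambda>k. eval_poly to_ac x (elem_sub i j e r k)) = x(i := x i + to_ac r * x j ^ e)"
    by (auto simp: elem_sub_def ac_hom.eval_add ac_hom.eval_mult ac_hom.eval_var ac_hom.eval_const
        ac_hom.eval_power)
  then show ?thesis using assms by (simp add: elem_aut_eq ac_hom.eval_subst)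
qed

section \<open>The action on points\<close>

locale tame_group = cyclic_extension p m E K F
  for p m E :: nat and K F :: "'a::{field,finite} alg_closure set" +
  fixes n :: nat and e :: "nat \<Rightarrow> nat"
  assumes n_ge_3: "3 \<le> n"
    and e_pos: "i < n \<Longrightarrow> 0 < e i"
    and E_prod: "E = (\<Prod>i<n. e i)"
    and K_large: "3 * (m * E)\<^sup>2 * p < p ^ m"
begin

abbreviation R :: "'a mpoly set" where "R \<equiv> poly_ring n"
abbreviation G :: "('a mpoly \<Rightarrow> 'a mpoly) monoid" where "G \<equiv> G_group n e"
abbreviation "ev \<equiv> eval_poly (to_ac :: 'a \<Rightarrow> 'a alg_closure)"
abbreviation "wt \<equiv> weight n e"
abbreviation "gn i \<equiv> elem_aut n i (Suc i mod n) (e i) :: 'a \<Rightarrow> 'a mpoly \<Rightarrow> 'a mpoly"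

definition gens :: "('a mpoly \<Rightarrow> 'a mpoly) set" where "gens = {gn i 1 | i. i < n}"

definition pact :: "('a mpoly \<Rightarrow> 'a mpoly) \<Rightarrow> (nat \<Rightarrow> 'a alg_closure) \<Rightarrow> nat \<Rightarrow> 'a alg_closure" where
  "pact g x = (\<lambda>k. if k < n then ev x (g (mp_var k)) else 0)"

lemma Suc_mod: "i < n \<Longrightarrow> Suc i mod n < n" "i < n \<Longrightarrow> Suc i mod n \<noteq> i"
  using n_ge_3 by (cases "Suc i = n"; simp)+

lemma gn_Bij: "i < n \<Longrightarrow> gn i r \<in> Bij R"
  using Suc_mod[of i] by (intro elem_aut_Bij) auto

text \<open>Homogeneity of the generators under scaling. At the last index the next weight is
  \<open>wt 0 = E\<close>, which acts as exponent 1 because \<open>l ^ E = l\<close>.\<close>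

lemma weight_Suc:
  assumes i: "i < n" and l: "l ^ (E - 1) = (1 :: 'a alg_closure)"
  shows "(l ^ wt (Suc i mod n)) ^ e i = l ^ wt i"
proof (cases "Suc i = n")
  case True
  have "wt i = e i" using True by (auto simp: weight_def)
  moreover have "wt 0 = E" unfolding weight_def E_prod by (simp add: lessThan_atLeast0)
  moreover have "l ^ E = l" using E l power_minus_mult[of E l] by simp
  ultimately show ?thesis using True by simp
next
  case False
  then have "{i..<n} = insert i {Suc i..<n}" using i by auto
  then have "wt i = e i * wt (Suc i)" by (simp add: weight_def)
  then show ?thesis using False i by (simp add: mult.commute flip: power_mult)
qed

text \<open>Evaluation at a point turns an automorphism \<open>g\<close> into a map on points, contravariantly.\<close>

definition good :: "('a mpoly \<Rightarrow> 'a mpoly) \<Rightarrow> bool" where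
  "good g \<longleftrightarrow> g \<in> Bij R \<and> (\<forall>x\<in>points n K. \<forall>P\<in>R. ev x (g P) = ev (pact g x) P)
    \<and> (\<forall>x\<in>points n K. pact g x \<in> points n K \<and> ((\<forall>i<n. x i \<in> F) \<longrightarrow> (\<forall>i<n. pact g x i \<in> F))
      \<and> (\<forall>\<gamma>\<in>twists wt. pact g (\<lambda>i. \<gamma> i (x i)) = (\<lambda>i. \<gamma> i (pact g x i))))"

lemma pact_eqI:
  assumes "y \<in> points n K" "\<And>P. P \<in> R \<Longrightarrow> ev x (g P) = ev y P"
  shows "pact g x = y"
  using assms by (auto simp: pact_def points_def fun_eq_iff ac_hom.eval_var poly_ring_var not_less)

lemma twist_point: "\<gamma> \<in> twists wt \<Longrightarrow> x \<in> points n K \<Longrightarrow> (\<lambda>i. \<gamma> i (x i)) \<in> points n K"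
  using p_gt_1 by (auto simp: points_def twists_def twist_def K_closed)

lemma pact_gn:
  assumes i: "i < n" and r: "r = 1 \<or> r = - 1" and x: "x \<in> points n K"
  shows "pact (gn i r) x = x(i := x i + to_ac r * x (Suc i mod n) ^ e i)" (is "_ = ?y")
    and "x(i := x i + to_ac r * x (Suc i mod n) ^ e i) \<in> points n K"
proof -
  have "to_ac r \<in> K" using r by (auto simp: K_closed)
  moreover have "x i \<in> K" "x (Suc i mod n) \<in> K" using x i Suc_mod by (auto simp: points_def)
  ultimately show y: "?y \<in> points n K" using x i by (auto simp: points_def K_closed)
  show "pact (gn i r) x = ?y" by (rule pact_eqI[OF y]) (rule eval_elem_aut)
qed

lemma good_gn:
  assumes i: "i < n" and r: "r = 1 \<or> r = - 1"
  shows "good (gn i r)"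
  unfolding good_def
proof (intro conjI ballI impI)
  show "gn i r \<in> Bij R" by (rule gn_Bij[OF i])
  fix x assume x: "x \<in> points n K"
  let ?j = "Suc i mod n"
  note eq = pact_gn(1)[OF i r x]
  show "ev x (gn i r P) = ev (pact (gn i r) x) P" if "P \<in> R" for P
    unfolding eq using that by (rule eval_elem_aut)
  show "pact (gn i r) x \<in> points n K" unfolding eq by (rule pact_gn(2)[OF i r x])
  have rF: "to_ac r \<in> F" using r by (auto simp: F_closed)
  show "\<forall>i'<n. pact (gn i r) x i' \<in> F" if "\<forall>i<n. x i \<in> F"
    unfolding eq using that rF i Suc_mod by (auto simp: F_closed)
  show "pact (gn i r) (\<lambda>i. \<gamma> i (x i)) = (\<lambda>k. \<gamma> k (pact (gn i r) x k))" if g: "\<gamma> \<in> twists wt" for \<gamma>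
  proof -
    obtain l s where l: "l \<in> K" "l ^ (E - 1) = 1" "\<gamma> = twist wt l s"
      using g by (auto simp: twists_def)
    have K: "x i \<in> K" "x ?j \<in> K" using x i Suc_mod by (auto simp: points_def)
    have rK: "to_ac r \<in> K" using rF F_K by blast
    \<comment> \<open>Frobenius is additive and fixes the coefficient, which lies in
      \<open>F\<close>; the weights then make both summands scale alike.\<close>
    have "\<gamma> i (x i + to_ac r * x ?j ^ e i) = l ^ wt i * (x i ^ (p ^ s) + to_ac r * (x ?j ^ (p ^ s)) ^ e i)"
      using K rK F_fr[OF rF, of s]
      by (simp add: l(3) twist_def K_closed fr_add power_mult_distrib mult.commute flip: power_mult)
    also have "\<dots> = \<gamma> i (x i) + to_ac r * \<gamma> ?j (x ?j) ^ e i"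
      using K weight_Suc[OF i l(2)]
      by (simp add: l(3) twist_def power_mult_distrib algebra_simps)
    finally show ?thesis
      unfolding eq pact_gn(1)[OF i r twist_point[OF g x]] by (auto simp: fun_eq_iff)
  qed
qed

lemma Bij_R: "g \<in> Bij R \<Longrightarrow> P \<in> R \<Longrightarrow> g P \<in> R"
  using Bij_imp_funcset by blast

lemma mult_BijGroup: "g \<in> Bij S \<Longrightarrow> h \<in> Bij S \<Longrightarrow> g \<otimes>\<^bsub>BijGroup S\<^esub> h = compose S g h"
  by (simp add: BijGroup_def)

lemma pact_compose:
  assumes g: "good g" and h: "good h" and x: "x \<in> points n K"
  shows "pact (compose R g h) x = pact h (pact g x)"
    "\<And>P. P \<in> R \<Longrightarrow> ev x (compose R g h P) = ev (pact h (pact g x)) P"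
proof -
  have y: "pact g x \<in> points n K" "pact h (pact g x) \<in> points n K"
    using g h x by (auto simp: good_def)
  show *: "ev x (compose R g h P) = ev (pact h (pact g x)) P" if "P \<in> R" for P
    using g h x that y Bij_R[of h P] by (simp add: good_def compose_def)
  show "pact (compose R g h) x = pact h (pact g x)" by (rule pact_eqI[OF y(2) *])
qed

lemma good_compose:
  assumes g: "good g" and h: "good h"
  shows "good (compose R g h)"
  unfolding good_def
proof (intro conjI ballI impI)
  show "compose R g h \<in> Bij R" using g h compose_Bij by (auto simp: good_def)
  fix x assume x: "x \<in> points n K"
  have y: "pact g x \<in> points n K" using g x by (auto simp: good_def)
  note eq = pact_compose(1)[OF g h x]
  show "ev x (compose R g h P) = ev (pact (compose R g h) x) P" if "P \<in> R" for P
    using pact_compose(2)[OF g h x that] eq by simp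
  show "pact (compose R g h) x \<in> points n K" using eq y h by (auto simp: good_def)
  show "\<forall>i<n. pact (compose R g h) x i \<in> F" if "\<forall>i<n. x i \<in> F"
    unfolding eq using g h x y that unfolding good_def by blast
  show "pact (compose R g h) (\<lambda>i. \<gamma> i (x i)) = (\<lambda>i. \<gamma> i (pact (compose R g h) x i))"
    if gm: "\<gamma> \<in> twists wt" for \<gamma>
  proof -
    have "pact g (\<lambda>i. \<gamma> i (x i)) = (\<lambda>i. \<gamma> i (pact g x i))" using g x gm by (auto simp: good_def)
    moreover have "pact h (\<lambda>i. \<gamma> i (pact g x i)) = (\<lambda>i. \<gamma> i (pact h (pact g x) i))"
      using h y gm by (auto simp: good_def)
    ultimately show ?thesis using eq pact_compose(1)[OF g h twist_point[OF gm x]] by simp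
  qed
qed

lemma pact_id: "x \<in> points n K \<Longrightarrow> pact (\<lambda>P\<in>R. P) x = x"
  by (rule pact_eqI) auto

lemma good_id: "good (\<lambda>P\<in>R. P)"
  unfolding good_def using pact_id id_Bij twist_point by (auto simp del: restrict_apply) auto

lemma inv_gn:
  assumes i: "i < n"
  shows "inv\<^bsub>BijGroup R\<^esub> (gn i 1) = gn i (- 1)"
proof -
  interpret B: group "BijGroup R" by (rule group_BijGroup)
  have "compose R (gn i (- 1)) (gn i 1) = (\<lambda>P\<in>R. P)"
    using elem_aut_inverse[OF i Suc_mod(1)[OF i] Suc_mod(2)[OF i, symmetric], of _ "e i" 1]
    by (auto simp: compose_def fun_eq_iff)
  then have "gn i (- 1) \<otimes>\<^bsub>BijGroup R\<^esub> gn i 1 = \<one>\<^bsub>BijGroup R\<^esub>"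
    using mult_BijGroup[OF gn_Bij[OF i] gn_Bij[OF i]] by (simp add: BijGroup_def)
  then show ?thesis
    using gn_Bij[OF i] by (intro B.inv_equality) (auto simp: BijGroup_def)
qed

lemma good_Bij: "good g \<Longrightarrow> g \<in> Bij R"
  by (simp add: good_def)

lemma G_carrier: "carrier G = generate (BijGroup R) gens"
  by (simp add: G_group_def gens_def)

text \<open>Goodness is carried through the induction because composing maps on points requires it
  of both factors. The inverse of a generator is again elementary, with coefficient -1.\<close>

lemma G_induct [consumes 1, case_names one incl inv mult]:
  assumes "g \<in> carrier G" "Q (\<lambda>P\<in>R. P)" "\<And>i. i < n \<Longrightarrow> Q (gn i 1)" "\<And>i. i < n \<Longrightarrow> Q (gn i (- 1))"
    "\<And>g h. g \<in> carrier G \<Longrightarrow> h \<in> carrier G \<Longrightarrow> good g \<Longrightarrow> good h \<Longrightarrow> Q g \<Longrightarrow> Q h \<Longrightarrow> Q (compose R g h)"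
  shows "Q g"
proof -
  have "good g \<and> Q g" using assms(1) unfolding G_carrier
  proof (induction rule: generate.induct)
    case one
    have "\<one>\<^bsub>BijGroup R\<^esub> = (\<lambda>P\<in>R. P)" by (simp add: BijGroup_def)
    then show ?case using good_id assms(2) by metis
  next
    case (incl g)
    then show ?case using good_gn assms(3) by (auto simp: gens_def)
  next
    case (inv g)
    then show ?case using good_gn assms(4) inv_gn by (auto simp: gens_def)
  next
    case (eng g h)
    then have "g \<otimes>\<^bsub>BijGroup R\<^esub> h = compose R g h"
      by (intro mult_BijGroup good_Bij) auto
    then show ?case using good_compose[of g h] assms(5)[unfolded G_carrier, of g h] eng by metis
  qed
  then show ?thesis by blast
qed

lemma G_good: "g \<in> carrier G \<Longrightarrow> good g"
proof (induction rule: G_induct)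
  case one
  show ?case by (rule good_id)
qed (auto intro: good_gn good_compose)

lemma gens_Bij: "gens \<subseteq> carrier (BijGroup R)"
  using gn_Bij by (auto simp: gens_def BijGroup_def)

lemma G_subgroup: "subgroup (carrier G) (BijGroup R)"
  unfolding G_carrier using group.generate_is_subgroup[OF group_BijGroup gens_Bij] .

lemma G_is_group: "group G"
  using group.subgroup_imp_group[OF group_BijGroup G_subgroup]
  by (simp add: G_group_def)

lemma G_mult:
  assumes "g \<in> carrier G" "h \<in> carrier G"
  shows "g \<otimes>\<^bsub>G\<^esub> h = compose R g h"
proof -
  have "g \<otimes>\<^bsub>G\<^esub> h = g \<otimes>\<^bsub>BijGroup R\<^esub> h" by (simp add: G_group_def)
  then show ?thesis using mult_BijGroup good_Bij G_good assms by metis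
qed

lemma G_one: "\<one>\<^bsub>G\<^esub> = (\<lambda>P\<in>R. P)"
  by (simp add: G_group_def BijGroup_def)

definition point_map :: "('a mpoly \<Rightarrow> 'a mpoly) \<Rightarrow> (nat \<Rightarrow> 'a alg_closure) \<Rightarrow> nat \<Rightarrow> 'a alg_closure" where
  "point_map g x = (if x \<in> points n K then pact g x else x)"

lemma point_map_comp:
  assumes "g \<in> carrier G" "h \<in> carrier G"
  shows "point_map (g \<otimes>\<^bsub>G\<^esub> h) = point_map h \<circ> point_map g"
proof
  fix x show "point_map (g \<otimes>\<^bsub>G\<^esub> h) x = (point_map h \<circ> point_map g) x"
    using G_good assms pact_compose(1) by (simp add: point_map_def G_mult good_def)
qed

lemma point_map_one: "point_map \<one>\<^bsub>G\<^esub> = id"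
  by (auto simp: point_map_def G_one pact_id fun_eq_iff)

lemma point_map_inv:
  assumes "g \<in> carrier G"
  shows "point_map (inv\<^bsub>G\<^esub> g) \<circ> point_map g = id" "point_map g \<circ> point_map (inv\<^bsub>G\<^esub> g) = id"
proof -
  interpret G: group G by (rule G_is_group)
  show "point_map (inv\<^bsub>G\<^esub> g) \<circ> point_map g = id" "point_map g \<circ> point_map (inv\<^bsub>G\<^esub> g) = id"
    using point_map_comp[of g "inv\<^bsub>G\<^esub> g"] point_map_comp[of "inv\<^bsub>G\<^esub> g" g] assms point_map_one by simp_all
qed

definition H :: "((nat \<Rightarrow> 'a alg_closure) \<Rightarrow> nat \<Rightarrow> 'a alg_closure) set" where
  "H = point_map ` carrier G"

lemma H_perm_group: "perm_group (points n K) H"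
proof
  interpret G: group G by (rule G_is_group)
  show "id \<in> H" unfolding H_def using point_map_one G.one_closed by (metis imageI)
  fix f assume "f \<in> H"
  then obtain g where g: "g \<in> carrier G" "f = point_map g" by (auto simp: H_def)
  have inv: "inv' f = point_map (inv\<^bsub>G\<^esub> g)" unfolding g(2) by (rule inv_unique_comp) (rule point_map_inv[OF g(1)])+
  show "inv' f \<in> H" unfolding inv H_def using g by simp
  have cl: "point_map g x \<in> points n K" if "g \<in> carrier G" "x \<in> points n K" for g x
    using G_good that by (simp add: point_map_def good_def)
  have "point_map (inv\<^bsub>G\<^esub> g) (point_map g x) = x" "point_map g (point_map (inv\<^bsub>G\<^esub> g) x) = x" for x
    using point_map_inv[OF g(1)] by (metis comp_apply id_apply)+
  then have "bij_betw f (points n K) (points n K)"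
    unfolding g(2) using cl g(1) by (intro bij_betw_byWitness[where f' = "point_map (inv\<^bsub>G\<^esub> g)"]) auto
  then show "f permutes points n K" by (rule bij_imp_permutes) (simp add: g(2) point_map_def)
  fix f' assume "f' \<in> H"
  then obtain g' where "g' \<in> carrier G" "f' = point_map g'" by (auto simp: H_def)
  then show "f \<circ> f' \<in> H" using point_map_comp[of g' g] g by (auto simp: H_def intro!: image_eqI[of _ _ "g' \<otimes>\<^bsub>G\<^esub> g"])
qed

sublocale point_system n K H
  by (intro point_system.intro K_closed H_perm_group)

lemma point_map_gn: "i < n \<Longrightarrow> point_map (gn i 1) = shear i (\<lambda>x. x (Suc i mod n) ^ e i)"
  by (auto simp: point_map_def shear_def pact_gn(1) fun_eq_iff)

lemma gn_G: "i < n \<Longrightarrow> gn i 1 \<in> carrier G"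
  unfolding G_carrier by (rule generate.incl) (auto simp: gens_def)

sublocale tame_action p m E n K F H e
proof unfold_locales
  show "(\<lambda>x. x (Suc i mod n) ^ e i) \<in> A i" if "i < n" for i
  proof -
    have "shear i (\<lambda>x. x (Suc i mod n) ^ e i) \<in> H"
      using imageI[OF gn_G[OF that], of point_map] point_map_gn[OF that] by (simp add: H_def)
    then show ?thesis
      using Suc_mod(2)[OF that] by (simp add: A_def fns_def K_closed Pt_K)
  qed
  show "\<phi> (\<lambda>i. \<gamma> i (x i)) = (\<lambda>i. \<gamma> i (\<phi> x i))"
    if "\<phi> \<in> H" "\<gamma> \<in> twists (weight n e)" "x \<in> points n K" for \<phi> \<gamma> x
    using that G_good twist_point by (auto simp: H_def point_map_def good_def)
  show "\<phi> x i \<in> F" if "\<phi> \<in> H" "x \<in> points n K" "\<forall>i<n. x i \<in> F" "i < n" for \<phi> x i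
    using that G_good by (auto simp: H_def point_map_def good_def)
qed (use n_ge_3 e_pos E_prod K_large in auto)


section \<open>Numbering the orbits and the homomorphism to the alternating group\<close>

abbreviation "d \<equiv> card orbs"

definition enum :: "(nat \<Rightarrow> 'a alg_closure) set \<Rightarrow> nat" where
  "enum = (SOME f. bij_betw f orbs {1..d})"

definition unenum :: "nat \<Rightarrow> (nat \<Rightarrow> 'a alg_closure) set" where
  "unenum = inv_into orbs enum"

lemma bij_enum: "bij_betw enum orbs {1..d}"
proof -
  have "\<exists>f. bij_betw f orbs {1..d}"
    by (rule finite_same_card_bij) (simp_all add: finite_orbits)
  then show ?thesis unfolding enum_def by (rule someI_ex)
qed

lemma unenum: "k \<in> {1..d} \<Longrightarrow> unenum k \<in> orbs" "k \<in> {1..d} \<Longrightarrow> enum (unenum k) = k"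
  "W \<in> orbs \<Longrightarrow> unenum (enum W) = W" "W \<in> orbs \<Longrightarrow> enum W \<in> {1..d}"
  using bij_betw_inv_into[OF bij_enum] bij_enum unfolding unenum_def
  by (auto simp: bij_betw_def inv_into_f_f f_inv_into_f) 

definition transport :: "((nat \<Rightarrow> 'a alg_closure) set \<Rightarrow> (nat \<Rightarrow> 'a alg_closure) set) \<Rightarrow> nat \<Rightarrow> nat" where
  "transport s k = (if k \<in> {1..d} then enum (s (unenum k)) else k)"

lemma transport_comp:
  assumes "t permutes orbs"
  shows "transport (s \<circ> t) = transport s \<circ> transport t"
  using assms unenum permutes_in_image[OF assms] by (auto simp: transport_def fun_eq_iff)

lemma transport_permutes:
  assumes "s permutes orbs"
  shows "transport s permutes {1..d}"
proof (rule bij_imp_permutes)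
  show "bij_betw (transport s) {1..d} {1..d}"
  proof (rule bij_betw_byWitness[where f' = "transport (inv' s)"])
    have s': "inv' s permutes orbs" using assms by (rule permutes_inv)
    show "\<forall>k\<in>{1..d}. transport (inv' s) (transport s k) = k" "\<forall>k\<in>{1..d}. transport s (transport (inv' s) k) = k"
      using unenum permutes_in_image[OF assms] permutes_in_image[OF s'] permutes_inverses[OF assms]
      by (auto simp: transport_def)
    show "transport s ` {1..d} \<subseteq> {1..d}" "transport (inv' s) ` {1..d} \<subseteq> {1..d}"
      using unenum permutes_in_image[OF assms] permutes_in_image[OF s'] by (auto simp: transport_def)
  qed
qed (auto simp: transport_def)

lemma transport_cyc3:
  assumes "distinct [a, b, c]" "a \<in> {1..d}" "b \<in> {1..d}" "c \<in> {1..d}"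
  shows "transport (cyc3 (unenum a) (unenum b) (unenum c)) = cyc3 a b c"
proof
  fix k
  have inj: "unenum x = unenum y \<longleftrightarrow> x = y" if "x \<in> {1..d}" "y \<in> {1..d}" for x y
    using unenum(2) that by metis
  then have "distinct [unenum a, unenum b, unenum c]" using assms by auto
  then show "transport (cyc3 (unenum a) (unenum b) (unenum c)) k = cyc3 a b c k"
    using assms inj unenum(2) by (auto simp: transport_def cyc3_apply simp del: atLeastAtMost_iff)
qed

text \<open>Passing from automorphisms to maps on points reverses composition; the inverse restores
  the order.\<close>

definition rep :: "('a mpoly \<Rightarrow> 'a mpoly) \<Rightarrow> nat \<Rightarrow> nat" where
  "rep g = transport (ind (point_map (inv\<^bsub>G\<^esub> g)))"

lemma point_map_H: "g \<in> carrier G \<Longrightarrow> point_map g \<in> H"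
  by (simp add: H_def)

lemma rep_permutes:
  assumes "g \<in> carrier G"
  shows "rep g permutes {1..d}"
proof -
  interpret G: group G by (rule G_is_group)
  show ?thesis unfolding rep_def using assms by (intro transport_permutes ind_permutes point_map_H) simp
qed

lemma transport_ind_comp:
  "f \<in> H \<Longrightarrow> f' \<in> H \<Longrightarrow> transport (ind (f \<circ> f')) = transport (ind f) \<circ> transport (ind f')"
  using ind_comp transport_comp ind_permutes by simp

lemma rep_mult:
  assumes "g \<in> carrier G" "h \<in> carrier G"
  shows "rep (g \<otimes>\<^bsub>G\<^esub> h) = rep g \<circ> rep h"
proof -
  interpret G: group G by (rule G_is_group)
  have "point_map (inv\<^bsub>G\<^esub> (g \<otimes>\<^bsub>G\<^esub> h)) = point_map (inv\<^bsub>G\<^esub> g) \<circ> point_map (inv\<^bsub>G\<^esub> h)"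
    using assms by (simp add: G.inv_mult_group point_map_comp)
  then show ?thesis unfolding rep_def using assms by (simp add: transport_ind_comp point_map_H)
qed

text \<open>A shear by \<open>f\<close> is the square of the shear by \<open>f / 2\<close>, hence an even permutation.\<close>

lemma even_shear:
  assumes "odd p" and i: "i < n" and f: "f \<in> A i"
  shows "evenperm (transport (ind (shear i f)))"
proof -
  \<comment> \<open>For odd \<open>p\<close> this is the element 1/2 of \<open>F\<close>.\<close>
  define r where "r = (of_nat ((p + 1) div 2) :: 'a alg_closure)"
  have "of_nat k \<in> F" for k by (induction k) (auto simp: F_closed)
  then have "r \<in> F" by (simp add: r_def)
  then have rf: "(\<lambda>x. r * f x) \<in> A i" by (intro A_scale i f)
  have "(p + 1) div 2 + (p + 1) div 2 = p + 1" using assms(1) by presburger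
  then have "r + r = of_nat (p + 1)" unfolding r_def of_nat_add[symmetric] by (rule arg_cong)
  also have "\<dots> = 1" using CHAR of_nat_eq_0_iff_char_dvd[of p, where ?'a = "'a alg_closure"] by simp
  finally have "r + r = 1" .
  then have fr: "(\<lambda>x. r * f x + r * f x) = f"
    by (intro ext) (simp only: distrib_right[symmetric] mult_1)
  have "shear i f = shear i (\<lambda>x. r * f x) \<circ> shear i (\<lambda>x. r * f x)"
    unfolding shear_comp[OF i A_fns[OF rf] A_fns[OF rf]] fr ..
  moreover have H: "shear i (\<lambda>x. r * f x) \<in> H" using rf by (simp add: A_def)
  ultimately have eq: "transport (ind (shear i f)) =
      transport (ind (shear i (\<lambda>x. r * f x))) \<circ> transport (ind (shear i (\<lambda>x. r * f x)))" (is "_ = ?t \<circ> ?t")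
    by (simp add: transport_ind_comp)
  have "permutation ?t"
    using transport_permutes[OF ind_permutes[OF H]] permutation_permutes by blast
  then show ?thesis unfolding eq by (simp add: evenperm_comp)
qed

lemma even_transport:
  assumes "odd p" "g \<in> carrier G"
  shows "evenperm (transport (ind (point_map g)))"
  using assms(2)
proof (induction rule: G_induct)
  case one
  have "transport id = id" using unenum by (auto simp: transport_def fun_eq_iff)
  then show ?case using point_map_one ind_id unfolding G_one by (metis evenperm_id)
next
  case (incl i)
  then show ?case using even_shear[OF assms(1) incl gen[OF incl]] point_map_gn by simp
next
  case (inv i)
  then have "point_map (gn i (- 1)) = shear i (\<lambda>x. - (x (Suc i mod n) ^ e i))"
    by (auto simp: point_map_def shear_def pact_gn(1) fun_eq_iff)
  then show ?case using even_shear[OF assms(1) inv A_minus[OF inv gen[OF inv]]] by simp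
next
  case (mult g h)
  have perm: "permutation (transport (ind (point_map g)))" if "g \<in> carrier G" for g
    using transport_permutes[OF ind_permutes[OF point_map_H[OF that]]] permutation_permutes by blast
  have "point_map (compose R g h) = point_map h \<circ> point_map g" using point_map_comp G_mult mult by metis
  then have "transport (ind (point_map (compose R g h))) = transport (ind (point_map h)) \<circ> transport (ind (point_map g))"
    using mult by (simp only: transport_ind_comp point_map_H)
  then show ?case using mult perm by (simp only: evenperm_comp)
qed

lemma rep_hom:
  assumes "odd p"
  shows "group_hom G (alt_group d) rep"
proof -
  interpret G: group G by (rule G_is_group)
  have "rep \<in> hom G (alt_group d)"
    using even_transport[OF assms] rep_permutes rep_mult
    by (auto simp: hom_def alt_group_carrier alt_group_mult rep_def)
  then show ?thesis
    by (intro group_hom.intro G_is_group alt_group_is_group group_hom_axioms.intro)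
qed

lemma rep_surj:
  assumes "odd p"
  shows "rep ` carrier G = carrier (alt_group d)"
proof
  interpret G: group G by (rule G_is_group)
  interpret group_hom G "alt_group d" rep by (rule rep_hom[OF assms])
  show "rep ` carrier G \<subseteq> carrier (alt_group d)" using hom_closed by auto
  have "three_cycles d \<subseteq> rep ` carrier G"
  proof
    fix s assume "s \<in> three_cycles d"
    then obtain cs where cs: "s = cycle_of_list cs" "cycle cs" "length cs = 3" "set cs \<subseteq> {1..d}" by blast
    obtain a b c where abc: "cs = [a, b, c]" using stupid_lemma[OF cs(3)] by blast
    \<comment> \<open>\<open>cycle_of_list\<close> unfolds to the same product of transpositions by
      which \<open>cyc3\<close> is defined.\<close>
    have s: "s = cyc3 a b c" by (simp add: cs(1) abc cyc3_def)
    have mem: "a \<in> {1..d}" "b \<in> {1..d}" "c \<in> {1..d}" and dist: "distinct [a, b, c]"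
      using cs abc by auto
    have "distinct [unenum a, unenum b, unenum c]"
      using dist unenum(2)[OF mem(1)] unenum(2)[OF mem(2)] unenum(2)[OF mem(3)]
      by (metis distinct_length_2_or_more distinct_singleton)
    then have "cyc3 (unenum a) (unenum b) (unenum c) \<in> ind ` H"
      using unenum(1) mem by (intro cyc3_mem_ind) auto
    then obtain g where g: "g \<in> carrier G" "cyc3 (unenum a) (unenum b) (unenum c) = ind (point_map g)"
      by (auto simp: H_def)
    then have "rep (inv\<^bsub>G\<^esub> g) = s" using transport_cyc3[OF dist mem] by (simp add: rep_def s)
    then show "s \<in> rep ` carrier G" using g(1) by (metis G.inv_closed imageI)
  qed
  then show "carrier (alt_group d) \<subseteq> rep ` carrier G"
    unfolding alt_group_carrier_as_three_cycles
    by (intro group.generate_subgroup_incl[OF alt_group_is_group] img_is_subgroup)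
qed

lemma alt_quotient:
  assumes "odd p"
  shows "\<exists>N. N \<lhd> G \<and> (G Mod N) \<cong> alt_group d"
proof -
  interpret group_hom G "alt_group d" rep by (rule rep_hom[OF assms])
  show ?thesis using normal_kernel FactGroup_iso[OF rep_surj[OF assms]] by blast
qed

end

section \<open>Size estimates and the choice of m\<close>

lemma exp5_bound: "3 * (k + 6)\<^sup>2 < (5::nat) ^ (k + 3)"
proof (induction k)
  case (Suc k)
  have "(Suc k + 6)\<^sup>2 \<le> 5 * (k + 6)\<^sup>2"
    by (simp add: power2_eq_square algebra_simps)
  then have "3 * (Suc k + 6)\<^sup>2 < 5 * 5 ^ (k + 3)" using Suc by linarith
  also have "5 * 5 ^ (k + 3) = (5::nat) ^ (Suc k + 3)" by (simp only: add_Suc power_Suc)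
  finally show ?case .
qed simp

text \<open>Since \<open>E^2 * p \<le> p^3\<close>, it is enough that
  \<open>3 * m^2 < p^(m - 3)\<close>. With base 5 this holds from \<open>m = 6\<close> on, where it
  reads \<open>108 < 125\<close>.\<close>

lemma size_bound_prime:
  fixes p m E :: nat
  assumes p: "5 \<le> p" and E: "E < p" and m: "6 \<le> m"
  shows "3 * (m * E)\<^sup>2 * p < p ^ m"
proof -
  have "3 * m\<^sup>2 < 5 ^ (m - 3)" using exp5_bound[of "m - 6"] m by simp
  also have "\<dots> \<le> p ^ (m - 3)" using p by (rule power_mono) simp
  finally have "(3 * m\<^sup>2) * p ^ 3 < p ^ (m - 3) * p ^ 3" using p by (intro mult_strict_right_mono) auto
  also have "\<dots> = p ^ m" using m by (simp flip: power_add)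
  finally have 1: "(3 * m\<^sup>2) * p ^ 3 < p ^ m" .
  have "E\<^sup>2 * p \<le> p\<^sup>2 * p" using E by (intro mult_right_mono power_mono) auto
  then have "(3 * m\<^sup>2) * (E\<^sup>2 * p) \<le> (3 * m\<^sup>2) * p ^ 3"
    by (intro mult_left_mono) (simp_all add: power2_eq_square power3_eq_cube)
  then have "(3 * m\<^sup>2) * (E\<^sup>2 * p) < p ^ m" using 1 by linarith
  then show ?thesis by (simp add: power_mult_distrib mult.assoc)
qed

text \<open>Translation by 1 permutes the field, so comparing the sums of all elements before and
  after it gives \<open>p = 0\<close> in the field.\<close>

lemma CHAR_eq_card_if_prime:
  assumes "card (UNIV :: 'a::{field,finite} set) = p" "Factorial_Ring.prime p"
  shows "CHAR('a) = p"
proof -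
  have "(\<Sum>x\<in>UNIV. x + 1 :: 'a) = (\<Sum>x\<in>UNIV. x)"
    by (rule sum.reindex_bij_witness[of _ "\<lambda>x. x - 1" "\<lambda>x. x + 1"]) auto
  then have "of_nat p = (0 :: 'a)" using assms(1) by (simp add: sum.distrib)
  then have "CHAR('a) dvd p" by (simp add: of_nat_eq_0_iff_char_dvd)
  moreover have "CHAR('a) \<noteq> 1" by (simp add: CHAR_not_1)
  ultimately show ?thesis using assms(2) by (auto simp: prime_nat_iff)
qed

theorem theorem1p2:
  fixes p n :: nat and e :: "nat \<Rightarrow> nat"
  assumes "card (UNIV :: 'a set) = p"
    and "n \<ge> 3"
    and "\<forall>i<n. e i > 0"
    and "(\<Prod>i<n. e i) \<ge> 2"
    and "Factorial_Ring.prime p"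
    and "p \<ge> 3 * (\<Prod>i<n. e i) - 2"
  shows "infinite {d::nat. \<exists>N. N \<lhd> (G_group n e :: ('a::{field,finite} mpoly \<Rightarrow> 'a mpoly) monoid)
                       \<and> (G_group n e Mod N) \<cong> alt_group d}"
  unfolding infinite_nat_iff_unbounded_le
proof
  fix D
  define E where "E = (\<Prod>i<n. e i)"
  \<comment> \<open>For \<open>E \<ge> 2\<close> the number \<open>3 * E - 2\<close> is at least 4
    and exceeds \<open>E\<close>; a prime of this size is odd, hence at least 5.\<close>
  have E: "2 \<le> E" "E < p" "4 \<le> p" using assms(4,6) by (auto simp: E_def)
  have odd: "odd p" using assms(5) E prime_odd_nat by auto
  then have p5: "5 \<le> p" using E by presburger
  \<comment> \<open>\<open>D\<close> makes the number of orbits large, \<open>E\<close> secures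
    \<open>E \<le> m\<close>, and 6 is the threshold of \<open>size_bound_prime\<close>.\<close>
  obtain m where m: "Factorial_Ring.prime m" "D + E + 6 < m" using bigger_prime by blast
  have CHAR: "CHAR('a alg_closure) = p" using CHAR_eq_card_if_prime[OF assms(1,5)] by simp
  interpret tame_group p m E "{x :: 'a alg_closure. x ^ (p ^ m) = x}" "{x. x ^ p = x}" n e
    by unfold_locales
      (use assms(2,3,5) m E CHAR size_bound_prime[OF p5 E(2), of m] in \<open>auto simp: E_def\<close>)
  have "D \<le> card orbs" using m_le_card_orbs m by simp
  then show "\<exists>d\<ge>D. d \<in> {d. \<exists>N. N \<lhd> (G_group n e :: ('a mpoly \<Rightarrow> 'a mpoly) monoid)
      \<and> (G_group n e Mod N) \<cong> alt_group d}"
    using alt_quotient[OF odd] by blast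
qed

end
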